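(* Let $A$ and $B$ be distinct rigidity circuits on vertices in $[n]$, let $e\in E(A)\cap E(B)$, and suppose $C=\mathrm{CR}(A,B,e)$ is a rigidity circuit. Let $p_A,p_B,p_C\in CM_n$ be the corresponding circuit polynomials. Then the resultant $\mathrm{Res}(p_A,p_B,x_e)$ is a nonzero polynomial lying in $CM_n\cap\mathbb{Q}[C]$; $p_C$ divides it; and every irreducible factor over $\mathbb{Q}$ of $\mathrm{Res}(p_A,p_B,x_e)$ that belongs to $CM_n$ is a nonzero rational multiple of $p_C$. Consequently, following a resultant tree of a rigidity circuit $C$, the circuit polynomial $p_C$ can be obtained inductively from the circuit polynomials of $K_4$ graphs by taking resultants and, at each step, selecting the unique (up to scalar) irreducible factor lying in the Cayley–Menger ideal.
   Context: Rigidity circuit: a graph $C=(V,E)$ (vertex set = endpoints of edges) with $|E|=2|V|-2$ such that every proper subset $V'\subsetneq V$ with $|V'|\ge 2$ spans at most $2|V'|-3$ edges. Combinatorial resultant $\mathrm{CR}(G_1,G_2,e)$ of distinct graphs with common edge $e$: vertex set $V_1\cup V_2$, edge set $(E_1\cup E_2)\setminus\{e\}$. A resultant tree of $C$ is a rooted binary tree with root $C$ whose nodes are rigidity circuits, each internal node being the combinatorial resultant of its two children on a common edge, and whose leaves are $K_4$'s. Let $X_n=\{x_{ij}:1\le i<j\le n\}$, where $x_{ij}$ is identified with the edge $ij$ of $K_n$; a set of variables is identified with the graph on the corresponding edges, and $\mathbb{Q}[S]$ denotes polynomials in the variables of $S$. The 2D Cayley–Menger ideal $CM_n\subset\mathbb{Q}[X_n]$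 is generated by all $5\times 5$ minors of the $(n+1)\times(n+1)$ symmetric Cayley–Menger matrix whose first row and column are $(0,1,\dots,1)$, with zero diagonal and $(i+1,j+1)$ entry $x_{ij}$ for $i<j$; it is a prime ideal. Its algebraic matroid on $X_n$ has as independent sets the $X\subseteq X_n$ with $CM_n\cap\mathbb{Q}[X]=\{0\}$, and its circuits are exactly the (edge sets of) rigidity circuits. For a circuit $C$, the circuit polynomial $p_C$ is the irreducible polynomial in $CM_n$ whose support (set of variables occurring) is exactly $C$; it is unique up to a nonzero rational scalar and generates $CM_n\cap\mathbb{Q}[C]$. $\mathrm{Res}(f,g,x)$ denotes the resultant of $f,g$ with respect to $x$, i.e. the determinant of their Sylvester matrix as polynomials in $x$. *)

theory Defs
  imports "Subresultants.Resultant_Prelim" "HOL-Library.Poly_Mapping"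
    "HOL-Computational_Algebra.Factorial_Ring"
begin

text \<open>An edge ij with i < j is the pair (i,j); the variable x_ij is identified with it.
  A monomial is a finitely supported exponent map on edges; a polynomial is a finitely
  supported map from monomials to rational coefficients (library Poly_Mapping, with its
  convolution product, a commutative ring with 1).\<close>

type_synonym edge = "nat \<times> nat"
type_synonym mono = "edge \<Rightarrow>\<^sub>0 nat"
type_synonym mpoly = "mono \<Rightarrow>\<^sub>0 rat"

definition Var :: "edge \<Rightarrow> mpoly" where
  "Var e = Poly_Mapping.single (Poly_Mapping.single e 1) 1"

definition Const :: "rat \<Rightarrow> mpoly" where
  "Const c = Poly_Mapping.single 0 c"

definition vars :: "mpoly \<Rightarrow> edge set" where
  "vars p = (\<Union>m\<in>Poly_Mapping.keys p. Poly_Mapping.keys m)"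

definition Xn :: "nat \<Rightarrow> edge set" where
  "Xn n = {(i, j). 1 \<le> i \<and> i < j \<and> j \<le> n}"

definition poly_in :: "edge set \<Rightarrow> mpoly set" where
  "poly_in S = {p. vars p \<subseteq> S}"

definition CM_entry :: "nat \<Rightarrow> nat \<Rightarrow> mpoly" where
  "CM_entry a b =
     (if a = b then 0
      else if a = 0 \<or> b = 0 then 1
      else Var (min a b, max a b))"

definition CM_matrix :: "nat \<Rightarrow> mpoly mat" where
  "CM_matrix n = mat (n + 1) (n + 1) (\<lambda>(a, b). CM_entry a b)"

definition CM_minors :: "nat \<Rightarrow> mpoly set" where
  "CM_minors n = {det (mat 5 5 (\<lambda>(a, b). CM_matrix n $$ (r a, c b))) | r c.
       strict_mono_on {..<5} r \<and> strict_mono_on {..<5} c \<and> r 4 \<le> n \<and> c 4 \<le> n}"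

definition CM :: "nat \<Rightarrow> mpoly set" where
  "CM n = {p. \<exists>k (h :: nat \<Rightarrow> mpoly) g.
      (\<forall>i<k. h i \<in> poly_in (Xn n) \<and> g i \<in> CM_minors n) \<and> p = (\<Sum>i<k. h i * g i)}"

definition to_univ :: "edge \<Rightarrow> mpoly \<Rightarrow> mpoly poly" where
  "to_univ e p = (\<Sum>m\<in>Poly_Mapping.keys p.
      monom (Poly_Mapping.single (Poly_Mapping.update e 0 m) (Poly_Mapping.lookup p m))
            (Poly_Mapping.lookup m e))"

definition Res :: "mpoly \<Rightarrow> mpoly \<Rightarrow> edge \<Rightarrow> mpoly" where
  "Res f g e = resultant (to_univ e f) (to_univ e g)"

definition verts :: "edge set \<Rightarrow> nat set" where
  "verts E = fst ` E \<union> snd ` E"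

definition span_edges :: "edge set \<Rightarrow> nat set \<Rightarrow> edge set" where
  "span_edges E V' = {e \<in> E. fst e \<in> V' \<and> snd e \<in> V'}"

definition rigidity_circuit :: "edge set \<Rightarrow> bool" where
  "rigidity_circuit E \<longleftrightarrow> finite E \<and>
     int (card E) = 2 * int (card (verts E)) - 2 \<and>
     (\<forall>V'. V' \<subset> verts E \<and> card V' \<ge> 2 \<longrightarrow>
        int (card (span_edges E V')) \<le> 2 * int (card V') - 3)"

definition CR :: "edge set \<Rightarrow> edge set \<Rightarrow> edge \<Rightarrow> edge set" where
  "CR E1 E2 e = (E1 \<union> E2) - {e}"

definition K4_on :: "nat set \<Rightarrow> edge set" where
  "K4_on S = {(i, j). i \<in> S \<and> j \<in> S \<and> i < j}"

definition is_K4 :: "nat \<Rightarrow> edge set \<Rightarrow> bool" where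
  "is_K4 n G \<longleftrightarrow> (\<exists>S. S \<subseteq> {1..n} \<and> card S = 4 \<and> G = K4_on S)"

definition circuit_poly :: "nat \<Rightarrow> edge set \<Rightarrow> mpoly \<Rightarrow> bool" where
  "circuit_poly n C p \<longleftrightarrow> p \<in> CM n \<and> irreducible p \<and> vars p = C"

inductive has_resultant_tree :: "nat \<Rightarrow> edge set \<Rightarrow> bool" for n where
  leaf: "is_K4 n G \<Longrightarrow> has_resultant_tree n G"
| node: "\<lbrakk>has_resultant_tree n A; has_resultant_tree n B; A \<noteq> B; e \<in> A \<inter> B;
          rigidity_circuit (CR A B e)\<rbrakk> \<Longrightarrow> has_resultant_tree n (CR A B e)"

inductive obtainable :: "nat \<Rightarrow> edge set \<Rightarrow> mpoly \<Rightarrow> bool" for n where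
  leaf: "\<lbrakk>is_K4 n G; circuit_poly n G p\<rbrakk> \<Longrightarrow> obtainable n G p"
| node: "\<lbrakk>obtainable n A pA; obtainable n B pB; A \<noteq> B; e \<in> A \<inter> B;
          rigidity_circuit (CR A B e); irreducible f; f dvd Res pA pB e; f \<in> CM n\<rbrakk>
          \<Longrightarrow> obtainable n (CR A B e) f"

end

theory Submission
  imports Defs "HOL-Library.Product_Lexorder"
begin

text \<open>
  The ideal \<open>CM n\<close> is the kernel of the generic length map \<open>x\<^sub>i\<^sub>j \<mapsto> (a\<^sub>i - a\<^sub>j) (b\<^sub>i - b\<^sub>j)\<close>, hence prime.
  That it contains the kernel is the second fundamental theorem for O(2): modulo the 3-minors of the
  Gram matrix \<open>Y\<close>, a linear section of \<open>Y\<^sub>i\<^sub>j \<mapsto> a\<^sub>i b\<^sub>j + a\<^sub>j b\<^sub>i\<close> is built by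
  writing \<open>2 a\<^sub>i b\<^sub>j\<close> as \<open>Y\<^sub>i\<^sub>j\<close> plus a skew form and replacing products of two skew forms
  by 2-minors of \<open>Y\<close>.

  By Laman's theorem, proved with Henneberg moves, a rigidity circuit becomes independent when an edge
  is deleted. So if \<open>p\<^sub>C\<close> did not divide some \<open>f\<close> in \<open>CM n\<close> supported on \<open>C\<close>, then by the Gauss lemma
  the resultant of \<open>p\<^sub>C\<close> and \<open>f\<close> would be a nonzero relation supported on a proper subset of \<open>C\<close>.
\<close>

section \<open>Polynomials and substitution\<close>

text \<open>Two obstacles shape the proof. First, \<open>CM n\<close> admits multipliers from
  \<open>poly_in (Xn n)\<close> only, and nothing is known about the variables of the cofactors that
  write a resultant as a combination of its arguments. In the kernel description such cofactors are
  harmless, since membership is the vanishing of one homomorphism. Second, a monomial in the a_i and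
  b_j does not say which a belongs to which b, whereas the lift is computed from a chosen pairing.
  Any two pairings are linked by exchanges of partners, a_i b_j a_k b_l = a_i b_l a_k b_j. Writing
  each 2 a_i b_j as a symmetric plus a skew part and separating by parity, an exchange becomes one
  identity between 2-minors of the Gram matrix and one relation linear in the skew forms, and the
  latter holds modulo 3-minors. Along a resultant tree the selected factor exists because the ideal
  is prime, and is unique because every element of the ideal supported on a circuit is a multiple of
  its circuit polynomial.\<close>

abbreviation "lk \<equiv> Poly_Mapping.lookup"
abbreviation "ks \<equiv> Poly_Mapping.keys"
abbreviation "sg \<equiv> Poly_Mapping.single"

lemma mpoly_decompose: "p = (\<Sum>m\<in>ks p. sg m (lk p m))" for p :: mpoly
  by (rule poly_mapping_eqI)
    (auto simp: lookup_sum lookup_single when_def sum.delta in_keys_iff)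

lemma mono_sum_single: "m = (\<Sum>e\<in>ks m. sg e (lk m e))" for m :: mono
  by (rule poly_mapping_eqI)
    (auto simp: lookup_sum lookup_single when_def sum.delta in_keys_iff)

lemma Var_times_single: "Var e * sg m c = sg (m + sg e 1) c"
  by (simp add: Var_def mult_single add.commute)

lemma Const_times_single: "Const a * sg m c = sg m (a * c)"
  by (simp add: Const_def mult_single)

lemma mono_induct [consumes 1, case_names zero add]:
  fixes m :: mono
  assumes "ks m \<subseteq> S" and "P 0" and "\<And>m e. e \<in> S \<Longrightarrow> P m \<Longrightarrow> P (m + sg e 1)"
  shows "P m"
proof -
  have "ks m \<subseteq> S \<longrightarrow> P m"
  proof (induction m rule: update_induct)
    case const
    then show ?case using assms by simp
  next
    case (update f a b)
    have eq: "Poly_Mapping.update a k f = f + sg a k" for k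
      using update(1)
      by (intro poly_mapping_eqI) (auto simp: lookup_update lookup_add lookup_single when_def in_keys_iff)
    have "P (f + sg a k)" if "P f" "a \<in> S" for k
    proof (induction k)
      case 0
      then show ?case using that by simp
    next
      case (Suc k)
      have "f + sg a (Suc k) = (f + sg a k) + sg a 1"
        by (simp add: add.assoc flip: single_add)
      then show ?case using assms(3)[OF that(2) Suc] by simp
    qed
    then show ?case using update by (auto simp: eq[symmetric] keys_update)
  qed
  then show ?thesis using assms by blast
qed

text \<open>The form suited to comparing ring homomorphisms: only constants, sums and a single
  variable factor have to be checked, and the support condition travels along.\<close>

lemma poly_in_induct [consumes 1, case_names Const add Var]:
  fixes p :: mpoly
  assumes "p \<in> poly_in S" and C: "\<And>c. P (Const c)" and A: "\<And>p q. P p \<Longrightarrow> P q \<Longrightarrow> P (p + q)"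
    and V: "\<And>e p. e \<in> S \<Longrightarrow> P p \<Longrightarrow> P (Var e * p)"
  shows "P p"
proof -
  have s: "P (sg m c)" if "ks m \<subseteq> S" for m c
    using that
  proof (induction m rule: mono_induct)
    case zero
    then show ?case using C[of c] by (simp add: Const_def)
  next
    case (add m e)
    then show ?case using V[of e "sg m c"] by (simp add: Var_times_single)
  qed
  have z: "P 0" using C[of 0] by (simp add: Const_def)
  have "P (\<Sum>m\<in>M. sg m (lk p m))" if "finite M" "M \<subseteq> ks p" for M
    using that
  proof (induction M rule: finite_induct)
    case (insert m M)
    have "ks m \<subseteq> S" using insert assms(1) by (auto simp: poly_in_def vars_def)
    then show ?case using insert A s by simp
  qed (use z in simp)
  from this[of "ks p"] show ?thesis using mpoly_decompose[of p] by simp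
qed

lemma mpoly_induct [case_names Const add Var]:
  fixes p :: mpoly
  assumes "\<And>c. P (Const c)" and "\<And>p q. P p \<Longrightarrow> P q \<Longrightarrow> P (p + q)"
    and "\<And>e p. P p \<Longrightarrow> P (Var e * p)"
  shows "P p"
  by (rule poly_in_induct[of p UNIV]) (auto simp: poly_in_def assms)

interpretation Const_hom: inj_comm_ring_hom Const
  by unfold_locales (auto simp: Const_def single_add mult_single dest: arg_cong[of _ _ "\<lambda>p. lk p 0"])

lemma vars_Const [simp]: "vars (Const c) = {}"
  by (simp add: vars_def Const_def)

lemma vars_Var [simp]: "vars (Var e) = {e}"
  by (simp add: vars_def Var_def)

lemma vars_0 [simp]: "vars 0 = {}" and vars_1 [simp]: "vars 1 = {}"
  by (simp_all add: vars_def)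

lemma finite_vars [simp]: "finite (vars p)"
  by (simp add: vars_def)

lemma vars_add: "vars (p + q) \<subseteq> vars p \<union> vars q"
  using keys_add[of p q] by (fastforce simp: vars_def)

lemma vars_uminus [simp]: "vars (- p) = vars p"
  by (simp add: vars_def keys_def)

lemma vars_mult: "vars (p * q) \<subseteq> vars p \<union> vars q"
proof
  fix e assume "e \<in> vars (p * q)"
  then obtain m where "m \<in> ks (p * q)" "e \<in> ks m" by (auto simp: vars_def)
  then obtain a b where "a \<in> ks p" "b \<in> ks q" "e \<in> ks (a + b)"
    using keys_mult[of p q] by auto
  then show "e \<in> vars p \<union> vars q"
    using keys_add[of a b] by (auto simp: vars_def)
qed

lemma poly_in_mono: "p \<in> poly_in S \<Longrightarrow> S \<subseteq> T \<Longrightarrow> p \<in> poly_in T"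
  by (auto simp: poly_in_def)

lemma poly_in_vars: "p \<in> poly_in (vars p)"
  by (simp add: poly_in_def)

lemma poly_in_Const [simp]: "Const c \<in> poly_in S"
  and poly_in_0 [simp]: "0 \<in> poly_in S" and poly_in_1 [simp]: "1 \<in> poly_in S"
  and poly_in_Var [simp]: "Var e \<in> poly_in S \<longleftrightarrow> e \<in> S"
  by (auto simp: poly_in_def)

lemma poly_in_add [intro]: "p \<in> poly_in S \<Longrightarrow> q \<in> poly_in S \<Longrightarrow> p + q \<in> poly_in S"
  using vars_add[of p q] by (auto simp: poly_in_def)

lemma poly_in_mult [intro]: "p \<in> poly_in S \<Longrightarrow> q \<in> poly_in S \<Longrightarrow> p * q \<in> poly_in S"
  using vars_mult[of p q] by (auto simp: poly_in_def)

lemma poly_in_uminus [intro]: "p \<in> poly_in S \<Longrightarrow> - p \<in> poly_in S"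
  by (auto simp: poly_in_def)

lemma poly_in_diff [intro]: "p \<in> poly_in S \<Longrightarrow> q \<in> poly_in S \<Longrightarrow> p - q \<in> poly_in S"
  using poly_in_add[of p S "- q"] by auto

lemma poly_in_sum [intro]: "(\<And>i. i \<in> I \<Longrightarrow> f i \<in> poly_in S) \<Longrightarrow> sum f I \<in> poly_in S"
  by (induction I rule: infinite_finite_induct) auto

lemma poly_in_prod [intro]: "(\<And>i. i \<in> I \<Longrightarrow> f i \<in> poly_in S) \<Longrightarrow> prod f I \<in> poly_in S"
  by (induction I rule: infinite_finite_induct) auto

lemma poly_in_power [intro]: "p \<in> poly_in S \<Longrightarrow> p ^ k \<in> poly_in S"
  by (induction k) auto

lemma poly_in_empty: "p \<in> poly_in {} \<Longrightarrow> \<exists>c. p = Const c"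
  by (induction p rule: poly_in_induct) (auto simp flip: Const_hom.hom_add)

lemma poly_in_det:
  assumes "A \<in> carrier_mat n n" "\<And>i j. i < n \<Longrightarrow> j < n \<Longrightarrow> A $$ (i, j) \<in> poly_in S"
  shows "det A \<in> poly_in S"
proof -
  have "signof p * (\<Prod>i = 0..<n. A $$ (i, p i)) \<in> poly_in S" if "p permutes {0..<n}" for p
  proof -
    have "(\<Prod>i = 0..<n. A $$ (i, p i)) \<in> poly_in S"
      using that permutes_in_image[OF that] by (intro poly_in_prod assms) auto
    then show ?thesis by (auto simp: sign_def)
  qed
  then show ?thesis using assms(1) by (auto simp: det_def)
qed

section \<open>Evaluation homomorphisms\<close>

definition psubst :: "(rat \<Rightarrow> 'a :: comm_ring_1) \<Rightarrow> (edge \<Rightarrow> 'a) \<Rightarrow> mpoly \<Rightarrow> 'a" where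
  "psubst c s p = (\<Sum>m\<in>ks p. c (lk p m) * (\<Prod>e\<in>ks m. s e ^ lk m e))"

locale rat_algebra = comm_ring_hom c for c :: "rat \<Rightarrow> 'a :: comm_ring_1"
begin

lemma psubst_single: "psubst c s (sg m a) = c a * (\<Prod>e\<in>ks m. s e ^ lk m e)"
  by (auto simp: psubst_def)

lemma psubst_Const [simp]: "psubst c s (Const a) = c a"
  using psubst_single[of s 0 a] by (simp add: Const_def)

lemma psubst_Var [simp]: "psubst c s (Var e) = s e"
  by (simp add: Var_def psubst_single)

lemma psubst_add: "psubst c s (p + q) = psubst c s p + psubst c s q"
  unfolding psubst_def by (rule setsum_keys_plus_distrib) (auto simp: hom_distribs algebra_simps)

lemma mono_prod_add:
  "(\<Prod>e\<in>ks (m + m'). s e ^ lk (m + m') e) = (\<Prod>e\<in>ks m. s e ^ lk m e) * (\<Prod>e\<in>ks m'. (s e :: 'a) ^ lk m' e)"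
  for m m' :: mono
proof -
  let ?A = "ks m \<union> ks m'"
  have *: "(\<Prod>e\<in>ks k. s e ^ lk k e) = (\<Prod>e\<in>?A. s e ^ lk k e)" if "ks k \<subseteq> ?A" for k :: mono
    using that by (intro prod.mono_neutral_left) (auto simp: in_keys_iff)
  show ?thesis
    by (subst (1 2 3) *) (auto simp: lookup_add power_add prod.distrib in_keys_iff)
qed

lemma psubst_0 [simp]: "psubst c s 0 = 0"
  by (simp add: psubst_def)

lemma psubst_1 [simp]: "psubst c s 1 = 1"
  using psubst_Const[of s 1] by simp

lemma psubst_sum: "psubst c s (sum f I) = (\<Sum>i\<in>I. psubst c s (f i))"
  by (induction I rule: infinite_finite_induct) (simp_all add: psubst_add)

lemma psubst_mult: "psubst c s (p * q) = psubst c s p * psubst c s q"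
proof -
  have "p * q = (\<Sum>m\<in>ks p. sg m (lk p m)) * (\<Sum>m\<in>ks q. sg m (lk q m))"
    using mpoly_decompose[of p] mpoly_decompose[of q] by simp
  also have "\<dots> = (\<Sum>m\<in>ks p. \<Sum>k\<in>ks q. sg (m + k) (lk p m * lk q k))"
    by (simp add: sum_product mult_single)
  also have "psubst c s \<dots> = (\<Sum>m\<in>ks p. \<Sum>k\<in>ks q. psubst c s (sg m (lk p m)) * psubst c s (sg k (lk q k)))"
    by (simp add: psubst_sum psubst_single mono_prod_add hom_mult mult_ac)
  also have "\<dots> = psubst c s (\<Sum>m\<in>ks p. sg m (lk p m)) * psubst c s (\<Sum>m\<in>ks q. sg m (lk q m))"
    by (simp add: psubst_sum sum_product)
  finally show ?thesis
    using mpoly_decompose[of p] mpoly_decompose[of q] by simp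
qed

lemma psubst_hom: "comm_ring_hom (psubst c s)"
  by unfold_locales (simp_all add: psubst_add psubst_mult)

end

interpretation Const_alg: rat_algebra Const ..

interpretation pConst_alg: rat_algebra "\<lambda>a. [:Const a:]"
  by unfold_locales (simp_all add: Const_hom.hom_add Const_hom.hom_mult)

lemma psubst_Var_id [simp]: "psubst Const Var p = p"
  by (induction p rule: mpoly_induct) (simp_all add: Const_alg.psubst_add Const_alg.psubst_mult)

text \<open>The monomialwise definition of \<open>to_univ\<close> is awkward to multiply with; as a
  substitution it inherits the ring laws from \<open>psubst\<close>.\<close>

lemma to_univ_eq_psubst:
  "to_univ e p = psubst (\<lambda>a. [:Const a:]) (\<lambda>x. if x = e then [:0, 1:] else [:Var x:]) p"
proof -
  have "monom (sg (Poly_Mapping.update e 0 m) a) (lk m e) =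
      [:Const a:] * (\<Prod>x\<in>ks m. (if x = e then [:0, 1:] else [:Var x:]) ^ lk m x)" (is "_ = _ * prod ?f _") for m a
  proof -
    have pw: "[:Var x:] ^ k = [:Var x ^ k:]" for x k by (induction k) simp_all
    have pr: "(\<Prod>x\<in>A. [:g x:]) = [:\<Prod>x\<in>A. g x:]" for A and g :: "edge \<Rightarrow> mpoly"
      by (induction A rule: infinite_finite_induct) simp_all
    have vs: "Var x ^ k = sg (sg x k) 1" for x k
      by (induction k) (simp_all add: Var_def mult_single flip: single_add)
    have sp: "(\<Prod>x\<in>A. sg (g x) 1) = sg (sum g A) 1" for A and g :: "edge \<Rightarrow> mono"
      by (induction A rule: infinite_finite_induct) (simp_all add: mult_single)
    have x: "[:0, 1:] ^ lk m e = monom 1 (lk m e)" by (simp add: monom_altdef)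
    have "prod ?f (ks m) = ?f e * prod ?f (ks m - {e})"
      by (cases "e \<in> ks m") (auto simp: prod.remove in_keys_iff)
    also have "prod ?f (ks m - {e}) = [: \<Prod>x\<in>ks m - {e}. Var x ^ lk m x :]"
      unfolding pr[symmetric] by (intro prod.cong) (auto simp: pw)
    also have "(\<Prod>x\<in>ks m - {e}. Var x ^ lk m x) = sg (\<Sum>x\<in>ks m - {e}. sg x (lk m x)) 1"
      by (simp add: vs sp)
    also have "(\<Sum>x\<in>ks m - {e}. sg x (lk m x)) = Poly_Mapping.update e 0 m"
      by (rule poly_mapping_eqI) (auto simp: lookup_sum lookup_single lookup_update when_def in_keys_iff)
    finally show ?thesis
      by (simp add: x smult_monom Const_times_single mult.commute)
  qed
  then show ?thesis
    by (simp add: to_univ_def psubst_def)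
qed

section \<open>Unique factorization and resultants\<close>

lemma to_univ_hom: "comm_ring_hom (to_univ e)"
proof -
  have "to_univ e = psubst (\<lambda>a. [:Const a:]) (\<lambda>x. if x = e then [:0, 1:] else [:Var x:])"
    by (rule ext) (rule to_univ_eq_psubst)
  then show ?thesis using pConst_alg.psubst_hom by simp
qed

interpretation to_univ: comm_ring_hom "to_univ e" for e
  by (rule to_univ_hom)

lemma to_univ_Const [simp]: "to_univ e (Const a) = [:Const a:]"
  by (simp add: to_univ_eq_psubst)

lemma to_univ_Var: "to_univ e (Var x) = (if x = e then [:0, 1:] else [:Var x:])"
  by (simp add: to_univ_eq_psubst)

lemma poly_to_univ [simp]: "poly (to_univ e p) (Var e) = p"
  by (induction p rule: mpoly_induct) (simp_all add: to_univ.hom_add to_univ.hom_mult to_univ_Var)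

interpretation to_univ: inj_comm_ring_hom "to_univ e" for e
proof unfold_locales
  show "p = 0" if "to_univ e p = 0" for p
    using poly_to_univ[of e p] that by simp
qed

lemma coeff_to_univ_in: "p \<in> poly_in S \<Longrightarrow> coeff (to_univ e p) k \<in> poly_in (S - {e})"
proof (induction p arbitrary: k rule: poly_in_induct)
  case (Const c)
  then show ?case by (simp add: coeff_pCons split: nat.split)
next
  case (add p q)
  then show ?case by (auto simp: to_univ.hom_add)
next
  case (Var x p)
  then show ?case by (auto simp: to_univ.hom_mult to_univ_Var coeff_pCons split: nat.split)
qed

lemma to_univ_free: "p \<in> poly_in S \<Longrightarrow> e \<notin> S \<Longrightarrow> to_univ e p = [:p:]"
  by (induction p rule: poly_in_induct) (auto simp: to_univ.hom_add to_univ.hom_mult to_univ_Var)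

abbreviation "dg e p \<equiv> degree (to_univ e p)"

lemma dg_pos_iff: "0 < dg e p \<longleftrightarrow> e \<in> vars p"
proof
  assume "0 < dg e p"
  then show "e \<in> vars p" using to_univ_free[OF poly_in_vars, of e p] by (cases "e \<in> vars p") simp_all
next
  assume e: "e \<in> vars p"
  show "0 < dg e p"
  proof (rule ccontr)
    assume "\<not> 0 < dg e p"
    then obtain c where c: "to_univ e p = [:c:]" by (metis degree_eq_zeroE gr0I)
    have "c \<in> poly_in (vars p - {e})"
      using coeff_to_univ_in[OF poly_in_vars, of e p 0] c by simp
    moreover have "p = c" using poly_to_univ[of e p] c by simp
    ultimately show False using e by (auto simp: poly_in_def)
  qed
qed

text \<open>Rests on \<open>mpoly\<close> having no zero divisors, where the lexicographic order on
  edges supplies the linear order of monomials.\<close>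

lemma dg_mult: "p \<noteq> 0 \<Longrightarrow> q \<noteq> 0 \<Longrightarrow> dg e (p * q) = dg e p + dg e q"
  by (simp add: to_univ.hom_mult degree_mult_eq)

lemma vars_mult_eq: "p \<noteq> 0 \<Longrightarrow> q \<noteq> 0 \<Longrightarrow> vars (p * q) = vars p \<union> vars q"
  using dg_pos_iff[of _ "p * q"] dg_pos_iff[of _ p] dg_pos_iff[of _ q] dg_mult[of p q] by auto

lemma dvd_vars: "p dvd q \<Longrightarrow> q \<noteq> 0 \<Longrightarrow> vars p \<subseteq> vars q"
  by (auto simp: vars_mult_eq)

lemma unit_mpoly: "p dvd 1 \<Longrightarrow> \<exists>c. c \<noteq> 0 \<and> p = Const c" for p :: mpoly
proof -
  assume "p dvd 1"
  then have "vars p \<subseteq> {}" using dvd_vars[of p 1] by simp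
  then have "p \<in> poly_in {}" by (auto simp: poly_in_def)
  then obtain c where "p = Const c" using poly_in_empty by blast
  then show ?thesis using \<open>p dvd 1\<close> by (cases "c = 0") auto
qed

lemma unit_Const: "c \<noteq> 0 \<Longrightarrow> Const c dvd 1"
  by (rule dvdI[of _ _ "Const (1 / c)"]) (simp flip: Const_hom.hom_mult)

section \<open>Total degree and factorization into irreducibles\<close>

definition homog :: "mpoly \<Rightarrow> mpoly poly" where
  "homog = psubst (\<lambda>a. [:Const a:]) (\<lambda>x. [:0, Var x:])"

interpretation homog: comm_ring_hom homog
  unfolding homog_def by (rule pConst_alg.psubst_hom)

lemma poly_homog [simp]: "poly (homog p) 1 = p"
  by (induction p rule: mpoly_induct) (simp_all add: homog.hom_add homog.hom_mult, simp_all add: homog_def)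

interpretation homog: inj_comm_ring_hom homog
proof unfold_locales
  show "p = 0" if "homog p = 0" for p
    using poly_homog[of p] that by simp
qed

text \<open>The map \<open>homog\<close> attaches one indeterminate t to every variable, so this is
  the total degree. It serves as a termination measure for factorization.\<close>

definition tdeg :: "mpoly \<Rightarrow> nat" where "tdeg p = degree (homog p)"

lemma tdeg_mult: "p \<noteq> 0 \<Longrightarrow> q \<noteq> 0 \<Longrightarrow> tdeg (p * q) = tdeg p + tdeg q"
  by (simp add: tdeg_def homog.hom_mult degree_mult_eq)

definition mdeg :: "mono \<Rightarrow> nat" where "mdeg m = (\<Sum>e\<in>ks m. lk m e)"

lemma coeff_homog: "lk (coeff (homog p) k) m = (if mdeg m = k then lk p m else 0)"
proof -
  have "[:Const a:] * (\<Prod>e\<in>ks m. [:0, Var e:] ^ lk m e) = monom (sg m a) (mdeg m)" for m a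
  proof -
    have "[:0, Var e:] ^ k = monom (sg (sg e k) 1) k" for e k
      by (induction k) (simp_all add: Var_def mult_single flip: single_add, simp_all add: monom_Suc Var_def mult_single smult_monom flip: single_add)
    moreover have "(\<Prod>e\<in>A. monom (sg (g e) 1) (n e)) = monom (sg (sum g A) (1::rat)) (sum n A)"
      for A and g :: "edge \<Rightarrow> mono" and n
      by (induction A rule: infinite_finite_induct) (simp_all add: mult_single mult_monom monom_0)
    ultimately have "(\<Prod>e\<in>ks m. [:0, Var e:] ^ lk m e) = monom (sg m 1) (mdeg m)"
      using mono_sum_single[of m] by (simp add: mdeg_def)
    then show ?thesis by (simp add: smult_monom Const_times_single)
  qed
  then have "homog p = (\<Sum>m\<in>ks p. monom (sg m (lk p m)) (mdeg m))"
    by (simp add: homog_def psubst_def)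
  then have "lk (coeff (homog p) k) m = (\<Sum>i\<in>ks p. if i = m then if mdeg m = k then lk p m else 0 else 0)"
    unfolding \<open>homog p = _\<close> coeff_sum lookup_sum coeff_monom by (intro sum.cong) (auto simp: lookup_single when_def)
  then show ?thesis by (auto simp: in_keys_iff)
qed

lemma tdeg_0_imp_unit: "tdeg p = 0 \<Longrightarrow> p \<noteq> 0 \<Longrightarrow> p dvd 1"
proof -
  assume t: "tdeg p = 0" and p: "p \<noteq> 0"
  have "lk p m = 0" if "m \<noteq> 0" for m
  proof -
    obtain e where "lk m e \<noteq> 0" using \<open>m \<noteq> 0\<close> by (metis lookup_zero poly_mapping_eqI)
    then have "mdeg m > 0" by (auto simp: mdeg_def in_keys_iff intro!: sum_pos2[of _ e])
    then have "coeff (homog p) (mdeg m) = 0" using t by (simp add: tdeg_def coeff_eq_0)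
    then show ?thesis using coeff_homog[of p "mdeg m" m] by simp
  qed
  then have "p = Const (lk p 0)"
    by (intro poly_mapping_eqI) (auto simp: Const_def lookup_single when_def)
  then show ?thesis using unit_Const[of "lk p 0"] p by (metis Const_hom.hom_zero)
qed

lemma ex_irreducible_factor:
  fixes p :: mpoly
  assumes "p \<noteq> 0" "\<not> p dvd 1"
  shows "\<exists>f. irreducible f \<and> f dvd p"
  using assms
proof (induction "tdeg p" arbitrary: p rule: less_induct)
  case less
  show ?case
  proof (cases "irreducible p")
    case False
    then obtain a b where ab: "p = a * b" "\<not> a dvd 1" "\<not> b dvd 1"
      using less.prems by (auto simp: irreducible_def)
    then have nz: "a \<noteq> 0" "b \<noteq> 0" using less.prems by auto
    then have "tdeg a < tdeg p" using ab tdeg_0_imp_unit[of b] by (auto simp: tdeg_mult)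
    then obtain f where "irreducible f" "f dvd a" using less.hyps ab nz by blast
    then show ?thesis using ab by auto
  qed auto
qed

text \<open>Needs only the existence of irreducible factors, so it is available before irreducible
  elements are known to be prime.\<close>

lemma factor_induct [consumes 1, case_names unit mult]:
  fixes p :: mpoly
  assumes "p \<noteq> 0" and U: "\<And>u. u dvd 1 \<Longrightarrow> P u"
    and M: "\<And>f q. irreducible f \<Longrightarrow> q \<noteq> 0 \<Longrightarrow> P q \<Longrightarrow> P (f * q)"
  shows "P p"
  using assms(1)
proof (induction "tdeg p" arbitrary: p rule: less_induct)
  case less
  show ?case
  proof (cases "p dvd 1")
    case False
    then obtain f q where f: "irreducible f" "p = f * q"
      using ex_irreducible_factor less.prems by (metis dvdE)
    then have nz: "f \<noteq> 0" "q \<noteq> 0" using less.prems by auto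
    moreover have "tdeg f \<noteq> 0" using f nz tdeg_0_imp_unit[of f] by (auto simp: irreducible_def)
    ultimately have "P q" using less.hyps f(2) by (simp add: tdeg_mult)
    then show ?thesis using M f nz by simp
  qed (use U in blast)
qed

section \<open>Irreducible polynomials are prime\<close>

definition prime_on :: "edge set \<Rightarrow> mpoly \<Rightarrow> bool" where
  "prime_on S f \<longleftrightarrow> (\<forall>g\<in>poly_in S. \<forall>h\<in>poly_in S. f dvd g * h \<longrightarrow> f dvd g \<or> f dvd h)"

lemma dvd_iff_coeffs:
  assumes "f \<in> poly_in S" "y \<notin> S"
  shows "f dvd g \<longleftrightarrow> (\<forall>i. f dvd coeff (to_univ y g) i)"
proof -
  have U: "to_univ y f = [:f:]" using assms by (rule to_univ_free)
  have "f dvd g" if a: "[:f:] dvd to_univ y g"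
  proof -
    obtain k where "to_univ y g = [:f:] * k" using a by blast
    then have "poly (to_univ y g) (Var y) = poly ([:f:] * k) (Var y)" by simp
    then have "g = f * poly k (Var y)" by (simp only: poly_to_univ poly_mult) simp
    then show ?thesis by simp
  qed
  moreover have "f dvd g \<Longrightarrow> [:f:] dvd to_univ y g"
    using to_univ.hom_dvd[of f g y] U by simp
  ultimately show ?thesis using const_poly_dvd_iff[of f "to_univ y g"] by auto
qed

lemma prime_on_insert:
  assumes "f \<in> poly_in S" "prime_on S f" "y \<notin> S"
  shows "prime_on (insert y S) f"
  unfolding prime_on_def
proof (intro ballI impI, rule ccontr)
  fix g h assume g: "g \<in> poly_in (insert y S)" and h: "h \<in> poly_in (insert y S)"
    and d: "f dvd g * h" and n: "\<not> (f dvd g \<or> f dvd h)"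
  note dv = dvd_iff_coeffs[OF assms(1,3)]
  let ?G = "to_univ y g" and ?H = "to_univ y h"
  define i where "i = (LEAST i. \<not> f dvd coeff ?G i)"
  define j where "j = (LEAST j. \<not> f dvd coeff ?H j)"
  have "\<exists>i. \<not> f dvd coeff ?G i" "\<exists>j. \<not> f dvd coeff ?H j"
    using n unfolding dv[of g] dv[of h] by auto
  from LeastI_ex[OF this(1)] LeastI_ex[OF this(2)]
  have i: "\<not> f dvd coeff ?G i" and j: "\<not> f dvd coeff ?H j" unfolding i_def j_def .
  have li: "f dvd coeff ?G k" if "k < i" for k using that not_less_Least unfolding i_def by blast
  have lj: "f dvd coeff ?H k" if "k < j" for k using that not_less_Least unfolding j_def by blast
  have "coeff (?G * ?H) (i + j) = (\<Sum>k\<le>i+j. coeff ?G k * coeff ?H (i + j - k))"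
    by (rule coeff_mult)
  also have "\<dots> = coeff ?G i * coeff ?H j + (\<Sum>k\<in>{..i+j} - {i}. coeff ?G k * coeff ?H (i + j - k))"
    by (subst sum.remove[of _ i]) auto
  finally have eq: "coeff ?G i * coeff ?H j = coeff (to_univ y (g * h)) (i + j) -
      (\<Sum>k\<in>{..i+j} - {i}. coeff ?G k * coeff ?H (i + j - k))"
    by (simp add: to_univ.hom_mult)
  have "f dvd (\<Sum>k\<in>{..i+j} - {i}. coeff ?G k * coeff ?H (i + j - k))"
  proof (rule dvd_sum)
    fix k assume "k \<in> {..i+j} - {i}"
    then have "k < i \<or> i + j - k < j" by auto
    then show "f dvd coeff ?G k * coeff ?H (i + j - k)" using li lj by auto
  qed
  then have "f dvd coeff ?G i * coeff ?H j" unfolding eq using d unfolding dv[of "g * h"] by (intro dvd_diff) auto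
  moreover have "coeff ?G i \<in> poly_in S" "coeff ?H j \<in> poly_in S"
    using coeff_to_univ_in[OF g, of y i] coeff_to_univ_in[OF h, of y j] assms(3)
    by (auto intro: poly_in_mono)
  ultimately show False using assms(2) i j by (auto simp: prime_on_def)
qed

text \<open>The two factors of a product involve only finitely many variables outside
  \<open>S\<close>; these are adjoined one at a time.\<close>

lemma prime_on_imp_prime_elem:
  assumes f: "f \<in> poly_in S" "prime_on S f" "irreducible f"
  shows "prime_elem f"
proof (rule prime_elemI)
  show "f \<noteq> 0" "\<not> f dvd 1" using f(3) by (auto simp: irreducible_def)
  fix g h assume d: "f dvd g * h"
  have *: "prime_on (S \<union> T) f" if "finite T" for T
    using that
  proof (induction T rule: finite_induct)
    case (insert y T)
    then show ?case
      using prime_on_insert[of f "S \<union> T" y] poly_in_mono[OF f(1), of "S \<union> T"]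
      by (cases "y \<in> S \<union> T") (auto simp: insert_absorb)
  qed (use f in simp)
  have "prime_on (S \<union> (vars g \<union> vars h)) f" by (rule *) simp
  moreover have "g \<in> poly_in (S \<union> (vars g \<union> vars h))" "h \<in> poly_in (S \<union> (vars g \<union> vars h))"
    by (auto simp: poly_in_def)
  ultimately show "f dvd g \<or> f dvd h" using d by (auto simp: prime_on_def)
qed

lemma irreducible_assoc:
  fixes f g :: mpoly
  assumes "irreducible f" "irreducible g" "f dvd g"
  shows "\<exists>c. c \<noteq> 0 \<and> g = Const c * f"
proof -
  obtain u where u: "g = f * u" using assms(3) by blast
  then have "u dvd 1" using assms by (auto simp: irreducible_def)
  then show ?thesis using unit_mpoly[of u] u by (auto simp: mult.commute)
qed

lemma vars_Const_mult: "c \<noteq> 0 \<Longrightarrow> vars (Const c * f) = vars f"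
  by (cases "f = 0") (auto simp: vars_mult_eq)

text \<open>The induction step on the number of variables. Polynomials in \<open>W\<close> act as
  the scalars of a field of fractions with denominators cleared, and \<open>e\<close> is the one
  remaining variable.\<close>

locale gauss_step =
  fixes f :: mpoly and e :: edge and W :: "edge set"
  assumes irr: "irreducible f" and ef: "e \<in> vars f"
    and eW: "e \<notin> W"
    and primes: "\<And>g. irreducible g \<Longrightarrow> vars g \<subseteq> W \<Longrightarrow> prime_elem g"
begin

lemma not_dvd: "irreducible g \<Longrightarrow> vars g \<subseteq> W \<Longrightarrow> \<not> g dvd f"
  using irreducible_assoc[of g f] irr ef eW by (metis subsetD vars_Const_mult)

text \<open>A prime factor of \<open>c\<close> cannot divide \<open>f\<close>, which is irreducible
  and contains \<open>e\<close>; hence it divides the cofactor and can be cancelled.\<close>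

lemma cancel_factor:
  assumes "c \<noteq> 0" "c \<in> poly_in W" "f dvd c * g"
  shows "f dvd g"
  using assms
proof (induction c arbitrary: g rule: factor_induct)
  case (unit u)
  then show ?case using dvd_mult_unit_iff'[of u f g] by simp
next
  case (mult p q)
  have p0: "p \<noteq> 0" using mult(1) by auto
  then have v: "vars p \<subseteq> W" "q \<in> poly_in W"
    using vars_mult_eq[of p q] mult(2) mult.prems(1) by (auto simp: poly_in_def)
  obtain k where k: "p * q * g = f * k" using mult.prems by blast
  have "p dvd f * k" unfolding k[symmetric] by (simp add: mult.assoc)
  then have "p dvd k" using primes[OF mult(1) v(1)] not_dvd[OF mult(1) v(1)]
    by (meson prime_elem_dvd_multD)
  then obtain k' where "k = p * k'" by blast
  then have "p * (q * g) = p * (f * k')" using k by (simp add: ac_simps)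
  then have "q * g = f * k'" using p0 by simp
  then show ?case using mult v by simp
qed

text \<open>Gauss's lemma: a factorization of \<open>f\<close> up to a scalar from \<open>W\<close>
  becomes an honest one once the primes of the scalar are distributed over the two factors.\<close>

lemma split_factor:
  assumes "c \<noteq> 0" "c \<in> poly_in W" "c * f = d * q"
  shows "\<exists>c1 c2 d' q'. c1 \<in> poly_in W \<and> d = c1 * d' \<and> q = c2 * q' \<and> f = d' * q'"
  using assms
proof (induction c arbitrary: d q rule: factor_induct)
  case (unit u)
  then obtain v where v: "1 = u * v" by blast
  have "f = (u * v) * f" using v by simp
  also have "\<dots> = v * (u * f)" by (simp add: ac_simps)
  also have "u * f = d * q" using unit by simp
  finally have "f = d * (v * q)" by (simp add: ac_simps)
  moreover have "q = u * (v * q)" using v by (simp flip: mult.assoc)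
  ultimately have "1 \<in> poly_in W \<and> d = 1 * d \<and> q = u * (v * q) \<and> f = d * (v * q)" by simp
  then show ?case by blast
next
  case (mult p c)
  then have v: "vars p \<subseteq> W" "c \<in> poly_in W" "p \<in> poly_in W" and p0: "p \<noteq> 0"
    using vars_mult_eq[of p c] by (auto simp: poly_in_def irreducible_def)
  have "p dvd d * q" unfolding mult.prems(2)[symmetric] by (simp add: mult.assoc)
  then consider "p dvd d" | "p dvd q" using primes[OF mult(1) v(1)] by (meson prime_elem_dvd_multD)
  then show ?case
  proof cases
    case 1
    then obtain d0 where d0: "d = p * d0" by blast
    then have "c * f = d0 * q" using mult.prems p0 by (simp add: mult.assoc)
    then obtain c1 c2 d' q' where "c1 \<in> poly_in W" "d0 = c1 * d'" "q = c2 * q'" "f = d' * q'"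
      using mult.IH v by blast
    then have "p * c1 \<in> poly_in W \<and> d = (p * c1) * d' \<and> q = c2 * q' \<and> f = d' * q'"
      using d0 v by (auto simp: mult.assoc)
    then show ?thesis by blast
  next
    case 2
    then obtain q0 where q0: "q = p * q0" by blast
    then have "c * f = d * q0" using mult.prems p0 by (simp add: mult.assoc mult.left_commute)
    then obtain c1 c2 d' q' where "c1 \<in> poly_in W" "d = c1 * d'" "q0 = c2 * q'" "f = d' * q'"
      using mult.IH v by blast
    then have "c1 \<in> poly_in W \<and> d = c1 * d' \<and> q = (p * c2) * q' \<and> f = d' * q'"
      using q0 by (auto simp: mult.assoc)
    then show ?thesis by blast
  qed
qed

end

lemma pseudo_division:
  assumes d: "d \<in> poly_in (insert e W)" "d \<noteq> 0" and e: "e \<notin> W" and p: "p \<in> poly_in (insert e W)"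
  shows "\<exists>c q r. c \<noteq> 0 \<and> c \<in> poly_in W \<and> q \<in> poly_in (insert e W) \<and> r \<in> poly_in (insert e W) \<and>
    c * p = q * d + r \<and> (r = 0 \<or> dg e r < dg e d)"
  using p
proof (induction "dg e p" arbitrary: p rule: less_induct)
  case less
  have lc: "coeff (to_univ e a) k \<in> poly_in W" if "a \<in> poly_in (insert e W)" for a k
    using coeff_to_univ_in[OF that, of e k] e by simp
  have WW: "a \<in> poly_in (insert e W)" if "a \<in> poly_in W" for a
    using that by (auto intro: poly_in_mono)
  show ?case
  proof (cases "p = 0 \<or> dg e p < dg e d")
    case True
    then show ?thesis using less.prems by (intro exI[of _ 1] exI[of _ 0] exI[of _ p]) auto
  next
    case False
    define k where "k = dg e p - dg e d"
    define lp where "lp = lead_coeff (to_univ e p)"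
    define ld where "ld = lead_coeff (to_univ e d)"
    \<comment> \<open>Cross-multiplying by the leading coefficients cancels the top term in
      \<open>e\<close>.\<close>
    define p' where "p' = ld * p - lp * Var e ^ k * d"
    have l: "lp \<in> poly_in W" "ld \<in> poly_in W" and ld0: "ld \<noteq> 0"
      using lc less.prems d by (auto simp: lp_def ld_def)
    have p'in: "p' \<in> poly_in (insert e W)"
      unfolding p'_def using l[THEN WW] less.prems d by (intro poly_in_diff poly_in_mult poly_in_power) auto
    have "to_univ e p' = smult ld (to_univ e p) - smult lp (monom 1 k * to_univ e d)"
      using to_univ_free[OF l(1) e] to_univ_free[OF l(2) e]
      by (simp add: p'_def to_univ.hom_minus to_univ.hom_mult to_univ.hom_power to_univ_Var monom_altdef mult.assoc)
    moreover have "degree \<dots> \<le> dg e p"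
    proof (rule degree_diff_le)
      show "degree (smult lp (monom 1 k * to_univ e d)) \<le> dg e p"
        by (rule order.trans[OF degree_smult_le], rule order.trans[OF degree_mult_le])
          (use False in \<open>auto simp: k_def degree_monom_eq\<close>)
    qed (rule degree_smult_le)
    moreover have "coeff (smult ld (to_univ e p) - smult lp (monom 1 k * to_univ e d)) (dg e p) = 0"
    proof -
      have "coeff (monom 1 k * to_univ e d) (dg e p) = ld"
        using False by (simp add: coeff_monom_mult k_def ld_def)
      then show ?thesis by (simp add: lp_def mult.commute[of ld])
    qed
    ultimately have "p' = 0 \<or> dg e p' < dg e p"
      using leading_coeff_0_iff[of "to_univ e p'"] to_univ.hom_0_iff[of e p'] by (auto simp: order_le_less)
    then have "\<exists>c q r. c \<noteq> 0 \<and> c \<in> poly_in W \<and> q \<in> poly_in (insert e W) \<and> r \<in> poly_in (insert e W) \<and>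
      c * p' = q * d + r \<and> (r = 0 \<or> dg e r < dg e d)"
    proof
      assume "p' = 0"
      then show ?thesis by (intro exI[of _ 1] exI[of _ 0]) auto
    qed (use less.hyps p'in in blast)
    then obtain c q r where c: "c \<noteq> 0" "c \<in> poly_in W" "q \<in> poly_in (insert e W)" "r \<in> poly_in (insert e W)"
      "c * p' = q * d + r" "r = 0 \<or> dg e r < dg e d" by blast
    have "(c * ld) * p = (q + c * lp * Var e ^ k) * d + r"
      using c(5) by (simp add: p'_def algebra_simps)
    moreover have "c * ld \<noteq> 0" "c * ld \<in> poly_in W" using c l ld0 by auto
    moreover have "q + c * lp * Var e ^ k \<in> poly_in (insert e W)"
      using c(3) WW[OF c(2)] WW[OF l(1)] by (intro poly_in_add poly_in_mult poly_in_power) auto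
    ultimately show ?thesis using c by blast
  qed
qed

context gauss_step
begin

text \<open>A nonzero combination \<open>d\<close> of \<open>f\<close> and \<open>g\<close> of least
  degree in \<open>e\<close> divides both up to scalars from \<open>W\<close>, by pseudo-division.
  Irreducibility of \<open>f\<close> then leaves no room for \<open>e\<close> in
  \<open>d\<close>.\<close>

lemma bezout:
  assumes fV: "f \<in> poly_in (insert e W)" and gV: "g \<in> poly_in (insert e W)" and "\<not> f dvd g"
  shows "\<exists>a b d. d \<noteq> 0 \<and> d \<in> poly_in W \<and> a * f + b * g = d"
proof -
  define V where "V = insert e W"
  define I where "I = {d. d \<noteq> 0 \<and> (\<exists>a\<in>poly_in V. \<exists>b\<in>poly_in V. d = a * f + b * g)}"
  have f0: "f \<noteq> 0" using irr by auto
  have "f = 1 * f + 0 * g" by simp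
  then have "f \<in> I" unfolding I_def using f0 poly_in_0 poly_in_1 by blast
  then obtain d where d: "d \<in> I" and dmin: "\<And>x. x \<in> I \<Longrightarrow> dg e d \<le> dg e x"
    using ex_has_least_nat[of "\<lambda>x. x \<in> I" f "dg e"] by blast
  obtain a b where ab: "a \<in> poly_in V" "b \<in> poly_in V" "d = a * f + b * g" and d0: "d \<noteq> 0"
    using d by (auto simp: I_def)
  have dV: "d \<in> poly_in V" using ab fV gV by (auto simp: V_def)
  have red: "\<exists>c q. c \<noteq> 0 \<and> c \<in> poly_in W \<and> c * p = q * d"
    if pp: "p = s * f + t * g" "s \<in> poly_in V" "t \<in> poly_in V" for p s t
  proof -
    have "p \<in> poly_in V" using that fV gV by (auto simp: V_def)
    then obtain c q r where c: "c \<noteq> 0" "c \<in> poly_in W" "q \<in> poly_in V" "c * p = q * d + r"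
      "r = 0 \<or> dg e r < dg e d"
      using pseudo_division[of d e W p] dV d0 eW by (auto simp: V_def)
    have "c \<in> poly_in V" using c(2) by (auto simp: V_def intro: poly_in_mono)
    moreover have "r = (c * s - q * a) * f + (c * t - q * b) * g"
      using c(4) unfolding pp ab(3) by (simp add: algebra_simps)
    moreover have "c * s - q * a \<in> poly_in V" "c * t - q * b \<in> poly_in V"
      using that c(3) ab \<open>c \<in> poly_in V\<close> by auto
    ultimately have "r \<noteq> 0 \<Longrightarrow> r \<in> I" unfolding I_def by blast
    then have "r = 0" using c(5) dmin[of r] by force
    then show ?thesis using c by auto
  qed
  obtain c1 q1 where c1: "c1 \<noteq> 0" "c1 \<in> poly_in W" "c1 * f = q1 * d"
    using red[of f 1 0] by auto
  obtain c2 q2 where c2: "c2 \<noteq> 0" "c2 \<in> poly_in W" "c2 * g = q2 * d"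
    using red[of g 0 1] by auto
  obtain k1 k2 d' q' where k: "k1 \<in> poly_in W" "d = k1 * d'" "q1 = k2 * q'" "f = d' * q'"
    using split_factor[OF c1(1,2), of d q1] c1(3) by (auto simp: mult.commute)
  \<comment> \<open>A unit \<open>q'\<close> would make \<open>f\<close> divide \<open>d\<close>,
    hence \<open>c2 * g\<close>, hence \<open>g\<close>. So \<open>d'\<close> is the unit, and
    \<open>d\<close> lies over \<open>W\<close>.\<close>
  have "d' dvd 1 \<or> q' dvd 1" using k(4) irr by (auto simp: irreducible_def)
  moreover have "\<not> q' dvd 1"
  proof
    assume "q' dvd 1"
    then have "f dvd d'" unfolding k(4) by (simp add: mult_unit_dvd_iff)
    then have "f dvd c2 * g" unfolding c2(3) k(2) by simp
    then show False using cancel_factor[OF c2(1,2)] assms by blast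
  qed
  ultimately obtain u where "d' = Const u" using unit_mpoly by blast
  then have "d \<in> poly_in W" using k by auto
  then show ?thesis using ab d0 by blast
qed

end

text \<open>If \<open>f\<close> does not divide \<open>g\<close>, multiply a Bezout combination free
  of \<open>e\<close> by \<open>h\<close>: this shows that \<open>f\<close> divides a scalar times
  \<open>h\<close>, and the scalar cancels.\<close>

theorem irreducible_imp_prime_elem_mpoly:
  fixes f :: mpoly
  assumes "irreducible f"
  shows "prime_elem f"
  using assms
proof (induction "card (vars f)" arbitrary: f rule: less_induct)
  case less
  have "vars f \<noteq> {}"
  proof
    assume "vars f = {}"
    then obtain c where c: "f = Const c" using poly_in_empty[of f] by (auto simp: poly_in_def)
    then have "c \<noteq> 0" using less.prems by auto
    then show False using less.prems unit_Const c by (auto simp: irreducible_def)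
  qed
  then obtain e where e: "e \<in> vars f" by blast
  define W where "W = vars f - {e}"
  have V: "vars f = insert e W" using e by (auto simp: W_def)
  interpret gauss_step f e W
  proof
    fix g :: mpoly assume g: "irreducible g" "vars g \<subseteq> W"
    then have "vars g \<subset> vars f" using e by (auto simp: W_def)
    then have "card (vars g) < card (vars f)" by (simp add: psubset_card_mono)
    then show "prime_elem g" using less.hyps g by blast
  qed (use less.prems e in \<open>auto simp: W_def\<close>)
  have fV: "f \<in> poly_in (insert e W)" using poly_in_vars[of f] V by simp
  have "prime_on (insert e W) f"
    unfolding prime_on_def
  proof (intro ballI impI)
    fix g h assume g: "g \<in> poly_in (insert e W)" and d: "f dvd g * h"
    show "f dvd g \<or> f dvd h"
    proof (cases "f dvd g")
      case False
      then obtain a b c where c: "c \<noteq> 0" "c \<in> poly_in W" "a * f + b * g = c"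
        using bezout[OF fV g] by blast
      have "c * h = f * (a * h) + b * (g * h)" unfolding c(3)[symmetric] by (simp add: algebra_simps)
      then have "f dvd c * h" using d by (simp add: dvd_add)
      then show ?thesis using cancel_factor c by blast
    qed simp
  qed
  then show ?case using prime_on_imp_prime_elem fV less.prems by blast
qed

text \<open>Primality is now known for all irreducible polynomials, so \<open>gauss_step\<close>
  applies with every other variable of \<open>f\<close> and \<open>g\<close> in
  \<open>W\<close>.\<close>

lemma mpoly_bezout:
  assumes "irreducible f" "e \<in> vars f" "\<not> f dvd g"
  shows "\<exists>a b d. d \<noteq> 0 \<and> e \<notin> vars d \<and> a * f + b * g = d"
proof -
  interpret gauss_step f e "vars f \<union> vars g - {e}"
    using assms irreducible_imp_prime_elem_mpoly by unfold_locales auto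
  have "f \<in> poly_in (insert e (vars f \<union> vars g - {e}))" "g \<in> poly_in (insert e (vars f \<union> vars g - {e}))"
    by (auto simp: poly_in_def)
  from bezout[OF this assms(3)] show ?thesis by (auto simp: poly_in_def)
qed

section \<open>Sylvester matrices and resultants\<close>

lemma sylvester_row:
  fixes F G :: "'a :: comm_ring_1 poly"
  defines "N \<equiv> degree F + degree G"
  defines "Q \<equiv> \<lambda>i. if i < degree G then monom 1 (degree G - 1 - i) * F else monom 1 (N - 1 - i) * G"
  assumes "i < N"
  shows "j < N \<Longrightarrow> sylvester_mat F G $$ (i, j) = coeff (Q i) (N - 1 - j)"
    and "degree (Q i) < N"
proof -
  assume j: "j < N"
  have shift: "coeff (monom 1 (k - i) * P) (N - j) = coeff (monom 1 (k - 1 - i) * P) (N - 1 - j)"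
    if "i < k" for k and P :: "'a poly"
  proof -
    have "k - i = Suc (k - 1 - i)" "N - j = Suc (N - 1 - j)" using that j by auto
    then show ?thesis by (simp only: monom_Suc mult_pCons_left smult_0_left add_0_left coeff_pCons_Suc)
  qed
  show "sylvester_mat F G $$ (i, j) = coeff (Q i) (N - 1 - j)"
  proof (cases "i < degree G")
    case True
    then show ?thesis
      using sylvester_index_mat2[of i F G j] shift[of "degree G" F] assms(3) j
      by (simp only: Q_def N_def if_True)
  next
    case False
    then show ?thesis
      using sylvester_index_mat2[of i F G j] shift[of N G] assms(3) j
      by (simp only: Q_def N_def if_False)
  qed
next
  have *: "degree (monom 1 k * P) \<le> k + degree P" for k and P :: "'a poly"
    by (rule order.trans[OF degree_mult_le]) (simp add: degree_monom_le)
  show "degree (Q i) < N"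
    using *[of "degree G - 1 - i" F] *[of "N - 1 - i" G] assms(3) by (auto simp: Q_def N_def)
qed

lemma mult_mat_vec_sum:
  assumes "A \<in> carrier_mat n m" "v \<in> carrier_vec m" "i < n"
  shows "(A *\<^sub>v v) $ i = (\<Sum>j<m. A $$ (i, j) * v $ j)"
  using assms by (auto simp: scalar_prod_def atLeast0LessThan intro!: sum.cong)

text \<open>Row i of the Sylvester matrix holds the coefficients of \<open>Q i\<close>, a power of
  the indeterminate times \<open>F\<close> or \<open>G\<close>. Applied to the descending powers of
  \<open>Var e\<close>, the matrix therefore yields multiples of \<open>f\<close> and
  \<open>g\<close>. The adjugate turns this vector into the determinant times the powers, whose last
  one is 1.\<close>

lemma Res_in_ideal:
  assumes "e \<in> vars f"
  shows "\<exists>a b. Res f g e = a * f + b * g"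
proof -
  define F G where "F = to_univ e f" and "G = to_univ e g"
  define N where "N = degree F + degree G"
  define Q where "Q = (\<lambda>i. if i < degree G then monom 1 (degree G - 1 - i) * F else monom 1 (N - 1 - i) * G)"
  \<comment> \<open>The hypothesis on \<open>e\<close> makes the matrix nonempty, so that a last
    entry exists.\<close>
  have N0: "N > 0" using assms dg_pos_iff[of e f] by (simp add: N_def F_def)
  let ?S = "sylvester_mat F G"
  have S: "?S \<in> carrier_mat N N" using sylvester_carrier_mat[of F G] by (simp add: N_def)
  define v where "v = vec N (\<lambda>j. Var e ^ (N - 1 - j))"
  have v: "v \<in> carrier_vec N" by (simp add: v_def)
  have Sv: "(?S *\<^sub>v v) $ i = poly (Q i) (Var e)" if i: "i < N" for i
  proof -
    have "(?S *\<^sub>v v) $ i = (\<Sum>j<N. ?S $$ (i, j) * Var e ^ (N - 1 - j))"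
      unfolding mult_mat_vec_sum[OF S v i] by (simp add: v_def)
    also have "\<dots> = (\<Sum>j<N. coeff (Q i) (N - Suc j) * Var e ^ (N - Suc j))"
      using sylvester_row(1)[of i F G] i by (intro sum.cong) (auto simp: N_def Q_def)
    also have "\<dots> = (\<Sum>k<N. coeff (Q i) k * Var e ^ k)"
      by (rule sum.nat_diff_reindex)
    also have "\<dots> = poly (Q i) (Var e)"
      unfolding poly_altdef using sylvester_row(2)[of i F G] i
      by (intro sum.mono_neutral_right) (auto simp: N_def Q_def coeff_eq_0)
    finally show ?thesis .
  qed
  let ?A = "adj_mat ?S"
  have A: "?A \<in> carrier_mat N N" using adj_mat(1)[OF S] .
  have "?A *\<^sub>v (?S *\<^sub>v v) = (det ?S \<cdot>\<^sub>m 1\<^sub>m N) *\<^sub>v v"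
    using assoc_mult_mat_vec[OF A S v] adj_mat(3)[OF S] by simp
  then have "(?A *\<^sub>v (?S *\<^sub>v v)) $ (N - 1) = (\<Sum>i<N. (if i = N - 1 then det ?S else 0) * v $ i)"
    using N0 v by (auto simp: scalar_prod_def atLeast0LessThan intro!: sum.cong)
  also have "\<dots> = (\<Sum>i<N. if i = N - 1 then det ?S * v $ i else 0)"
    by (intro sum.cong) auto
  finally have "det ?S = (?A *\<^sub>v (?S *\<^sub>v v)) $ (N - 1)"
    using N0 by (simp add: v_def del: index_mult_mat_vec)
  also have "\<dots> = (\<Sum>i<N. ?A $$ (N - 1, i) * poly (Q i) (Var e))"
    using N0 mult_mat_vec_sum[OF A mult_mat_vec_carrier[OF S v], of "N - 1"]
    by (simp add: Sv del: index_mult_mat_vec)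
  also have "\<exists>a b. \<dots> = a * f + b * g"
  proof -
    have "\<exists>a b. (\<Sum>i\<in>I. ?A $$ (N - 1, i) * poly (Q i) (Var e)) = a * f + b * g" for I
    proof (induction I rule: infinite_finite_induct)
      case (insert i I)
      then obtain a b where "(\<Sum>i\<in>I. ?A $$ (N - 1, i) * poly (Q i) (Var e)) = a * f + b * g" by blast
      moreover obtain a' b' where "?A $$ (N - 1, i) * poly (Q i) (Var e) = a' * f + b' * g"
      proof (cases "i < degree G")
        case True
        show ?thesis
          by (rule that[of "?A $$ (N - 1, i) * Var e ^ (degree G - 1 - i)" 0])
            (use True in \<open>simp add: Q_def F_def poly_monom mult.assoc\<close>)
      next
        case False
        show ?thesis
          by (rule that[of 0 "?A $$ (N - 1, i) * Var e ^ (N - 1 - i)"])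
            (use False in \<open>simp add: Q_def G_def poly_monom mult.assoc\<close>)
      qed
      ultimately have "(\<Sum>i\<in>insert i I. ?A $$ (N - 1, i) * poly (Q i) (Var e)) = (a' + a) * f + (b' + b) * g"
        using insert by (simp add: algebra_simps)
      then show ?case by blast
    qed (auto intro: exI[of _ 0])
    then show ?thesis by blast
  qed
  finally show ?thesis by (simp add: Res_def resultant_def F_def G_def)
qed

text \<open>A zero resultant gives \<open>u * F + w * G = 0\<close> with \<open>w\<close> of degree
  below that of \<open>F\<close>. Combined with a Bezout identity whose right side is free of
  \<open>e\<close>, this makes \<open>F\<close> divide a scalar multiple of \<open>w\<close>; hence
  \<open>w\<close> and then \<open>u\<close> vanish.\<close>

lemma Res_nonzero:
  assumes "irreducible f" "e \<in> vars f" "\<not> f dvd g"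
  shows "Res f g e \<noteq> 0"
proof
  assume z: "Res f g e = 0"
  define F G where "F = to_univ e f" and "G = to_univ e g"
  define N where "N = degree F + degree G"
  define Q where "Q = (\<lambda>i. if i < degree G then monom 1 (degree G - 1 - i) * F else monom 1 (N - 1 - i) * G)"
  let ?S = "transpose_mat (sylvester_mat F G)"
  have S: "?S \<in> carrier_mat N N" using sylvester_carrier_mat[of F G] by (simp add: N_def)
  have "det ?S = 0"
    using z det_transpose[OF sylvester_carrier_mat[of F G]] by (simp add: Res_def resultant_def F_def G_def)
  then obtain v where v: "v \<in> carrier_vec N" "v \<noteq> 0\<^sub>v N" "?S *\<^sub>v v = 0\<^sub>v N"
    using det_0_iff_vec_prod_zero[OF S] by blast
  have "coeff (\<Sum>i<N. smult (v $ i) (Q i)) k = 0" for k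
  proof (cases "k < N")
    case True
    define j where "j = N - 1 - k"
    have j: "j < N" "k = N - 1 - j" using True by (auto simp: j_def)
    have "0 = (?S *\<^sub>v v) $ j" unfolding v(3) using j(1) by simp
    also have "\<dots> = (\<Sum>i<N. sylvester_mat F G $$ (i, j) * v $ i)"
      unfolding mult_mat_vec_sum[OF S v(1) j(1)] using j(1) by (intro sum.cong) (auto simp: N_def)
    also have "\<dots> = (\<Sum>i<N. coeff (Q i) k * v $ i)"
      using sylvester_row(1)[of _ F G j] j by (intro sum.cong) (auto simp: N_def Q_def)
    finally show ?thesis by (simp add: coeff_sum mult.commute)
  next
    case False
    have "coeff (Q i) k = 0" if "i < N" for i
      using sylvester_row(2)[of i F G] that False by (intro coeff_eq_0) (auto simp: N_def Q_def)
    then show ?thesis by (simp add: coeff_sum)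
  qed
  then have comb: "(\<Sum>i<N. smult (v $ i) (Q i)) = 0" by (simp add: poly_eq_iff)
  define n m where "n = degree G" and "m = degree F"
  \<comment> \<open>The kernel vector is read as two lists of coefficients in descending
    degree.\<close>
  define u where "u = (\<Sum>i<n. monom (v $ i) (n - 1 - i))"
  define w where "w = (\<Sum>i<m. monom (v $ (n + i)) (m - 1 - i))"
  have cu: "coeff u (n - 1 - i) = v $ i" (is "?l = _") if "i < n" for i
  proof -
    have "?l = (\<Sum>x<n. if x = i then v $ x else 0)"
      using that unfolding u_def coeff_sum by (intro sum.cong) auto
    then show ?thesis using that by simp
  qed
  have cw: "coeff w (m - 1 - i) = v $ (n + i)" (is "?l = _") if "i < m" for i

  proof -
    have "?l = (\<Sum>x<m. if x = i then v $ (n + x) else 0)"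
      using that unfolding w_def coeff_sum by (intro sum.cong) auto
    then show ?thesis using that by simp
  qed
  have "(\<Sum>i<N. smult (v $ i) (Q i)) = (\<Sum>i<n. smult (v $ i) (Q i)) + (\<Sum>i<m. smult (v $ (n + i)) (Q (n + i)))"
  proof -
    have "(\<Sum>i<n + m. h i) = (\<Sum>i<n. h i) + (\<Sum>i<m. h (n + i))" for h :: "nat \<Rightarrow> mpoly poly"
      by (induction m) (simp_all add: add.assoc)
    then show ?thesis by (simp add: N_def n_def m_def add.commute)
  qed
  also have "(\<Sum>i<n. smult (v $ i) (Q i)) = u * F"
    unfolding u_def sum_distrib_right by (intro sum.cong) (auto simp: Q_def n_def smult_monom simp flip: mult_smult_left)
  also have "(\<Sum>i<m. smult (v $ (n + i)) (Q (n + i))) = w * G"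
    unfolding w_def sum_distrib_right
    by (intro sum.cong) (auto simp: Q_def n_def m_def N_def smult_monom simp flip: mult_smult_left)
  finally have uw: "u * F + w * G = 0" using comb by simp
  obtain a b d where d: "d \<noteq> 0" "e \<notin> vars d" "a * f + b * g = d"
    using mpoly_bezout[OF assms] by blast
  define A B where "A = to_univ e a" and "B = to_univ e b"
  have "A * F + B * G = [:d:]"
    using to_univ_free[OF poly_in_vars, of e d] d
    by (simp add: A_def B_def F_def G_def flip: to_univ.hom_mult to_univ.hom_add)
  then have "[:d:] * w = (A * F + B * G) * w" by simp
  also have "\<dots> = A * F * w + B * (w * G)" by (simp add: algebra_simps)
  also have "w * G = - (u * F)" using uw by (simp add: add_eq_0_iff2 add.commute)
  finally have "smult d w = F * (A * w - B * u)" by (simp add: algebra_simps)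
  then have dvd: "F dvd smult d w" by simp
  have "w = 0"
  proof (rule ccontr)
    assume w: "w \<noteq> 0"
    have "degree w < m"
    proof (rule degree_lessI)
      show "w \<noteq> 0 \<or> 0 < m" using w by simp
      show "\<forall>k\<ge>m. coeff w k = 0"
        by (auto simp: w_def coeff_sum intro!: sum.neutral)
    qed
    moreover have "degree F \<le> degree (smult d w)"
      using dvd w d by (intro dvd_imp_degree_le) auto
    ultimately show False using d by (simp add: m_def)
  qed
  moreover have "F \<noteq> 0" using assms by (auto simp: F_def)
  ultimately have "u = 0" using uw by simp
  have "v $ i = 0" if "i < N" for i
  proof (cases "i < n")
    case True
    then show ?thesis using cu[of i] \<open>u = 0\<close> by simp
  next
    case False
    then have "i - n < m" using that by (auto simp: N_def n_def m_def)
    then show ?thesis using cw[of "i - n"] \<open>w = 0\<close> False by simp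
  qed
  then have "v = 0\<^sub>v N" using v by (intro eq_vecI) auto
  then show False using v by simp
qed

lemma Res_poly_in:
  assumes "f \<in> poly_in S" "g \<in> poly_in S"
  shows "Res f g e \<in> poly_in (S - {e})"
  unfolding Res_def resultant_def
proof (rule poly_in_det)
  show "sylvester_mat (to_univ e f) (to_univ e g) \<in> carrier_mat (dg e f + dg e g) (dg e f + dg e g)" by (rule sylvester_carrier_mat)
  fix i j assume "i < dg e f + dg e g" "j < dg e f + dg e g"
  then show "sylvester_mat (to_univ e f) (to_univ e g) $$ (i, j) \<in> poly_in (S - {e})"
    using coeff_to_univ_in[OF assms(1)] coeff_to_univ_in[OF assms(2)] by (auto simp: sylvester_index_mat)
qed

section \<open>The Cayley--Menger ideal vanishes on planar configurations\<close>

lemma det_expand_first_row: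
  "det (mat (Suc n) (Suc n) f) =
    (\<Sum>j<Suc n. f (0, j) * ((-1) ^ j * det (mat n n (\<lambda>(a, b). f (Suc a, if b < j then b else Suc b)))))"
proof -
  have "det (mat (Suc n) (Suc n) f) = (\<Sum>j<Suc n. mat (Suc n) (Suc n) f $$ (0, j) * cofactor (mat (Suc n) (Suc n) f) 0 j)"
    by (rule laplace_expansion_row) auto
  also have "\<dots> = (\<Sum>j<Suc n. f (0, j) * ((-1) ^ j * det (mat n n (\<lambda>(a, b). f (Suc a, if b < j then b else Suc b)))))"
    unfolding cofactor_def mat_delete_def
    by (intro sum.cong arg_cong2[of _ _ _ _ "(*)"] arg_cong[of _ _ det] cong_mat) auto
  finally show ?thesis .
qed

lemma det_mat3:
  fixes f :: "nat \<times> nat \<Rightarrow> 'a :: comm_ring_1"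
  shows "det (mat 3 3 f) = f (0,0) * (f (1,1) * f (2,2) - f (1,2) * f (2,1))
    - f (0,1) * (f (1,0) * f (2,2) - f (1,2) * f (2,0)) + f (0,2) * (f (1,0) * f (2,1) - f (1,1) * f (2,0))"
  by (simp add: numeral_eq_Suc det_expand_first_row lessThan_Suc algebra_simps)

lemma det_mat4:
  fixes f :: "nat \<times> nat \<Rightarrow> 'a :: comm_ring_1"
  defines "m \<equiv> \<lambda>i j k. f (1,i) * (f (2,j) * f (3,k) - f (2,k) * f (3,j))
    - f (1,j) * (f (2,i) * f (3,k) - f (2,k) * f (3,i)) + f (1,k) * (f (2,i) * f (3,j) - f (2,j) * f (3,i))"
  shows "det (mat 4 4 f) = f (0,0) * m 1 2 3 - f (0,1) * m 0 2 3 + f (0,2) * m 0 1 3 - f (0,3) * m 0 1 2"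
proof -
  have "det (mat 4 4 f) = (\<Sum>j<4. f (0, j) * ((-1) ^ j * det (mat 3 3 (\<lambda>(a, b). f (Suc a, if b < j then b else Suc b)))))"
    using det_expand_first_row[of 3 f] by simp
  moreover have "det (mat 3 3 (\<lambda>(a, b). f (Suc a, if b < 0 then b else Suc b))) = m 1 2 3"
    "det (mat 3 3 (\<lambda>(a, b). f (Suc a, if b < 1 then b else Suc b))) = m 0 2 3"
    "det (mat 3 3 (\<lambda>(a, b). f (Suc a, if b < 2 then b else Suc b))) = m 0 1 3"
    "det (mat 3 3 (\<lambda>(a, b). f (Suc a, if b < 3 then b else Suc b))) = m 0 1 2"
    unfolding det_mat3 m_def by (simp_all add: numeral_eq_Suc)
  moreover have "{..<4} = {0, 1, 2, 3 :: nat}" by auto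
  ultimately show ?thesis by simp
qed

lemma det_mat5:
  fixes f :: "nat \<times> nat \<Rightarrow> 'a :: comm_ring_1"
  shows "det (mat 5 5 f) = (\<Sum>j<5. f (0, j) * ((-1) ^ j * det (mat 4 4 (\<lambda>(a, b). f (Suc a, if b < j then b else Suc b)))))"
  using det_expand_first_row[of 4 f] by simp

text \<open>Schur complement of the block [[0,1],[1,0]] in rows and columns 0 and 1: the complement
  is \<open>- y\<close>, and its sign (-1)^3 cancels the determinant -1 of the block.\<close>

lemma det_bordered:
  fixes f :: "nat \<times> nat \<Rightarrow> 'a :: comm_ring_1"
  assumes "f (0,0) = 0" "f (1,1) = 0" "\<And>i. i \<in> {1..4} \<Longrightarrow> f (0,i) = 1" "\<And>i. i \<in> {1..4} \<Longrightarrow> f (i,0) = 1"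
  defines "y \<equiv> \<lambda>i j. f (i,1) + f (1,j) - f (i,j)"
  shows "det (mat 5 5 f) = y 2 2 * (y 3 3 * y 4 4 - y 3 4 * y 4 3) - y 2 3 * (y 3 2 * y 4 4 - y 3 4 * y 4 2)
      + y 2 4 * (y 3 2 * y 4 3 - y 3 3 * y 4 2)"
proof -
  have b: "f (0, 1) = 1" "f (0, 2) = 1" "f (0, 3) = 1" "f (0, 4) = 1"
    "f (1, 0) = 1" "f (2, 0) = 1" "f (3, 0) = 1" "f (4, 0) = 1" using assms(3,4) by auto
  define z22 z23 z24 z32 z33 z34 z42 z43 z44 p2 p3 p4 q2 q3 q4 where
    z: "z22 = f (2,2)" "z23 = f (2,3)" "z24 = f (2,4)" "z32 = f (3,2)" "z33 = f (3,3)" "z34 = f (3,4)"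
    "z42 = f (4,2)" "z43 = f (4,3)" "z44 = f (4,4)" "p2 = f (1,2)" "p3 = f (1,3)" "p4 = f (1,4)"
    "q2 = f (2,1)" "q3 = f (3,1)" "q4 = f (4,1)"
  note zz = z[symmetric]
  have "det (mat 5 5 f) =
    - det (mat 4 4 (\<lambda>(a, b). f (Suc a, if b < 1 then b else Suc b)))
    + det (mat 4 4 (\<lambda>(a, b). f (Suc a, if b < 2 then b else Suc b)))
    - det (mat 4 4 (\<lambda>(a, b). f (Suc a, if b < 3 then b else Suc b)))
    + det (mat 4 4 (\<lambda>(a, b). f (Suc a, if b < 4 then b else Suc b)))"
    unfolding det_mat5 using assms(1) b by (simp add: eval_nat_numeral)
  also have "\<dots> = (q2 + p2 - z22) * ((q3 + p3 - z33) * (q4 + p4 - z44) - (q3 + p4 - z34) * (q4 + p3 - z43))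
    - (q2 + p3 - z23) * ((q3 + p2 - z32) * (q4 + p4 - z44) - (q3 + p4 - z34) * (q4 + p2 - z42))
    + (q2 + p4 - z24) * ((q3 + p2 - z32) * (q4 + p3 - z43) - (q3 + p3 - z33) * (q4 + p2 - z42))"
  proof -
    have n: "Suc 1 = 2" "Suc 2 = 3" "Suc 3 = 4" "Suc 0 = 1" by auto
    show ?thesis
      unfolding det_mat4 prod.case n
      apply (simp only: n b assms(1,2) zz less_numeral_extra if_True if_False)
      apply (simp add: b[simplified] assms(2)[simplified] zz[simplified])
      apply (simp add: algebra_simps)
      done
  qed
  finally show ?thesis by (simp add: y_def z)
qed

section \<open>Membership in the Cayley--Menger ideal\<close>

lemma CM_entry_in: "i \<le> n \<Longrightarrow> j \<le> n \<Longrightarrow> CM_entry i j \<in> poly_in (Xn n)"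
  by (auto simp: CM_entry_def Xn_def min_def max_def)

lemma CM_entry_commute: "CM_entry i j = CM_entry j i"
  by (auto simp: CM_entry_def min.commute max.commute)

lemma CM_minor_cases:
  assumes "g \<in> CM_minors n"
  obtains r c where "strict_mono_on {..<5} r" "strict_mono_on {..<5} c"
    "\<And>i. i < 5 \<Longrightarrow> r i \<le> n" "\<And>i. i < 5 \<Longrightarrow> c i \<le> n"
    "g = det (mat 5 5 (\<lambda>(a, b). CM_entry (r a) (c b)))"
proof -
  obtain r c where rc: "g = det (mat 5 5 (\<lambda>(a, b). CM_matrix n $$ (r a, c b)))"
    "strict_mono_on {..<5} r" "strict_mono_on {..<5} c" "r 4 \<le> n" "c 4 \<le> n"
    using assms by (auto simp: CM_minors_def)
  have le: "h i \<le> n" if "strict_mono_on {..<5} h" "h 4 \<le> n" "i < 5" for h :: "nat \<Rightarrow> nat" and i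
    using that strict_mono_onD[OF that(1), of i 4] by (cases "i = 4") auto
  have "mat 5 5 (\<lambda>(a, b). CM_matrix n $$ (r a, c b)) = mat 5 5 (\<lambda>(a, b). CM_entry (r a) (c b))"
    by (rule eq_matI) (auto simp: CM_matrix_def less_Suc_eq_le le rc)
  then show ?thesis using that rc le by simp
qed

lemma CM_minors_poly_in:
  assumes "g \<in> CM_minors n"
  shows "g \<in> poly_in (Xn n)"
  using assms
proof (cases rule: CM_minor_cases)
  case (1 r c)
  show ?thesis unfolding 1(5)
    by (rule poly_in_det[of _ 5]) (simp_all add: CM_entry_in 1)
qed

lemma CM_E:
  assumes "p \<in> CM n"
  shows "\<exists>(k :: nat) h g. (\<forall>i<k. h i \<in> poly_in (Xn n) \<and> g i \<in> CM_minors n) \<and> p = (\<Sum>i<k. h i * g i)"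
  using assms unfolding CM_def by (rule CollectD)

lemma CM_I:
  fixes k :: nat
  assumes "\<And>i. i < k \<Longrightarrow> h i \<in> poly_in (Xn n)" "\<And>i. i < k \<Longrightarrow> g i \<in> CM_minors n" "p = (\<Sum>i<k. h i * g i)"
  shows "p \<in> CM n"
  unfolding CM_def by (rule CollectI, rule exI[of _ k], rule exI[of _ h], rule exI[of _ g]) (use assms in simp)

lemma CM_poly_in:
  assumes "p \<in> CM n"
  shows "p \<in> poly_in (Xn n)"
proof -
  obtain k :: nat and h g where *: "\<forall>i<k. h i \<in> poly_in (Xn n) \<and> g i \<in> CM_minors n" "p = (\<Sum>i<k. h i * g i)"
    using CM_E[OF assms] by metis
  show ?thesis unfolding *(2)
    by (rule poly_in_sum, rule poly_in_mult) (use *(1) in \<open>auto intro: CM_minors_poly_in\<close>)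
qed

lemma CM_generator: "g \<in> CM_minors n \<Longrightarrow> g \<in> CM n"
  by (rule CM_I[of 1 "\<lambda>_. 1" n "\<lambda>_. g"]) simp_all

lemma CM_0 [simp]: "0 \<in> CM n"
  by (rule CM_I[of 0]) simp_all

lemma CM_add [intro]:
  assumes "p \<in> CM n" "q \<in> CM n"
  shows "p + q \<in> CM n"
proof -
  obtain k :: nat and h g where p: "\<forall>i<k. h i \<in> poly_in (Xn n) \<and> g i \<in> CM_minors n" "p = (\<Sum>i<k. h i * g i)"
    using CM_E[OF assms(1)] by metis
  obtain k' :: nat and h' g' where q: "\<forall>i<k'. h' i \<in> poly_in (Xn n) \<and> g' i \<in> CM_minors n" "q = (\<Sum>i<k'. h' i * g' i)"
    using CM_E[OF assms(2)] by metis
  let ?h = "\<lambda>i. if i < k then h i else h' (i - k)" and ?g = "\<lambda>i. if i < k then g i else g' (i - k)"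
  have "(\<Sum>i<k + m. ?h i * ?g i) = p + (\<Sum>i<m. h' i * g' i)" for m
    by (induction m) (simp_all add: p add.assoc)
  then have "p + q = (\<Sum>i<k + k'. ?h i * ?g i)" using q by simp
  moreover have "\<forall>i<k + k'. ?h i \<in> poly_in (Xn n) \<and> ?g i \<in> CM_minors n"
    using p(1) q(1) by auto
  ultimately show ?thesis by (intro CM_I[of "k + k'" ?h n ?g]) simp_all
qed

lemma CM_mult [intro]:
  assumes "r \<in> poly_in (Xn n)" "p \<in> CM n"
  shows "r * p \<in> CM n"
proof -
  obtain k :: nat and h g where p: "\<forall>i<k. h i \<in> poly_in (Xn n) \<and> g i \<in> CM_minors n" "p = (\<Sum>i<k. h i * g i)"
    using CM_E[OF assms(2)] by metis
  then have "r * p = (\<Sum>i<k. (r * h i) * g i)" "\<forall>i<k. r * h i \<in> poly_in (Xn n) \<and> g i \<in> CM_minors n"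
    using assms(1) by (auto simp: sum_distrib_left mult.assoc)
  then show ?thesis by (intro CM_I[of k "\<lambda>i. r * h i" n g]) simp_all
qed

lemma CM_uminus [intro]: "p \<in> CM n \<Longrightarrow> - p \<in> CM n"
  using CM_mult[where r = "- 1", OF poly_in_uminus[OF poly_in_1]] by simp

lemma CM_diff [intro]: "p \<in> CM n \<Longrightarrow> q \<in> CM n \<Longrightarrow> p - q \<in> CM n"
  using CM_add[of p n "- q"] by auto

context rat_algebra
begin

text \<open>The squared distances are evaluated for the hyperbolic form \<open>(a, b) \<mapsto> a * b\<close> instead of
  \<open>a\<^sup>2 + b\<^sup>2\<close>: the two are equivalent over the complex numbers, and this one splits over the rationals.\<close>

definition cfg :: "(nat \<Rightarrow> 'a) \<Rightarrow> (nat \<Rightarrow> 'a) \<Rightarrow> mpoly \<Rightarrow> 'a" where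
  "cfg \<alpha> \<beta> = psubst c (\<lambda>(i, j). (\<alpha> i - \<alpha> j) * (\<beta> i - \<beta> j))"

lemma cfg_hom: "comm_ring_hom (cfg \<alpha> \<beta>)"
  unfolding cfg_def by (rule psubst_hom)

lemma cfg_CM_entry:
  "cfg \<alpha> \<beta> (CM_entry i j) =
    (if i = j then 0 else if i = 0 \<or> j = 0 then 1 else (\<alpha> i - \<alpha> j) * (\<beta> i - \<beta> j))"
proof (cases "i < j")
  case True
  then show ?thesis by (simp add: CM_entry_def cfg_def)
next
  case False
  have "(\<alpha> j - \<alpha> i) * (\<beta> j - \<beta> i) = (\<alpha> i - \<alpha> j) * (\<beta> i - \<beta> j)" by (simp add: algebra_simps)
  then show ?thesis using False by (simp add: CM_entry_def cfg_def min_def max_def)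
qed

text \<open>Since (a - a')(b - b') = ab + a'b' - ab' - ba', each evaluated entry is a sum of four
  products of a row term and a column term. A 5-minor thus factors through dimension 4;
  \<open>R\<close> and \<open>S\<close> are padded with zeros to square matrices.\<close>

lemma CM_vanishes:
  assumes "p \<in> CM n"
  shows "cfg \<alpha> \<beta> p = 0"
proof -
  interpret h: comm_ring_hom "cfg \<alpha> \<beta>" by (rule cfg_hom)
  have minor: "cfg \<alpha> \<beta> g = 0" if "g \<in> CM_minors n" for g
    using that
  proof (cases rule: CM_minor_cases)
    case (1 r s)
    define R where "R = mat 5 5 (\<lambda>(a, k). if k = 0 then (if r a = 0 then 0 else 1)
      else if k = 1 then (if r a = 0 then 1 else \<alpha> (r a) * \<beta> (r a))
      else if k = 2 then (if r a = 0 then 0 else - \<alpha> (r a))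
      else if k = 3 then (if r a = 0 then 0 else - \<beta> (r a)) else 0)"
    define S where "S = mat 5 5 (\<lambda>(k, b). if k = 0 then (if s b = 0 then 1 else \<alpha> (s b) * \<beta> (s b))
      else if k = 1 then (if s b = 0 then 0 else 1)
      else if k = 2 then (if s b = 0 then 0 else \<beta> (s b))
      else if k = 3 then (if s b = 0 then 0 else \<alpha> (s b)) else 0)"
    have RS: "R \<in> carrier_mat 5 5" "S \<in> carrier_mat 5 5" by (simp_all add: R_def S_def)
    have "map_mat (cfg \<alpha> \<beta>) (mat 5 5 (\<lambda>(a, b). CM_entry (r a) (s b))) = R * S"
    proof (rule eq_matI)
      fix a b assume "a < dim_row (R * S)" "b < dim_col (R * S)"
      then have ab: "a < 5" "b < 5" using RS by auto
      have "(R * S) $$ (a, b) = (\<Sum>k<5. R $$ (a, k) * S $$ (k, b))"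
        using ab RS by (simp add: scalar_prod_def atLeast0LessThan)
      also have "\<dots> = cfg \<alpha> \<beta> (CM_entry (r a) (s b))"
      proof -
        have "{..<5} = {0, 1, 2, 3, 4 :: nat}" by auto
        then have "(\<Sum>k<5. R $$ (a, k) * S $$ (k, b)) = R $$ (a, 0) * S $$ (0, b) + R $$ (a, 1) * S $$ (1, b)
          + R $$ (a, 2) * S $$ (2, b) + R $$ (a, 3) * S $$ (3, b) + R $$ (a, 4) * S $$ (4, b)"
          by (simp add: add.assoc)
        also have "\<dots> = (if r a = 0 then if s b = 0 then 0 else 1 else if s b = 0 then 1
          else \<alpha> (s b) * \<beta> (s b) + \<alpha> (r a) * \<beta> (r a) - \<alpha> (r a) * \<beta> (s b) - \<beta> (r a) * \<alpha> (s b))"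
          using ab by (simp add: R_def S_def)
        also have "\<dots> = cfg \<alpha> \<beta> (CM_entry (r a) (s b))"
          unfolding cfg_CM_entry by (auto simp: algebra_simps)
        finally show ?thesis .
      qed
      finally show "map_mat (cfg \<alpha> \<beta>) (mat 5 5 (\<lambda>(a, b). CM_entry (r a) (s b))) $$ (a, b) = (R * S) $$ (a, b)"
        using ab by simp
    qed (use RS in auto)
    moreover have "det R = 0"
    proof -
      have "det R = (\<Sum>i<5. R $$ (i, 4) * cofactor R i 4)"
        by (rule laplace_expansion_column[OF RS(1)]) simp
      also have "\<dots> = 0" by (intro sum.neutral) (auto simp: R_def)
      finally show ?thesis .
    qed
    ultimately show ?thesis
      using 1(5) h.hom_det[of "mat 5 5 (\<lambda>(a, b). CM_entry (r a) (s b))"] det_mult[OF RS] by simp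
  qed
  obtain k :: nat and f g where "\<forall>i<k. f i \<in> poly_in (Xn n) \<and> g i \<in> CM_minors n" "p = (\<Sum>i<k. f i * g i)"
    using CM_E[OF assms] by metis
  then show ?thesis by (simp add: h.hom_sum h.hom_mult minor)
qed

end

section \<open>The second fundamental theorem for rank two symmetric matrices\<close>

locale gram =
  fixes n :: nat
  assumes n: "1 \<le> n"
begin

definition V :: "nat set" where "V = {2..n}"

definition eqv :: "mpoly \<Rightarrow> mpoly \<Rightarrow> bool" (infix "\<doteq>" 50) where
  "p \<doteq> q \<longleftrightarrow> p - q \<in> CM n"

lemma eqv_refl [simp]: "p \<doteq> p" by (simp add: eqv_def)

lemma eqv_sym: "p \<doteq> q \<Longrightarrow> q \<doteq> p"
  using CM_uminus[of "p - q" n] by (simp add: eqv_def)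

lemma eqv_trans [trans]: "p \<doteq> q \<Longrightarrow> q \<doteq> r \<Longrightarrow> p \<doteq> r"
  using CM_add[of "p - q" n "q - r"] by (simp add: eqv_def)

lemma eqv_add: "p \<doteq> q \<Longrightarrow> p' \<doteq> q' \<Longrightarrow> p + p' \<doteq> q + q'"
  using CM_add[of "p - q" n "p' - q'"] by (simp add: eqv_def algebra_simps)

lemma eqv_mult: "r \<in> poly_in (Xn n) \<Longrightarrow> p \<doteq> q \<Longrightarrow> r * p \<doteq> r * q"
  using CM_mult[of r n "p - q"] by (simp add: eqv_def algebra_simps)

lemma eqv_uminus: "p \<doteq> q \<Longrightarrow> - p \<doteq> - q"
  using eqv_mult[where r = "- 1", OF poly_in_uminus[OF poly_in_1]] by simp

lemma eqv_diff: "p \<doteq> q \<Longrightarrow> p' \<doteq> q' \<Longrightarrow> p - p' \<doteq> q - q'"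
  using eqv_add[of p q "- p'" "- q'"] eqv_uminus by simp

text \<open>Twice the Gram matrix of the configuration, seen from vertex 1.\<close>

definition Y :: "nat \<Rightarrow> nat \<Rightarrow> mpoly" where
  "Y i j = CM_entry 1 i + CM_entry 1 j - CM_entry i j"

lemma Y_commute: "Y i j = Y j i"
  by (simp add: Y_def CM_entry_commute[of i] add.commute)

lemma Y_in: "i \<in> V \<Longrightarrow> j \<in> V \<Longrightarrow> Y i j \<in> poly_in (Xn n)"
  unfolding Y_def V_def using n by (intro poly_in_add poly_in_diff CM_entry_in) auto

text \<open>The 2-minor of the Gram matrix with rows \<open>x\<close> and columns \<open>y\<close>.
  On a configuration it is minus the product of the skew forms of \<open>x\<close> and
  \<open>y\<close>, which explains the sign in \<open>skew_lift\<close>.\<close>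

definition D :: "nat \<times> nat \<Rightarrow> nat \<times> nat \<Rightarrow> mpoly" where
  "D x y = Y (fst x) (fst y) * Y (snd x) (snd y) - Y (fst x) (snd y) * Y (snd x) (fst y)"

lemma D_commute: "D x y = D y x"
  by (simp add: D_def Y_commute[of "fst x"] Y_commute[of "snd x"] mult.commute)

lemma D_swap: "D (b, a) y = - D (a, b) y" "D y (b, a) = - D y (a, b)"
  by (simp_all add: D_def mult.commute)

lemma D_in: "x \<in> V \<times> V \<Longrightarrow> y \<in> V \<times> V \<Longrightarrow> D x y \<in> poly_in (Xn n)"
  unfolding D_def by (intro poly_in_diff poly_in_mult Y_in) auto

definition minor3 :: "nat \<Rightarrow> nat \<Rightarrow> nat \<Rightarrow> nat \<Rightarrow> nat \<Rightarrow> nat \<Rightarrow> mpoly" where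
  "minor3 a b c k l m = Y a k * D (b, c) (l, m) - Y a l * D (b, c) (k, m) + Y a m * D (b, c) (k, l)"

text \<open>Prefixing the indices 0 and 1 gives a generating 5-minor, which
  \<open>det_bordered\<close> reduces to this 3-minor.\<close>

lemma minor3_sorted:
  assumes "a \<in> V" "b \<in> V" "c \<in> V" "k \<in> V" "l \<in> V" "m \<in> V"
    "a < b" "b < c" "k < l" "l < m"
  shows "minor3 a b c k l m \<in> CM n"
proof -
  define r where "r = (\<lambda>i. [0, 1, a, b, c] ! i)"
  define s where "s = (\<lambda>i. [0, 1, k, l, m] ! i)"
  have "r 0 = 0" "r 1 = 1" "r 2 = a" "r 3 = b" "r 4 = c" "s 0 = 0" "s 1 = 1" "s 2 = k" "s 3 = l" "s 4 = m"
    by (simp_all add: r_def s_def eval_nat_numeral)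
  note rs = this
  have mono: "strict_mono_on {..<5} h" if "h 0 = 0" "h 1 = 1" "1 < h 2" "h 2 < h 3" "h 3 < h 4" for h :: "nat \<Rightarrow> nat"
  proof (rule strict_mono_onI)
    fix i j :: nat assume "i \<in> {..<5}" "j \<in> {..<5}" "i < j"
    then have "i \<in> {0,1,2,3}" "j \<in> {1,2,3,4}" by auto
    then show "h i < h j" using that \<open>i < j\<close> by auto
  qed
  have sm: "strict_mono_on {..<5} r" "strict_mono_on {..<5} s"
    by (rule mono; use assms rs in \<open>simp add: V_def\<close>)+
  have le: "r i \<le> n" "s i \<le> n" if "i < 5" for i
  proof -
    have "i \<in> {0,1,2,3,4}" using that by auto
    then show "r i \<le> n" "s i \<le> n" using assms n by (auto simp: rs rs[simplified] V_def)
  qed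
  let ?f = "\<lambda>(a, b). CM_entry (r a) (s b)"
  have "det (mat 5 5 (\<lambda>(a, b). CM_matrix n $$ (r a, s b))) \<in> CM_minors n"
    unfolding CM_minors_def using sm le[of 4] by auto
  also have "mat 5 5 (\<lambda>(a, b). CM_matrix n $$ (r a, s b)) = mat 5 5 ?f"
    by (rule eq_matI) (auto simp: CM_matrix_def less_Suc_eq_le le)
  also have "det (mat 5 5 ?f) = minor3 a b c k l m"
  proof -
    have *: "0 < r i" "0 < s i" if "i \<in> {1..4}" for i
      using strict_mono_onD[OF sm(1), of 0 i] strict_mono_onD[OF sm(2), of 0 i] that rs by auto
    have y: "?f (i, 1) + ?f (1, j) - ?f (i, j) = Y (r i) (s j)" for i j
      unfolding prod.case rs Y_def by (simp only: CM_entry_commute[of "r i" 1])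
    have "det (mat 5 5 ?f) = Y a k * (Y b l * Y c m - Y b m * Y c l) - Y a l * (Y b k * Y c m - Y b m * Y c k)
      + Y a m * (Y b k * Y c l - Y b l * Y c k)"
    proof (subst det_bordered)
      show "?f (0, i) = 1" "?f (i, 0) = 1" if "i \<in> {1..4}" for i
        using *[OF that] rs(1,6) by (auto simp: CM_entry_def)
      show "?f (0, 0) = 0" "?f (1, 1) = 0" unfolding prod.case rs by (simp_all add: CM_entry_def)
    qed (simp only: y rs)
    then show ?thesis by (simp only: minor3_def D_def fst_conv snd_conv)
  qed
  finally show ?thesis by (rule CM_generator)
qed

lemma minor3_swap:
  "minor3 b a c k l m = - minor3 a b c k l m" "minor3 a c b k l m = - minor3 a b c k l m"
  "minor3 a b c l k m = - minor3 a b c k l m" "minor3 a b c k m l = - minor3 a b c k l m"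
  by (simp_all add: minor3_def D_def algebra_simps)

text \<open>The generators of the ideal have increasing indices; for minors with arbitrary indices,
  alternation supplies the rest.\<close>

lemma alternating3_cases:
  fixes a b c :: nat
  assumes sorted: "\<And>a b c. {a, b, c} \<subseteq> A \<Longrightarrow> a < b \<Longrightarrow> b < c \<Longrightarrow> P a b c"
    and s1: "\<And>a b c. P a b c \<Longrightarrow> P b a c" and s2: "\<And>a b c. P a b c \<Longrightarrow> P a c b"
    and eq: "\<And>a b. P a a b"
    and A: "a \<in> A" "b \<in> A" "c \<in> A"
  shows "P a b c"
proof -
  consider "a = b" | "b = c" | "a = c" | "a < b" "b < c" | "a < c" "c < b" | "b < a" "a < c"
    | "b < c" "c < a" | "c < a" "a < b" | "c < b" "b < a" by linarith
  then show ?thesis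
  proof cases
    case 1 then show ?thesis using eq by simp
  next
    case 2 then show ?thesis using s1[OF s2[OF eq[of b a]]] by simp
  next
    case 3 then show ?thesis using s2[OF eq[of a b]] by simp
  next
    case 4 then show ?thesis using A by (intro sorted) auto
  next
    case 5 then show ?thesis using A by (intro s2[OF sorted]) auto
  next
    case 6 then show ?thesis using A by (intro s1[OF sorted]) auto
  next
    case 7 then show ?thesis using A by (intro s1[OF s2[OF sorted]]) auto
  next
    case 8 then show ?thesis using A by (intro s2[OF s1[OF sorted]]) auto
  next
    case 9 then show ?thesis using A by (intro s2[OF s1[OF s2[OF sorted]]]) auto
  qed
qed

lemma minor3_in_CM:
  assumes "a \<in> V" "b \<in> V" "c \<in> V" "k \<in> V" "l \<in> V" "m \<in> V"
  shows "minor3 a b c k l m \<in> CM n"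
proof (rule alternating3_cases[where P = "\<lambda>a b c. minor3 a b c k l m \<in> CM n" and A = V])
  fix a b c assume abc: "{a, b, c} \<subseteq> V" "a < b" "b < c"
  show "minor3 a b c k l m \<in> CM n"
  proof (rule alternating3_cases[where P = "\<lambda>k l m. minor3 a b c k l m \<in> CM n" and A = V])
    show "minor3 a b c k l m \<in> CM n" if "{k, l, m} \<subseteq> V" "k < l" "l < m" for k l m
      using that abc by (intro minor3_sorted) auto
    show "minor3 a b c l k m \<in> CM n" if "minor3 a b c k l m \<in> CM n" for k l m
      unfolding minor3_swap(3)[of a b c l k m] using that by (rule CM_uminus)
    show "minor3 a b c k m l \<in> CM n" if "minor3 a b c k l m \<in> CM n" for k l m
      unfolding minor3_swap(4)[of a b c k m l] using that by (rule CM_uminus)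
    show "minor3 a b c k k l \<in> CM n" for k l
      by (simp add: minor3_def D_def)
  qed fact+
next
  show "minor3 b a c k l m \<in> CM n" if "minor3 a b c k l m \<in> CM n" for a b c
    unfolding minor3_swap(1)[of b a c k l m] using that by (rule CM_uminus)
  show "minor3 a c b k l m \<in> CM n" if "minor3 a b c k l m \<in> CM n" for a b c
    unfolding minor3_swap(2)[of a c b k l m] using that by (rule CM_uminus)
  show "minor3 a a b k l m \<in> CM n" for a b
    by (simp add: minor3_def D_def algebra_simps)
qed fact+

text \<open>On configurations both sides are the product of the same four skew forms. The explicit
  combination \<open>?R\<close> of 3-minors certifies that they agree modulo the ideal.\<close>

lemma D_exchange:
  assumes "x \<in> V \<times> V" "y \<in> V \<times> V" "z \<in> V \<times> V" "w \<in> V \<times> V"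
  shows "D x y * D z w \<doteq> D x z * D y w"
proof -
  obtain i j where x: "x = (i, j)" "i \<in> V" "j \<in> V" using assms(1) by auto
  obtain k l where y: "y = (k, l)" "k \<in> V" "l \<in> V" using assms(2) by auto
  obtain p q where z: "z = (p, q)" "p \<in> V" "q \<in> V" using assms(3) by auto
  obtain m o' where w: "w = (m, o')" "m \<in> V" "o' \<in> V" using assms(4) by auto
  have "D x y * D z w - D x z * D y w =
      Y i k * minor3 j m o' l p q - Y i l * minor3 j m o' k p q
      + Y j p * minor3 i m o' k l q - Y j q * minor3 i m o' k l p" (is "_ = ?R")
    unfolding x y z w minor3_def D_def fst_conv snd_conv
      Y_commute[of p m] Y_commute[of p o'] Y_commute[of q m] Y_commute[of q o'] 
      Y_commute[of k m] Y_commute[of k o'] Y_commute[of l m] Y_commute[of l o'] 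
    by (simp add: algebra_simps)
  also have "?R \<in> CM n"
    by (intro CM_add CM_diff CM_mult Y_in minor3_in_CM x y z w)
  finally show ?thesis by (simp add: eqv_def)
qed

text \<open>The image, modulo \<open>CM\<close>, of a product of the antisymmetric forms \<open>a\<^sub>i b\<^sub>j - a\<^sub>j b\<^sub>i\<close>.
  Products of an odd number of them are not O(2)-invariant and are sent to 0.\<close>

fun skew_lift :: "(nat \<times> nat) list \<Rightarrow> mpoly" where
  "skew_lift [] = 1"
| "skew_lift [x] = 0"
| "skew_lift (x # y # l) = - D x y * skew_lift l"

lemma skew_lift_in: "set l \<subseteq> V \<times> V \<Longrightarrow> skew_lift l \<in> poly_in (Xn n)"
  by (induction l rule: skew_lift.induct) (auto intro!: poly_in_mult poly_in_uminus D_in)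

text \<open>Two neighbours either form one pair, where \<open>D\<close> is symmetric, or belong to
  consecutive pairs, where \<open>D_exchange\<close> applies; an unpaired last form makes both sides
  0.\<close>

lemma skew_lift_swap:
  "set (xs @ x # y # l) \<subseteq> V \<times> V \<Longrightarrow> skew_lift (xs @ x # y # l) \<doteq> skew_lift (xs @ y # x # l)"
proof (induction xs rule: skew_lift.induct)
  case 1
  then show ?case by (simp add: D_commute)
next
  case (2 w)
  show ?case
  proof (cases l)
    case (Cons z l')
    have "skew_lift l' * (D w x * D y z) \<doteq> skew_lift l' * (D w y * D x z)"
      using 2 Cons by (intro eqv_mult skew_lift_in D_exchange) auto
    then show ?thesis using Cons by (simp add: mult_ac)
  qed simp
next
  case (3 u v xs)
  then show ?case by (auto intro!: eqv_mult poly_in_uminus D_in simp flip: mult_minus_left)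
qed

text \<open>Adjacent swaps generate all permutations. The function is kept abstract because both
  \<open>skew_lift\<close> and \<open>orient_lift\<close> need this.\<close>

lemma perm_invariant:
  assumes swap: "\<And>xs x y l. set (xs @ x # y # l) \<subseteq> A \<Longrightarrow> h (xs @ x # y # l) \<doteq> h (xs @ y # x # l)"
    and "mset l = mset l'" "set l \<subseteq> A"
  shows "h l \<doteq> h l'"
proof -
  have front: "h (xs @ ys @ x # zs) \<doteq> h (xs @ x # ys @ zs)" if "set (xs @ ys @ x # zs) \<subseteq> A" for xs ys x zs
    using that
  proof (induction ys arbitrary: xs)
    case (Cons y ys)
    have "h ((xs @ [y]) @ ys @ x # zs) \<doteq> h ((xs @ [y]) @ x # ys @ zs)"
      by (rule Cons.IH) (use Cons.prems in auto)
    also have "h ((xs @ [y]) @ x # ys @ zs) \<doteq> h (xs @ x # y # ys @ zs)"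
      using swap[of xs y x "ys @ zs"] Cons.prems by auto
    finally show ?case by simp
  qed simp
  have "h (xs @ l) \<doteq> h (xs @ l')" if "set (xs @ l) \<subseteq> A" "mset l = mset l'" for xs
    using that
  proof (induction l arbitrary: xs l')
    case (Cons x l)
    then have "x \<in> set l'" by (metis list.set_intros(1) set_mset_mset)
    then obtain ys zs where l': "l' = ys @ x # zs" by (meson split_list)
    then have m: "mset l = mset (ys @ zs)" using Cons.prems by simp
    then have "set l = set (ys @ zs)" by (metis set_mset_mset)
    then have "h ((xs @ [x]) @ l) \<doteq> h ((xs @ [x]) @ ys @ zs)"
      using Cons.prems by (intro Cons.IH m) auto
    also have "h ((xs @ [x]) @ ys @ zs) \<doteq> h (xs @ l')"
      using front[of xs ys x zs, THEN eqv_sym] Cons.prems \<open>set l = _\<close> by (simp add: l')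
    finally show ?case by simp
  qed simp
  from this[of "[]"] show ?thesis using assms by simp
qed

lemma skew_lift_perm: "mset l = mset l' \<Longrightarrow> set l \<subseteq> V \<times> V \<Longrightarrow> skew_lift l \<doteq> skew_lift l'"
  by (rule perm_invariant[where A = "V \<times> V"]) (rule skew_lift_swap)

abbreviation YY :: "nat \<times> nat \<Rightarrow> mpoly" where "YY z \<equiv> Y (fst z) (snd z)"

text \<open>Modulo \<open>CM\<close>, \<open>orient_lift L acc\<close> is a lift of the product of the monomials \<open>a\<^sub>i b\<^sub>j\<close>, \<open>(i, j)\<close> in \<open>L\<close>,
  averaged over the exchange of \<open>a\<close> and \<open>b\<close>: each factor is half the sum of \<open>Y i j\<close>
  and an antisymmetric form, and the antisymmetric forms are collected in the accumulator.\<close>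

fun orient_lift :: "(nat \<times> nat) list \<Rightarrow> (nat \<times> nat) list \<Rightarrow> mpoly" where
  "orient_lift [] acc = skew_lift acc"
| "orient_lift (z # L) acc = Const (1 / 2) * (YY z * orient_lift L acc + orient_lift L (z # acc))"

lemma orient_lift_acc_perm:
  "mset acc = mset acc' \<Longrightarrow> set L \<subseteq> V \<times> V \<Longrightarrow> set acc \<subseteq> V \<times> V \<Longrightarrow> orient_lift L acc \<doteq> orient_lift L acc'"
proof (induction L arbitrary: acc acc')
  case (Cons z L)
  then show ?case
    by (auto intro!: eqv_mult eqv_add Y_in)
qed (simp add: skew_lift_perm)

lemma orient_lift_Cons_cong:
  assumes "\<And>acc. set acc \<subseteq> V \<times> V \<Longrightarrow> orient_lift L acc \<doteq> orient_lift L' acc" "z \<in> V \<times> V" "set acc \<subseteq> V \<times> V"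
  shows "orient_lift (z # L) acc \<doteq> orient_lift (z # L') acc"
  using assms by (auto intro!: eqv_mult eqv_add Y_in)

text \<open>The two expansions share the three terms of \<open>r\<close> and differ only in the
  order of \<open>z\<close> and \<open>w\<close> in the accumulator.\<close>

lemma orient_lift_swap:
  assumes "z \<in> V \<times> V" "w \<in> V \<times> V" "set L \<subseteq> V \<times> V" "set acc \<subseteq> V \<times> V"
  shows "orient_lift (z # w # L) acc \<doteq> orient_lift (w # z # L) acc"
proof -
  define r where "r = YY z * YY w * orient_lift L acc + YY z * orient_lift L (w # acc) + YY w * orient_lift L (z # acc)"
  have "Const (1/2) * (Const (1/2) * (orient_lift L (w # z # acc) + r)) \<doteq>
      Const (1/2) * (Const (1/2) * (orient_lift L (z # w # acc) + r))"
    using assms by (intro eqv_mult eqv_add orient_lift_acc_perm) auto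
  moreover have "orient_lift (z # w # L) acc = Const (1/2) * (Const (1/2) * (orient_lift L (w # z # acc) + r))"
  proof -
    have "c * (y * (c * (y' * g + g1)) + c * (y' * g2 + g3)) = c * (c * (g3 + (y * y' * g + y * g1 + y' * g2)))"
      for c y y' g g1 g2 g3 :: mpoly by (simp add: algebra_simps)
    then show ?thesis unfolding orient_lift.simps r_def .
  qed
  moreover have "orient_lift (w # z # L) acc = Const (1/2) * (Const (1/2) * (orient_lift L (z # w # acc) + r))"
  proof -
    have "c * (y' * (c * (y * g + g2)) + c * (y * g1 + g3)) = c * (c * (g3 + (y * y' * g + y * g1 + y' * g2)))"
      for c y y' g g1 g2 g3 :: mpoly by (simp add: algebra_simps)
    then show ?thesis unfolding orient_lift.simps r_def .
  qed
  ultimately show ?thesis by simp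
qed

lemma orient_lift_perm:
  assumes "mset L = mset L'" "set L \<subseteq> V \<times> V" "set acc \<subseteq> V \<times> V"
  shows "orient_lift L acc \<doteq> orient_lift L' acc"
proof -
  have "orient_lift (xs @ x # y # l) acc \<doteq> orient_lift (xs @ y # x # l) acc"
    if "set (xs @ x # y # l) \<subseteq> V \<times> V" "set acc \<subseteq> V \<times> V" for xs x y l acc
    using that
  proof (induction xs arbitrary: acc)
    case Nil
    then show ?case unfolding append_Nil by (intro orient_lift_swap) simp_all
  next
    case (Cons z xs)
    show ?case unfolding append_Cons
    proof (rule orient_lift_Cons_cong)
      show "orient_lift (xs @ x # y # l) acc' \<doteq> orient_lift (xs @ y # x # l) acc'" if "set acc' \<subseteq> V \<times> V" for acc'
        using Cons.prems that by (intro Cons.IH) simp_all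
    qed (use Cons.prems in simp_all)
  qed
  then show ?thesis
    by (rule perm_invariant[where h = "\<lambda>L. orient_lift L acc" and A = "V \<times> V"]) (use assms in simp_all)
qed

text \<open>Forms pushed later can be permuted behind \<open>x\<close> and \<open>y\<close>, so
  these two are still paired with each other when the accumulator is evaluated.\<close>

lemma orient_lift_acc_pair:
  "set L \<subseteq> V \<times> V \<Longrightarrow> set (x # y # acc) \<subseteq> V \<times> V \<Longrightarrow> orient_lift L (x # y # acc) \<doteq> - D x y * orient_lift L acc"
proof (induction L arbitrary: acc)
  case (Cons z L)
  have "orient_lift L (z # x # y # acc) \<doteq> orient_lift L (x # y # z # acc)"
    using Cons.prems by (intro orient_lift_acc_perm) auto
  also have "\<dots> \<doteq> - D x y * orient_lift L (z # acc)"
    using Cons.prems by (intro Cons.IH) auto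
  finally have "Const (1/2) * (YY z * orient_lift L (x # y # acc) + orient_lift L (z # x # y # acc)) \<doteq>
    Const (1/2) * (YY z * (- D x y * orient_lift L acc) + - D x y * orient_lift L (z # acc))"
    using Cons.prems by (intro eqv_mult eqv_add Cons.IH) (auto intro!: Y_in)
  moreover have "c * (y * (d * g) + d * g') = d * (c * (y * g + g'))" for c d y g g' :: mpoly
    by (simp add: algebra_simps)
  ultimately show ?case by (simp only: orient_lift.simps)
qed simp

lemma orient_lift_acc_antisym:
  "set L \<subseteq> V \<times> V \<Longrightarrow> set ((a, b) # acc) \<subseteq> V \<times> V \<Longrightarrow> orient_lift L ((a, b) # acc) + orient_lift L ((b, a) # acc) \<doteq> 0"
proof (induction L arbitrary: acc)
  case Nil
  have "skew_lift ((a, b) # acc) + skew_lift ((b, a) # acc) = 0"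
    by (cases acc) (simp_all add: D_swap(1)[of b a])
  then show ?case by simp
next
  case (Cons z L)
  have "orient_lift L (z # (a, b) # acc) + orient_lift L (z # (b, a) # acc) \<doteq>
    orient_lift L ((a, b) # z # acc) + orient_lift L ((b, a) # z # acc)"
    using Cons.prems by (intro eqv_add orient_lift_acc_perm) auto
  also have "\<dots> \<doteq> 0" using Cons.prems by (intro Cons.IH) auto
  finally have "Const (1/2) * (YY z * (orient_lift L ((a, b) # acc) + orient_lift L ((b, a) # acc)) +
      (orient_lift L (z # (a, b) # acc) + orient_lift L (z # (b, a) # acc))) \<doteq> Const (1/2) * (YY z * 0 + 0)"
    using Cons.prems by (intro eqv_mult eqv_add Cons.IH) (auto intro!: Y_in)
  moreover have "c * (y * (g1 + g2) + (h1 + h2)) = c * (y * g1 + h1) + c * (y * g2 + h2)" for c y g1 g2 h1 h2 :: mpoly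
    by (simp add: algebra_simps)
  ultimately show ?case by (simp only: orient_lift.simps mult_zero_right add_0_right)
qed

text \<open>With s the skew form, (Y i j + s i j)(Y k l + s k l) and (Y i l + s i l)(Y k j + s k j)
  are both 4 a_i b_j a_k b_l. This is the part of that identity linear in s.\<close>

lemma orient_lift_acc_linear:
  assumes "i \<in> V" "j \<in> V" "k \<in> V" "l \<in> V"
  shows "set L \<subseteq> V \<times> V \<Longrightarrow> set acc \<subseteq> V \<times> V \<Longrightarrow>
    Y i j * orient_lift L ((k, l) # acc) + Y k l * orient_lift L ((i, j) # acc)
      - Y i l * orient_lift L ((k, j) # acc) - Y k j * orient_lift L ((i, l) # acc) \<doteq> 0"
proof (induction L arbitrary: acc)
  case Nil
  show ?case
  proof (cases acc)
    \<comment> \<open>Paired with one more form, the relation is a multiple of a sum of two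
      3-minors. With an empty accumulator every summand is 0.\<close>
    case (Cons x acc')
    obtain p q where x: "x = (p, q)" "p \<in> V" "q \<in> V" using Nil Cons by auto
    have "Y i j * orient_lift [] ((k, l) # acc) + Y k l * orient_lift [] ((i, j) # acc)
        - Y i l * orient_lift [] ((k, j) # acc) - Y k j * orient_lift [] ((i, l) # acc)
      = - skew_lift acc' * (minor3 j p q i k l + minor3 l p q k i j)"
      by (simp add: Cons x minor3_def D_def) (simp add: algebra_simps Y_commute)
    also have "\<dots> \<in> CM n"
      using Nil Cons x assms by (intro CM_mult CM_add minor3_in_CM poly_in_uminus skew_lift_in) auto
    finally show ?thesis by (simp add: eqv_def)
  qed simp
next
  case (Cons z L)
  let ?S = "\<lambda>g. Y i j * g (k, l) + Y k l * g (i, j) - Y i l * g (k, j) - Y k j * g (i, l)"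
  have "?S (\<lambda>x. orient_lift L (z # x # acc)) \<doteq> ?S (\<lambda>x. orient_lift L (x # z # acc))"
    using Cons.prems assms by (intro eqv_diff eqv_add eqv_mult orient_lift_acc_perm Y_in) auto
  also have "\<dots> \<doteq> 0" using Cons.prems by (intro Cons.IH) auto
  finally have "Const (1/2) * (YY z * ?S (\<lambda>x. orient_lift L (x # acc)) + ?S (\<lambda>x. orient_lift L (z # x # acc))) \<doteq> Const (1/2) * (YY z * 0 + 0)"
    using Cons.prems by (intro eqv_mult eqv_add Cons.IH) (auto intro!: Y_in)
  moreover have "c * (y * (y1 * g1 + y2 * g2 - y3 * g3 - y4 * g4) + (y1 * h1 + y2 * h2 - y3 * h3 - y4 * h4)) =
      y1 * (c * (y * g1 + h1)) + y2 * (c * (y * g2 + h2)) - y3 * (c * (y * g3 + h3)) - y4 * (c * (y * g4 + h4))"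
    for c y y1 y2 y3 y4 g1 g2 g3 g4 h1 h2 h3 h4 :: mpoly
    by (simp add: algebra_simps)
  ultimately show ?case by (simp only: orient_lift.simps mult_zero_right add_0_right)
qed

text \<open>Exchange of partners, split by parity in the skew forms: \<open>?even\<close> cancels
  through 2-minors, \<open>?odd\<close> is the linear relation.\<close>

lemma orient_lift_exchange:
  assumes "i \<in> V" "j \<in> V" "k \<in> V" "l \<in> V" "set L \<subseteq> V \<times> V" "set acc \<subseteq> V \<times> V"
  shows "orient_lift ((i, j) # (k, l) # L) acc \<doteq> orient_lift ((i, l) # (k, j) # L) acc"
proof -
  let ?even = "(Y i j * Y k l - Y i l * Y k j) * orient_lift L acc + (orient_lift L ((k, l) # (i, j) # acc) - orient_lift L ((k, j) # (i, l) # acc))"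
  let ?odd = "Y i j * orient_lift L ((k, l) # acc) + Y k l * orient_lift L ((i, j) # acc)
      - Y i l * orient_lift L ((k, j) # acc) - Y k j * orient_lift L ((i, l) # acc)"
  have "?even \<doteq> (Y i j * Y k l - Y i l * Y k j) * orient_lift L acc + (- D (k, l) (i, j) * orient_lift L acc - - D (k, j) (i, l) * orient_lift L acc)"
    using assms by (intro eqv_add eqv_diff orient_lift_acc_pair) auto
  also have "\<dots> = 0"
    by (simp add: D_def algebra_simps Y_commute[of k i] Y_commute[of l j] Y_commute[of k j] Y_commute[of l i] Y_commute[of k l] Y_commute[of j i])
  finally have "Const (1/2) * (Const (1/2) * (?even + ?odd)) \<doteq> Const (1/2) * (Const (1/2) * (0 + 0))"
    using assms by (intro eqv_mult eqv_add orient_lift_acc_linear) auto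
  then have "Const (1/2) * (Const (1/2) * (?even + ?odd)) \<in> CM n" by (simp add: eqv_def)
  also have "Const (1/2) * (Const (1/2) * (?even + ?odd)) =
      orient_lift ((i, j) # (k, l) # L) acc - orient_lift ((i, l) # (k, j) # L) acc"
  proof -
    have "c * (c * (((y1 * y2 - y3 * y4) * g + (e1 - e2)) + (y1 * h1 + y2 * h2 - y3 * h3 - y4 * h4))) =
      c * (y1 * (c * (y2 * g + h1)) + c * (y2 * h2 + e1)) - c * (y3 * (c * (y4 * g + h3)) + c * (y4 * h4 + e2))"
      for c y1 y2 y3 y4 g e1 e2 h1 h2 h3 h4 :: mpoly
      by (simp add: algebra_simps)
    then show ?thesis by (simp only: orient_lift.simps fst_conv snd_conv)
  qed
  finally show ?thesis by (simp add: eqv_def)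
qed

text \<open>The lift depends only on the monomial, that is, on the multisets of a-indices and
  b-indices. If the head pair is missing from \<open>L'\<close>, one exchange of partners creates
  it.\<close>

lemma orient_lift_mset_cong:
  assumes "mset (map fst L) = mset (map fst L')" "mset (map snd L) = mset (map snd L')"
    "set L \<subseteq> V \<times> V" "set L' \<subseteq> V \<times> V" "set acc \<subseteq> V \<times> V"
  shows "orient_lift L acc \<doteq> orient_lift L' acc"
  using assms
proof (induction L arbitrary: L' acc)
  case (Cons x L)
  obtain s t where x: "x = (s, t)" by force
  have "s \<in> set (map fst L')" using Cons.prems(1) x by (metis fst_conv list.set_intros(1) list.simps(9) set_mset_mset)
  then obtain t' where st': "(s, t') \<in> set L'" by auto
  show ?case
  proof (cases "(s, t) \<in> set L'")
    case True
    then obtain ys zs where L': "L' = ys @ (s, t) # zs" by (meson split_list)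
    have "orient_lift (x # L) acc \<doteq> orient_lift (x # ys @ zs) acc"
      using Cons.prems L' x by (intro orient_lift_Cons_cong Cons.IH) auto
    also have "\<dots> \<doteq> orient_lift L' acc"
      using Cons.prems L' x by (intro orient_lift_perm) auto
    finally show ?thesis .
  next
    case False
    have "t \<in> set (map snd L')" using Cons.prems(2) x by (metis snd_conv list.set_intros(1) list.simps(9) set_mset_mset)
    then obtain s' where s't: "(s', t) \<in> set L'" by auto
    \<comment> \<open>The two pairs sit at different places of \<open>L'\<close>, since
      \<open>(s, t)\<close> itself does not occur there.\<close>
    obtain R where R: "mset L' = mset ((s, t') # (s', t) # R)"
    proof -
      obtain ys zs where 1: "L' = ys @ (s, t') # zs" using st' by (meson split_list)
      then have "(s', t) \<in> set (ys @ zs)" using s't False by auto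
      then obtain us vs where 2: "ys @ zs = us @ (s', t) # vs" by (meson split_list)
      have "mset L' = add_mset (s, t') (mset (ys @ zs))" using 1 by simp
      then show ?thesis using that[of "us @ vs"] 2 by simp
    qed
    have sR: "set L' = set ((s, t') # (s', t) # R)" using R by (metis set_mset_mset)
    have V: "s \<in> V" "t \<in> V" "s' \<in> V" "t' \<in> V" "set R \<subseteq> V \<times> V"
      using Cons.prems x sR by auto
    have mf: "mset (map fst L') = mset (map fst ((s, t') # (s', t) # R))"
      "mset (map snd L') = mset (map snd ((s, t') # (s', t) # R))"
      using R by (metis mset_map)+
    have "orient_lift (x # L) acc \<doteq> orient_lift (x # (s', t') # R) acc"
      using Cons.prems mf x V by (intro orient_lift_Cons_cong Cons.IH) auto
    also have "\<dots> \<doteq> orient_lift ((s, t') # (s', t) # R) acc"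
      unfolding x using V Cons.prems by (intro orient_lift_exchange) auto
    also have "\<dots> \<doteq> orient_lift L' acc"
      using V Cons.prems R by (intro orient_lift_perm) auto
    finally show ?thesis .
  qed
qed auto

end

section \<open>The generic configuration and the kernel of its length map\<close>

definition acoord :: "nat \<Rightarrow> mpoly" where "acoord i = (if i = 1 then 0 else Var (0, i))"

text \<open>In the target ring of \<open>gencfg\<close> the pairs (0, i) and (1, i) merely name the
  two coordinates of vertex i; (1, i) is not read there as an edge. Lengths are translation
  invariant, so vertex 1 is put at the origin.\<close>

definition bcoord :: "nat \<Rightarrow> mpoly" where "bcoord i = (if i = 1 then 0 else Var (1, i))"

abbreviation "gencfg \<equiv> Const_alg.cfg acoord bcoord"

interpretation gencfg: comm_ring_hom gencfg
  by (rule Const_alg.cfg_hom)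

lemma gencfg_Const [simp]: "gencfg (Const a) = Const a"
  by (simp add: Const_alg.cfg_def)

context gram
begin

lemma gencfg_Y: "i \<in> V \<Longrightarrow> j \<in> V \<Longrightarrow> gencfg (Y i j) = acoord i * bcoord j + acoord j * bcoord i"
  by (auto simp: Y_def V_def gencfg.hom_minus gencfg.hom_add Const_alg.cfg_CM_entry acoord_def bcoord_def algebra_simps)

definition pair_mono :: "(nat \<times> nat) list \<Rightarrow> mono" where
  "pair_mono L = (\<Sum>z\<leftarrow>L. sg (0, fst z) 1 + sg (1, snd z) 1)"

lemma lookup_pair_mono:
  "lk (pair_mono L) (0, s) = count (mset (map fst L)) s" "lk (pair_mono L) (1, s) = count (mset (map snd L)) s"
  by (induction L) (auto simp: pair_mono_def lookup_add lookup_single when_def)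

lemma pair_mono_eq_imp:
  assumes "pair_mono L = pair_mono L'"
  shows "mset (map fst L) = mset (map fst L')" "mset (map snd L) = mset (map snd L')"
  using lookup_pair_mono[of L] lookup_pair_mono[of L'] assms by (auto intro!: multiset_eqI)

lemma pair_mono_Cons:
  assumes "a \<in> V" "b \<in> V"
  shows "sg (pair_mono L) 1 * (acoord a * bcoord b) = sg (pair_mono ((a, b) # L)) 1"
  using assms by (simp add: acoord_def bcoord_def V_def Var_def mult_single pair_mono_def add.commute)

text \<open>An arbitrary pairing is chosen, which \<open>orient_lift_mset_cong\<close> makes
  harmless. Monomials without a pairing, such as those of unequal degree in a and b, go to
  0.\<close>

definition mono_lift :: "mono \<Rightarrow> mpoly" where
  "mono_lift \<mu> = (if \<exists>L. set L \<subseteq> V \<times> V \<and> pair_mono L = \<mu>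
    then orient_lift (SOME L. set L \<subseteq> V \<times> V \<and> pair_mono L = \<mu>) [] else 0)"

lemma mono_lift_pair_mono:
  assumes "set L \<subseteq> V \<times> V"
  shows "mono_lift (pair_mono L) \<doteq> orient_lift L []"
proof -
  let ?P = "\<lambda>L'. set L' \<subseteq> V \<times> V \<and> pair_mono L' = pair_mono L"
  have "?P (SOME L'. ?P L')" by (rule someI[of ?P L]) (use assms in simp)
  moreover have "mono_lift (pair_mono L) = orient_lift (SOME L'. ?P L') []" using assms by (auto simp: mono_lift_def)
  ultimately show ?thesis
    using assms pair_mono_eq_imp[of "SOME L'. ?P L'" L] by (auto intro!: orient_lift_mset_cong)
qed

definition poly_lift :: "mpoly \<Rightarrow> mpoly" where
  "poly_lift q = (\<Sum>\<mu>\<in>ks q. Const (lk q \<mu>) * mono_lift \<mu>)"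

lemma poly_lift_add: "poly_lift (p + q) = poly_lift p + poly_lift q"
  unfolding poly_lift_def by (rule setsum_keys_plus_distrib) (simp_all add: Const_hom.hom_add algebra_simps)

lemma poly_lift_single: "poly_lift (sg \<mu> a) = Const a * mono_lift \<mu>"
  by (simp add: poly_lift_def)

lemma poly_lift_Const_mult: "poly_lift (Const a * q) = Const a * poly_lift q"
proof (cases "a = 0")
  case False
  have lk: "lk (Const a * q) \<mu> = a * lk q \<mu>" for \<mu>
    by (subst mpoly_decompose[of q])
      (simp add: sum_distrib_left Const_times_single lookup_sum lookup_single when_def in_keys_iff)
  then have "ks (Const a * q) = ks q" using False by (auto simp: in_keys_iff)
  then show ?thesis by (simp add: poly_lift_def lk Const_hom.hom_mult sum_distrib_left mult.assoc)
qed (simp add: poly_lift_def)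

text \<open>For \<open>L = []\<close> this says that \<open>poly_lift\<close> is a section of
  \<open>gencfg\<close> modulo the ideal. The extra monomial is the strengthening needed to induct
  over multiplication by \<open>Y\<close>.\<close>

definition recovered :: "mpoly \<Rightarrow> bool" where
  "recovered f \<longleftrightarrow> f \<in> poly_in (Xn n) \<and>
    (\<forall>L. set L \<subseteq> V \<times> V \<longrightarrow> poly_lift (sg (pair_mono L) 1 * gencfg f) \<doteq> f * orient_lift L [])"

lemma recovered_Const_mult:
  assumes "recovered f"
  shows "recovered (Const a * f)"
  unfolding recovered_def
proof (intro conjI allI impI)
  show "Const a * f \<in> poly_in (Xn n)" using assms by (auto simp: recovered_def)
  fix L assume L: "set L \<subseteq> V \<times> V"
  have "sg (pair_mono L) 1 * gencfg (Const a * f) = Const a * (sg (pair_mono L) 1 * gencfg f)"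
    by (simp only: gencfg.hom_mult gencfg_Const mult.left_commute)
  moreover have "Const a * poly_lift (sg (pair_mono L) 1 * gencfg f) \<doteq> Const a * (f * orient_lift L [])"
    using assms L by (intro eqv_mult) (auto simp: recovered_def)
  ultimately show "poly_lift (sg (pair_mono L) 1 * gencfg (Const a * f)) \<doteq> Const a * f * orient_lift L []"
    by (simp only: poly_lift_Const_mult mult.assoc)
qed

lemma recovered_add:
  assumes "recovered f" "recovered g"
  shows "recovered (f + g)"
  using assms by (auto simp: recovered_def gencfg.hom_add distrib_left distrib_right poly_lift_add intro!: eqv_add)

lemma recovered_1: "recovered 1"
  using mono_lift_pair_mono by (auto simp: recovered_def poly_lift_single)

lemma recovered_Y_mult:
  assumes f: "recovered f" and ab: "a \<in> V" "b \<in> V"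
  shows "recovered (Y a b * f)"
  unfolding recovered_def
proof (intro conjI allI impI)
  show "Y a b * f \<in> poly_in (Xn n)" using f ab by (auto simp: recovered_def intro!: Y_in)
  fix L assume L: "set L \<subseteq> V \<times> V"
  have "sg (pair_mono L) 1 * gencfg (Y a b * f) =
      sg (pair_mono L) 1 * (acoord a * bcoord b) * gencfg f + sg (pair_mono L) 1 * (acoord b * bcoord a) * gencfg f"
    using ab by (simp add: gencfg.hom_mult gencfg_Y algebra_simps)
  also have "poly_lift \<dots> = poly_lift (sg (pair_mono ((a, b) # L)) 1 * gencfg f) + poly_lift (sg (pair_mono ((b, a) # L)) 1 * gencfg f)"
    by (simp only: pair_mono_Cons ab poly_lift_add)
  also have "\<dots> \<doteq> f * orient_lift ((a, b) # L) [] + f * orient_lift ((b, a) # L) []"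
    using f L ab by (intro eqv_add) (auto simp: recovered_def simp del: orient_lift.simps)
  \<comment> \<open>Each orientation contributes half of \<open>Y a b\<close>, while their skew
    parts are opposite and cancel in the next step.\<close>
  also have "\<dots> = f * (Const (1/2) * (2 * (Y a b * orient_lift L []) + (orient_lift L [(a, b)] + orient_lift L [(b, a)])))"
    by (simp add: Y_commute[of b a] algebra_simps)
  also have "\<dots> \<doteq> f * (Const (1/2) * (2 * (Y a b * orient_lift L []) + 0))"
    by (rule eqv_mult[OF _ eqv_mult[OF _ eqv_add[OF eqv_refl orient_lift_acc_antisym]]])
      (use f L ab in \<open>auto simp: recovered_def\<close>)
  also have "Const (1/2) * (2 * (Y a b * orient_lift L []) + 0) = (Const (1/2) * 2) * (Y a b * orient_lift L [])"
    by (simp only: add_0_right mult.assoc)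
  also have "Const (1/2) * 2 = 1"
    using Const_hom.hom_mult[of "1/2" 2] by (simp add: Const_def)
  finally show "poly_lift (sg (pair_mono L) 1 * gencfg (Y a b * f)) \<doteq> Y a b * f * orient_lift L []"
    by (simp add: mult_ac)
qed

text \<open>Polarization: \<open>Y j j\<close> is twice the squared distance from vertex 1, so the
  Gram entries generate all the variables.\<close>

lemma Var_eq_Y:
  assumes "(i, j) \<in> Xn n"
  shows "Var (i, j) = (if i = 1 then Const (1/2) * Y j j
    else Const (1/2) * Y i i + Const (1/2) * Y j j + Const (- 1) * Y i j)"
proof -
  have Yd: "Y k k = 2 * CM_entry 1 k" for k by (simp add: Y_def CM_entry_def[of k k])
  have "Const (1/2) * (2 * p) = p" for p
  proof -
    have "Const (1/2) * 2 = (1 :: mpoly)"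
      using Const_hom.hom_mult[of "1/2" 2] by (simp add: Const_def)
    then show ?thesis by (metis mult.assoc mult_1)
  qed
  then have half: "Const (1/2) * Y k k = CM_entry 1 k" for k by (simp add: Yd)
  have m1: "Const (- 1) = - 1" by (simp add: Const_hom.hom_uminus)
  show ?thesis
    using assms unfolding half m1 by (auto simp: Y_def CM_entry_def Xn_def)
qed

lemma recovered_all: "f \<in> poly_in (Xn n) \<Longrightarrow> recovered f"
proof (induction f rule: poly_in_induct)
  case (Const c)
  then show ?case using recovered_Const_mult[OF recovered_1, of c] by simp
next
  case (Var e p)
  obtain i j where e: "e = (i, j)" by force
  have ij: "i = 1 \<or> i \<in> V" "j \<in> V" using Var e by (auto simp: Xn_def V_def)
  show ?case
  proof (cases "i = 1")
    case True
    then have eq: "Var e * p = Const (1/2) * (Y j j * p)"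
      using Var_eq_Y[of i j] Var e by (simp add: mult.assoc)
    show ?thesis unfolding eq using Var ij by (intro recovered_Const_mult recovered_Y_mult) auto
  next
    case False
    then have eq: "Var e * p = Const (1/2) * (Y i i * p) + Const (1/2) * (Y j j * p) + Const (- 1) * (Y i j * p)"
      using Var_eq_Y[of i j] Var e by (simp add: algebra_simps)
    show ?thesis unfolding eq using Var ij False
      by (intro recovered_add recovered_Const_mult recovered_Y_mult) auto
  qed
qed (rule recovered_add)

lemma kernel_subset_CM:
  assumes "f \<in> poly_in (Xn n)" "gencfg f = 0"
  shows "f \<in> CM n"
proof -
  have "poly_lift (sg (pair_mono []) 1 * gencfg f) \<doteq> f * orient_lift [] []"
    using recovered_all[OF assms(1)] unfolding recovered_def by (metis empty_subsetI list.set(1))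
  then have "0 \<doteq> f" using assms(2) by (simp add: poly_lift_def)
  then show ?thesis using CM_uminus[of "- f" n] by (simp add: eqv_def)
qed

end

theorem CM_eq_kernel: "f \<in> CM n \<longleftrightarrow> f \<in> poly_in (Xn n) \<and> gencfg f = 0"
proof (intro iffI conjI)
  assume *: "f \<in> poly_in (Xn n) \<and> gencfg f = 0"
  show "f \<in> CM n"
  proof (cases "1 \<le> n")
    case True
    then interpret gram n by unfold_locales
    show ?thesis using kernel_subset_CM * by blast
  next
    \<comment> \<open>Here \<open>n = 0\<close>: there is no base vertex, but there are no variables
      either, and \<open>gencfg\<close> fixes constants.\<close>
    case False
    then have "Xn n = {}" by (auto simp: Xn_def)
    then obtain c where "f = Const c" using * poly_in_empty by auto
    then show ?thesis using * by simp
  qed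
qed (auto simp: CM_poly_in Const_alg.CM_vanishes)

theorem CM_prime:
  assumes "f * g \<in> CM n" "f \<in> poly_in (Xn n)" "g \<in> poly_in (Xn n)"
  shows "f \<in> CM n \<or> g \<in> CM n"
  using assms by (simp add: CM_eq_kernel gencfg.hom_mult)

section \<open>Sparse graphs\<close>

text \<open>Laman's count, with the 3 moved across to avoid truncated subtraction.\<close>

definition sparse :: "edge set \<Rightarrow> bool" where
  "sparse L \<longleftrightarrow> finite L \<and> (\<forall>e\<in>L. fst e < snd e) \<and>
    (\<forall>U. finite U \<and> 2 \<le> card U \<longrightarrow> card (span_edges L U) + 3 \<le> 2 * card U)"

definition edge_of :: "nat \<Rightarrow> nat \<Rightarrow> edge" where
  "edge_of a b = (min a b, max a b)"

lemma edge_of_inject: "edge_of a b = edge_of a c \<longleftrightarrow> b = c"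
  by (auto simp: edge_of_def min_def max_def split: if_splits)

lemma edge_of_ends: "fst (edge_of a b) \<in> U \<and> snd (edge_of a b) \<in> U \<longleftrightarrow> a \<in> U \<and> b \<in> U"
  by (auto simp: edge_of_def min_def max_def)

lemma edge_of_less: "a \<noteq> b \<Longrightarrow> fst (edge_of a b) < snd (edge_of a b)"
  by (auto simp: edge_of_def)

lemma finite_span_edges [simp]: "finite L \<Longrightarrow> finite (span_edges L U)"
  by (simp add: span_edges_def)

lemma span_edges_Int: "span_edges L U \<inter> span_edges L W = span_edges L (U \<inter> W)"
  by (auto simp: span_edges_def)

lemma sparse_finite: "sparse L \<Longrightarrow> finite L"
  by (simp add: sparse_def)

lemma sparse_less: "sparse L \<Longrightarrow> e \<in> L \<Longrightarrow> fst e < snd e"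
  by (simp add: sparse_def)

lemma sparseD: "sparse L \<Longrightarrow> finite U \<Longrightarrow> 2 \<le> card U \<Longrightarrow> card (span_edges L U) + 3 \<le> 2 * card U"
  by (simp add: sparse_def)

lemma sparse_subset: "sparse L \<Longrightarrow> L' \<subseteq> L \<Longrightarrow> sparse L'"
proof -
  assume L: "sparse L" and sub: "L' \<subseteq> L"
  have fin: "finite L" "finite L'" using L sub by (auto simp: sparse_def intro: finite_subset)
  have "card (span_edges L' U) + 3 \<le> 2 * card U" if "finite U" "2 \<le> card U" for U
  proof -
    have "card (span_edges L' U) \<le> card (span_edges L U)"
      using sub fin by (intro card_mono) (auto simp: span_edges_def)
    then show ?thesis using sparseD[OF L that] by simp
  qed
  then show "sparse L'" using L sub fin by (auto simp: sparse_def)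
qed

text \<open>The degrees add up to 2|L|, which is at most 4|V| - 6, so not all of them can be 4 or
  more.\<close>

lemma ex_low_degree:
  assumes L: "sparse L" "L \<noteq> {}"
  shows "\<exists>v\<in>verts L. card {e\<in>L. fst e = v \<or> snd e = v} \<le> 3"
proof (rule ccontr)
  assume "\<not> ?thesis"
  then have deg: "4 \<le> card {e\<in>L. fst e = v \<or> snd e = v}" if "v \<in> verts L" for v
    using that by force
  have fin: "finite L" "finite (verts L)" using L by (auto simp: sparse_def verts_def)
  have card_filter: "card {x\<in>A. P x} = (\<Sum>x\<in>A. if P x then 1 else 0)" if "finite A" for A :: "'x set" and P
    using that by (simp add: sum.If_cases Int_def)
  have "4 * card (verts L) = (\<Sum>v\<in>verts L. 4)" by simp
  also have "\<dots> \<le> (\<Sum>v\<in>verts L. card {e\<in>L. fst e = v \<or> snd e = v})"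
    using deg by (intro sum_mono)
  also have "\<dots> = (\<Sum>v\<in>verts L. \<Sum>e\<in>L. if fst e = v \<or> snd e = v then 1 else 0)"
    by (simp only: card_filter[OF fin(1)])
  also have "\<dots> = (\<Sum>e\<in>L. \<Sum>v\<in>verts L. if fst e = v \<or> snd e = v then 1 else 0)"
    by (rule sum.swap)
  also have "\<dots> = (\<Sum>e\<in>L. 2)"
  proof (rule sum.cong[OF refl])
    fix e assume e: "e \<in> L"
    have "{v\<in>verts L. fst e = v \<or> snd e = v} = {fst e, snd e}"
      using e by (auto simp: verts_def)
    moreover have "fst e < snd e" using sparse_less[OF L(1) e] .
    ultimately show "(\<Sum>v\<in>verts L. if fst e = v \<or> snd e = v then 1 else 0) = (2 :: nat)"
      using card_filter[OF fin(2), of "\<lambda>v. fst e = v \<or> snd e = v"] by simp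
  qed
  finally have "4 * card (verts L) \<le> 2 * card L" by simp
  moreover have "span_edges L (verts L) = L" by (auto simp: span_edges_def verts_def)
  moreover have "2 \<le> card (verts L)"
  proof -
    obtain e where e: "e \<in> L" using L by blast
    then have "{fst e, snd e} \<subseteq> verts L" by (auto simp: verts_def)
    then have "card {fst e, snd e} \<le> card (verts L)" using fin by (intro card_mono)
    moreover have "fst e \<noteq> snd e" using sparse_less[OF L(1) e] by simp
    ultimately show ?thesis by simp
  qed
  ultimately show False using sparseD[OF L(1) fin(2)] by simp
qed

section \<open>Tight vertex sets and the inverse Henneberg move\<close>

definition tight :: "edge set \<Rightarrow> nat set \<Rightarrow> bool" where
  "tight L U \<longleftrightarrow> finite U \<and> 2 * card U \<le> card (span_edges L U) + 3"

text \<open>The number of spanned edges is supermodular, and sparsity bounds it on the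
  intersection.\<close>

lemma tight_Un:
  assumes L: "sparse L" and U: "tight L U" and W: "tight L W" and c: "2 \<le> card (U \<inter> W)"
  shows "tight L (U \<union> W)"
proof -
  have fin: "finite L" "finite U" "finite W" using assms by (auto simp: tight_def sparse_def)
  have "card (span_edges L U) + card (span_edges L W) =
      card (span_edges L U \<union> span_edges L W) + card (span_edges L (U \<inter> W))"
    using card_Un_Int[of "span_edges L U" "span_edges L W"] fin by (simp add: span_edges_Int)
  moreover have "card (span_edges L U \<union> span_edges L W) \<le> card (span_edges L (U \<union> W))"
    using fin by (intro card_mono) (auto simp: span_edges_def)
  moreover have "card (span_edges L (U \<inter> W)) + 3 \<le> 2 * card (U \<inter> W)"
    using sparseD[OF L _ c] fin by simp
  moreover have "card U + card W = card (U \<union> W) + card (U \<inter> W)"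
    using card_Un_Int fin by blast
  ultimately show ?thesis using U W fin by (simp add: tight_def)
qed

text \<open>Single vertices span no edge, so the edge counts add up while the vertex count drops by
  3: a sum of three bounds 2k - 3 is again 2k - 3 for the union.\<close>

lemma tight_triangle:
  assumes L: "sparse L" and t: "tight L U" "tight L W" "tight L Z"
    and i: "U \<inter> W = {q}" "U \<inter> Z = {p}" "W \<inter> Z = {r}" and d: "p \<noteq> r"
  shows "tight L (U \<union> W \<union> Z)"
proof -
  have fin: "finite L" "finite U" "finite W" "finite Z" using L t by (auto simp: tight_def sparse_def)
  have e: "span_edges L {x} = {}" for x using sparse_less[OF L] by (force simp: span_edges_def)
  have "(U \<union> W) \<inter> Z = {p, r}" using i by auto
  then have c: "card (U \<union> W \<union> Z) + 3 = card U + card W + card Z"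
    using card_Un_Int[of U W] card_Un_Int[of "U \<union> W" Z] fin i d by simp
  have "card (span_edges L U \<union> span_edges L W) = card (span_edges L U) + card (span_edges L W)"
    using fin i e by (intro card_Un_disjoint) (simp_all add: span_edges_Int)
  moreover have "card (span_edges L U \<union> span_edges L W \<union> span_edges L Z) =
      card (span_edges L U \<union> span_edges L W) + card (span_edges L Z)"
    using fin i e by (intro card_Un_disjoint) (simp_all add: Int_Un_distrib2 span_edges_Int)
  moreover have "card (span_edges L U \<union> span_edges L W \<union> span_edges L Z) \<le> card (span_edges L (U \<union> W \<union> Z))"
    using fin by (intro card_mono) (auto simp: span_edges_def)
  ultimately show ?thesis using t c fin by (simp add: tight_def)
qed

text \<open>If joining any two neighbours of \<open>v\<close> failed, each pair would lie in a tight
  set of \<open>L0\<close> avoiding \<open>v\<close>. Two of these sets sharing two vertices, or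
  otherwise all three as a triangle, unite to a tight set containing \<open>p\<close>,
  \<open>q\<close> and \<open>r\<close>, which leaves no room for the edges at
  \<open>v\<close>.\<close>

lemma ex_inverse_extension:
  assumes L: "sparse L" and pqr: "p \<noteq> q" "q \<noteq> r" "p \<noteq> r" and v: "v \<noteq> p" "v \<noteq> q" "v \<noteq> r"
    and star: "{e\<in>L. fst e = v \<or> snd e = v} = {edge_of v p, edge_of v q, edge_of v r}"
  defines "L0 \<equiv> {e\<in>L. fst e \<noteq> v \<and> snd e \<noteq> v}"
  shows "\<exists>a b c. {a, b, c} = {p, q, r} \<and> a \<noteq> b \<and> b \<noteq> c \<and> a \<noteq> c \<and> edge_of a b \<notin> L0 \<and>
    sparse (insert (edge_of a b) L0)"
proof (rule ccontr)
  assume no: "\<not> ?thesis"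
  have L0: "sparse L0" using sparse_subset[OF L] by (auto simp: L0_def)
  have fin: "finite L" "finite L0" using L L0 by (auto simp: sparse_def)
  have ex: "\<exists>U. tight L0 U \<and> a \<in> U \<and> b \<in> U \<and> v \<notin> U"
    if abc: "{a, b, c} = {p, q, r}" "a \<noteq> b" "b \<noteq> c" "a \<noteq> c" for a b c
  proof -
    have av: "a \<noteq> v" "b \<noteq> v" using abc(1) v by auto
    have "edge_of a b \<in> L0 \<or> \<not> sparse (insert (edge_of a b) L0)" using no abc by blast
    then show ?thesis
    proof
      assume "edge_of a b \<in> L0"
      then have "{edge_of a b} \<subseteq> span_edges L0 {a, b}"
        using edge_of_ends[of a b "{a, b}"] by (simp add: span_edges_def)
      then have "card {edge_of a b} \<le> card (span_edges L0 {a, b})"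
        using fin by (intro card_mono) auto
      then have "tight L0 {a, b}" using abc by (simp add: tight_def)
      then show ?thesis using av by auto
    next
      assume "\<not> sparse (insert (edge_of a b) L0)"
      moreover have "\<forall>e\<in>insert (edge_of a b) L0. fst e < snd e"
        using edge_of_less[OF abc(2)] sparse_less[OF L0] by auto
      ultimately obtain U where U: "finite U" "2 \<le> card U"
        "2 * card U < card (span_edges (insert (edge_of a b) L0) U) + 3"
        using fin by (auto simp: sparse_def not_le)
      have ab: "a \<in> U \<and> b \<in> U"
      proof (rule ccontr)
        assume "\<not> (a \<in> U \<and> b \<in> U)"
        then have "span_edges (insert (edge_of a b) L0) U = span_edges L0 U"
          using edge_of_ends[of a b U] by (auto simp: span_edges_def)
        then show False using U sparseD[OF L0 U(1,2)] by simp
      qed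
      have "span_edges (insert (edge_of a b) L0) U \<subseteq> insert (edge_of a b) (span_edges L0 (U - {v}))"
        by (auto simp: span_edges_def L0_def)
      then have "card (span_edges (insert (edge_of a b) L0) U) \<le> card (insert (edge_of a b) (span_edges L0 (U - {v})))"
        using fin by (intro card_mono) auto
      also have "\<dots> \<le> Suc (card (span_edges L0 (U - {v})))" by (rule card_insert_le_m1) auto
      finally have "2 * card U \<le> card (span_edges L0 (U - {v})) + 3" using U by simp
      moreover have "card (U - {v}) \<le> card U" using U by (simp add: card_mono)
      ultimately have "tight L0 (U - {v})" using U by (simp add: tight_def)
      then show ?thesis using ab av by auto
    qed
  qed
  \<comment> \<open>Adding \<open>v\<close> raises the bound 2|U| - 3 by 2 but the number of edges
    by 3.\<close>
  have no_tight: False if U: "tight L0 U" "p \<in> U" "q \<in> U" "r \<in> U" "v \<notin> U" for U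
  proof -
    let ?S = "{edge_of v p, edge_of v q, edge_of v r}"
    have S: "?S \<subseteq> L" using star by blast
    have "card ?S = 3" using pqr by (simp add: edge_of_inject)
    moreover have "card (span_edges L0 U \<union> ?S) = card (span_edges L0 U) + card ?S"
      using fin star by (intro card_Un_disjoint) (auto simp: span_edges_def L0_def)
    moreover have "span_edges L0 U \<union> ?S \<subseteq> span_edges L (insert v U)"
      using S U edge_of_ends[of v p "insert v U"] edge_of_ends[of v q "insert v U"] edge_of_ends[of v r "insert v U"]
      by (auto simp: span_edges_def L0_def)
    then have "card (span_edges L0 U \<union> ?S) \<le> card (span_edges L (insert v U))"
      using fin by (intro card_mono) auto
    moreover have "card (insert v U) = Suc (card U)" "finite U" using U by (auto simp: tight_def)
    moreover have "card {p, q} \<le> card U" using U \<open>finite U\<close> by (intro card_mono) auto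
    then have "2 \<le> card U" using pqr by simp
    ultimately show False using sparseD[OF L, of "insert v U"] U(1) by (simp add: tight_def)
  qed
  obtain U where U: "tight L0 U" "p \<in> U" "q \<in> U" "v \<notin> U" using ex[of p q r] pqr by auto
  obtain W where W: "tight L0 W" "q \<in> W" "r \<in> W" "v \<notin> W" using ex[of q r p] pqr by auto
  obtain Z where Z: "tight L0 Z" "p \<in> Z" "r \<in> Z" "v \<notin> Z" using ex[of p r q] pqr by auto
  have fU: "finite U" "finite W" "finite Z" using U W Z by (auto simp: tight_def)
  have one: "A = {x}" if "\<not> 2 \<le> card A" "x \<in> A" "finite A" for A and x :: nat
  proof -
    have "card A \<le> Suc 0" using that by simp
    then show ?thesis using that(2,3) card_le_Suc0_iff_eq by blast
  qed
  have "\<not> 2 \<le> card (U \<inter> W)"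
    using tight_Un[OF L0 U(1) W(1)] no_tight[of "U \<union> W"] U W by auto
  then have 1: "U \<inter> W = {q}" using one U W fU by blast
  have "\<not> 2 \<le> card (U \<inter> Z)"
    using tight_Un[OF L0 U(1) Z(1)] no_tight[of "U \<union> Z"] U Z by auto
  then have 2: "U \<inter> Z = {p}" using one U Z fU by blast
  have "\<not> 2 \<le> card (W \<inter> Z)"
    using tight_Un[OF L0 W(1) Z(1)] no_tight[of "W \<union> Z"] W Z by auto
  then have 3: "W \<inter> Z = {r}" using one W Z fU by blast
  show False
    using tight_triangle[OF L0 U(1) W(1) Z(1) 1 2 3] pqr no_tight[of "U \<union> W \<union> Z"] U W Z by auto
qed

section \<open>Infinitesimal independence\<close>

text \<open>The derivative of \<open>(\<alpha> i - \<alpha> j) * (\<beta> i - \<beta> j)\<close> in the direction \<open>(\<alpha>', \<beta>')\<close>.\<close>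

definition dform :: "(nat \<Rightarrow> 'a :: comm_ring_1) \<Rightarrow> (nat \<Rightarrow> 'a) \<Rightarrow> (nat \<Rightarrow> 'a) \<Rightarrow> (nat \<Rightarrow> 'a) \<Rightarrow> edge \<Rightarrow> 'a" where
  "dform \<alpha> \<beta> \<alpha>' \<beta>' e = (\<alpha> (fst e) - \<alpha> (snd e)) * (\<beta>' (fst e) - \<beta>' (snd e))
    + (\<beta> (fst e) - \<beta> (snd e)) * (\<alpha>' (fst e) - \<alpha>' (snd e))"

lemma dform_edge_of:
  "dform \<alpha> \<beta> \<alpha>' \<beta>' (edge_of i j) = (\<alpha> i - \<alpha> j) * (\<beta>' i - \<beta>' j) + (\<beta> i - \<beta> j) * (\<alpha>' i - \<alpha>' j)"
  by (cases "i \<le> j") (simp_all add: dform_def edge_of_def algebra_simps)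

lemma dform_sum:
  "dform \<alpha> \<beta> (\<lambda>i. \<Sum>k\<in>K. x k * a k i) (\<lambda>i. \<Sum>k\<in>K. x k * b k i) e = (\<Sum>k\<in>K. x k * dform \<alpha> \<beta> (a k) (b k) e)"
  by (simp add: dform_def algebra_simps sum.distrib sum_subtractf sum_distrib_left)

lemma dform_line:
  "dform (\<lambda>i. \<alpha> i + t * \<alpha>1 i) (\<lambda>i. \<beta> i + t * \<beta>1 i) \<alpha>' \<beta>' e = dform \<alpha> \<beta> \<alpha>' \<beta>' e + t * dform \<alpha>1 \<beta>1 \<alpha>' \<beta>' e"
  by (simp add: dform_def algebra_simps)

text \<open>Infinitesimal independence of the edge lengths of \<open>L\<close> at the configuration \<open>(\<alpha>, \<beta>)\<close>,
  as surjectivity of the derivative.\<close>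

definition surj_at :: "(nat \<Rightarrow> rat) \<Rightarrow> (nat \<Rightarrow> rat) \<Rightarrow> edge set \<Rightarrow> bool" where
  "surj_at \<alpha> \<beta> L \<longleftrightarrow> (\<forall>y. \<exists>\<alpha>' \<beta>'. \<forall>e\<in>L. dform \<alpha> \<beta> \<alpha>' \<beta>' e = y e)"

lemma linear_solve:
  fixes A :: "'a :: field mat"
  assumes A: "A \<in> carrier_mat m m" and d: "det A \<noteq> 0"
  shows "\<exists>x. \<forall>i<m. (\<Sum>k<m. A $$ (i, k) * x k) = y i"
proof -
  note adj = adj_mat[OF A]
  define x where "x = (\<lambda>k. (\<Sum>l<m. adj_mat A $$ (k, l) * y l) / det A)"
  have "(\<Sum>k<m. A $$ (i, k) * x k) = y i" if i: "i < m" for i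
  proof -
    have "(\<Sum>k<m. A $$ (i, k) * x k) = (\<Sum>k<m. \<Sum>l<m. A $$ (i, k) * adj_mat A $$ (k, l) * y l) / det A"
      by (simp add: x_def sum_divide_distrib sum_distrib_left mult.assoc)
    also have "(\<Sum>k<m. \<Sum>l<m. A $$ (i, k) * adj_mat A $$ (k, l) * y l) =
        (\<Sum>l<m. (\<Sum>k<m. A $$ (i, k) * adj_mat A $$ (k, l)) * y l)"
      unfolding sum_distrib_right by (rule sum.swap)
    also have "\<dots> = (\<Sum>l<m. if l = i then det A * y l else 0)"
    proof (rule sum.cong[OF refl])
      fix l assume l: "l \<in> {..<m}"
      have "(\<Sum>k<m. A $$ (i, k) * adj_mat A $$ (k, l)) = (A * adj_mat A) $$ (i, l)"
        using A adj(1) i l by (simp add: scalar_prod_def atLeast0LessThan)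
      also have "\<dots> = (if l = i then det A else 0)"
        unfolding adj(2) using i l by simp
      finally show "(\<Sum>k<m. A $$ (i, k) * adj_mat A $$ (k, l)) * y l = (if l = i then det A * y l else 0)"
        by simp
    qed
    finally show ?thesis using i d by simp
  qed
  then show ?thesis by blast
qed

text \<open>In velocities dual to the edges the derivative is the identity matrix at t = 0. Along
  the line its determinant is a polynomial in t with value 1 at 0, so only its finitely many roots
  can be bad.\<close>

lemma surj_perturb:
  assumes L: "finite L" and s: "surj_at \<alpha> \<beta> L"
  shows "finite {t. \<not> surj_at (\<lambda>i. \<alpha> i + t * \<alpha>1 i) (\<lambda>i. \<beta> i + t * \<beta>1 i) L}"
proof -
  define m where "m = card L"
  obtain f where f: "bij_betw f {0..<m} L" using ex_bij_betw_nat_finite[OF L] by (auto simp: m_def)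
  have "\<forall>k. \<exists>a b. \<forall>e\<in>L. dform \<alpha> \<beta> a b e = (if e = f k then 1 else 0)"
    using s[unfolded surj_at_def, THEN spec, of "\<lambda>e. if e = f _ then 1 else 0"] by simp
  then obtain a b where ab: "\<And>k e. e \<in> L \<Longrightarrow> dform \<alpha> \<beta> (a k) (b k) e = (if e = f k then 1 else 0)"
    by metis
  define M where "M = (\<lambda>i k. dform \<alpha>1 \<beta>1 (a k) (b k) (f i))"
  define P where "P = mat m m (\<lambda>(i, k). [:if i = k then 1 else 0, M i k:])"
  have ev: "poly (det P) t = det (mat m m (\<lambda>(i, k). (if i = k then 1 else 0) + t * M i k))" for t
  proof -
    have hom: "comm_ring_hom (\<lambda>p :: rat poly. poly p t)" by unfold_locales auto
    have "map_mat (\<lambda>p. poly p t) P = mat m m (\<lambda>(i, k). (if i = k then 1 else 0) + t * M i k)"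
      by (rule eq_matI) (auto simp: P_def)
    then show ?thesis using comm_ring_hom.hom_det[OF hom, of P] by simp
  qed
  have "mat m m (\<lambda>(i, k). (if i = k then 1 else 0) + 0 * M i k) = 1\<^sub>m m" by (rule eq_matI) auto
  then have "poly (det P) 0 = 1" unfolding ev by simp
  then have "det P \<noteq> 0" by auto
  moreover have "surj_at (\<lambda>i. \<alpha> i + t * \<alpha>1 i) (\<lambda>i. \<beta> i + t * \<beta>1 i) L" if t: "poly (det P) t \<noteq> 0" for t
    unfolding surj_at_def
  proof
    fix y
    let ?A = "mat m m (\<lambda>(i, k). (if i = k then 1 else 0) + t * M i k)"
    have "\<exists>x. \<forall>i<m. (\<Sum>k<m. ?A $$ (i, k) * x k) = y (f i)"
      using t unfolding ev by (intro linear_solve) auto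
    then obtain x where x: "\<And>i. i < m \<Longrightarrow> (\<Sum>k<m. ?A $$ (i, k) * x k) = y (f i)" by blast
    define a' where "a' = (\<lambda>j. \<Sum>k<m. x k * a k j)"
    define b' where "b' = (\<lambda>j. \<Sum>k<m. x k * b k j)"
    have "dform (\<lambda>i. \<alpha> i + t * \<alpha>1 i) (\<lambda>i. \<beta> i + t * \<beta>1 i) a' b' e = y e" if e: "e \<in> L" for e
    proof -
      obtain i where i: "i < m" "e = f i" using f e by (auto simp: bij_betw_def)
      have "(if e = f k then 1 else 0) = (if i = k then 1 else (0 :: rat))" if "k < m" for k
        using f i that by (auto simp: bij_betw_def inj_on_def)
      then have "dform \<alpha> \<beta> a' b' e + t * dform \<alpha>1 \<beta>1 a' b' e = (\<Sum>k<m. ?A $$ (i, k) * x k)"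
        unfolding a'_def b'_def dform_sum sum_distrib_left sum.distrib[symmetric]
        using i e by (intro sum.cong) (auto simp: ab M_def algebra_simps)
      then show ?thesis using x i by (simp add: dform_line)
    qed
    then show "\<exists>\<alpha>' \<beta>'. \<forall>e\<in>L. dform (\<lambda>i. \<alpha> i + t * \<alpha>1 i) (\<lambda>i. \<beta> i + t * \<beta>1 i) \<alpha>' \<beta>' e = y e"
      by blast
  qed
  ultimately show ?thesis
    by (rule_tac finite_subset[OF _ poly_roots_finite[of "det P"]]) auto
qed

lemma surj_general_position:
  assumes L: "finite L" and s: "surj_at \<alpha> \<beta> L" and d: "p \<noteq> q" "q \<noteq> r" "p \<noteq> r"
  shows "\<exists>\<alpha> \<beta>. surj_at \<alpha> \<beta> L \<and> (\<alpha> q - \<alpha> p) * (\<beta> r - \<beta> p) \<noteq> (\<alpha> r - \<alpha> p) * (\<beta> q - \<beta> p)"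
proof -
  \<comment> \<open>Points of the parabola (i, i^2): no three are collinear, so the collinearity
    determinant along this direction has nonzero leading coefficient in t.\<close>
  define a b where "a = (\<lambda>i :: nat. rat_of_nat i)" and "b = (\<lambda>i :: nat. rat_of_nat i ^ 2)"
  have "(a q - a p) * (b r - b p) - (a r - a p) * (b q - b p) = (a q - a p) * (a r - a p) * (a r - a q)"
    by (simp add: a_def b_def power2_eq_square algebra_simps)
  also have "\<dots> \<noteq> 0" using d by (simp add: a_def)
  finally have lead: "(a q - a p) * (b r - b p) - (a r - a p) * (b q - b p) \<noteq> 0" .
  let ?D = "\<lambda>\<alpha> \<beta>. (\<alpha> q - \<alpha> p) * (\<beta> r - \<beta> p) - (\<alpha> r - \<alpha> p) * (\<beta> q - \<beta> p)"
  let ?P = "[:?D \<alpha> \<beta>, (\<alpha> q - \<alpha> p) * (b r - b p) + (a q - a p) * (\<beta> r - \<beta> p)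
    - (\<alpha> r - \<alpha> p) * (b q - b p) - (a r - a p) * (\<beta> q - \<beta> p), ?D a b:]"
  have P: "poly ?P t = ?D (\<lambda>i. \<alpha> i + t * a i) (\<lambda>i. \<beta> i + t * b i)" for t
    by (simp add: algebra_simps)
  have "?P \<noteq> 0" using lead by simp
  then have "finite {t. poly ?P t = 0}" by (rule poly_roots_finite)
  then have "finite ({t. poly ?P t = 0} \<union> {t. \<not> surj_at (\<lambda>i. \<alpha> i + t * a i) (\<lambda>i. \<beta> i + t * b i) L})"
    using surj_perturb[OF L s] by simp
  then obtain t :: rat where "t \<notin> {t. poly ?P t = 0} \<union> {t. \<not> surj_at (\<lambda>i. \<alpha> i + t * a i) (\<lambda>i. \<beta> i + t * b i) L}"
    using ex_new_if_finite[OF infinite_UNIV_char_0] by blast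
  then have "surj_at (\<lambda>i. \<alpha> i + t * a i) (\<lambda>i. \<beta> i + t * b i) L" "poly ?P t \<noteq> 0" by blast+
  then show ?thesis unfolding P by (metis (mono_tags, lifting) right_minus_eq)
qed

section \<open>Henneberg moves and infinitesimal independence\<close>

lemma solve2:
  fixes a b c a' b' c' :: rat
  assumes "a * b' - a' * b \<noteq> 0"
  shows "\<exists>x y. a * x + b * y = c \<and> a' * x + b' * y = c'"
proof (intro exI conjI)
  let ?d = "a * b' - a' * b"
  have "a * ((c * b' - c' * b) / ?d) + b * ((a * c' - a' * c) / ?d) = c * ?d / ?d"
    by (simp add: algebra_simps flip: add_divide_distrib diff_divide_distrib)
  then show "a * ((c * b' - c' * b) / ?d) + b * ((a * c' - a' * c) / ?d) = c" using assms by simp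
  have "a' * ((c * b' - c' * b) / ?d) + b' * ((a * c' - a' * c) / ?d) = c' * ?d / ?d"
    by (simp add: algebra_simps flip: add_divide_distrib diff_divide_distrib)
  then show "a' * ((c * b' - c' * b) / ?d) + b' * ((a * c' - a' * c) / ?d) = c'" using assms by simp
qed

lemma dform_update:
  assumes "fst e \<noteq> v" "snd e \<noteq> v"
  shows "dform (\<alpha>(v := x)) (\<beta>(v := y)) (\<alpha>'(v := x')) (\<beta>'(v := y')) e = dform \<alpha> \<beta> \<alpha>' \<beta>' e"
  using assms by (simp add: dform_def)

text \<open>The vertex \<open>v\<close> is moved to a point not collinear with \<open>p\<close> and
  \<open>q\<close>; the at most two edges at \<open>v\<close> are then met by solving for its
  velocity. Only the position of the auxiliary label \<open>r\<close> is borrowed, and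
  \<open>r\<close> may be \<open>v\<close> itself.\<close>

lemma surj_extend0:
  assumes L: "finite L" and pq: "p \<noteq> q" "v \<noteq> p" "v \<noteq> q"
    and star: "{e\<in>L. fst e = v \<or> snd e = v} \<subseteq> {edge_of v p, edge_of v q}"
    and s: "surj_at \<alpha> \<beta> {e\<in>L. fst e \<noteq> v \<and> snd e \<noteq> v}"
  shows "\<exists>\<alpha> \<beta>. surj_at \<alpha> \<beta> L"
proof -
  define r where "r = Suc (max p q)"
  have "q \<noteq> r" "p \<noteq> r" by (auto simp: r_def)
  then obtain \<alpha> \<beta> where s': "surj_at \<alpha> \<beta> {e\<in>L. fst e \<noteq> v \<and> snd e \<noteq> v}"
    and gp: "(\<alpha> q - \<alpha> p) * (\<beta> r - \<beta> p) \<noteq> (\<alpha> r - \<alpha> p) * (\<beta> q - \<beta> p)"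
    using surj_general_position[OF _ s, of p q r] L pq by auto
  have "surj_at (\<alpha>(v := \<alpha> r)) (\<beta>(v := \<beta> r)) L"
    unfolding surj_at_def
  proof
    fix y
    obtain a b where ab: "\<And>e. e \<in> L \<Longrightarrow> fst e \<noteq> v \<Longrightarrow> snd e \<noteq> v \<Longrightarrow> dform \<alpha> \<beta> a b e = y e"
      using s' unfolding surj_at_def by blast
    have "(\<beta> r - \<beta> p) * (\<alpha> r - \<alpha> q) - (\<beta> r - \<beta> q) * (\<alpha> r - \<alpha> p) \<noteq> 0"
      using gp by (simp add: algebra_simps)
    from solve2[OF this] obtain xa xb where
      x: "(\<beta> r - \<beta> p) * xa + (\<alpha> r - \<alpha> p) * xb = y (edge_of v p) + (\<beta> r - \<beta> p) * a p + (\<alpha> r - \<alpha> p) * b p"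
         "(\<beta> r - \<beta> q) * xa + (\<alpha> r - \<alpha> q) * xb = y (edge_of v q) + (\<beta> r - \<beta> q) * a q + (\<alpha> r - \<alpha> q) * b q"
      by blast
    have "dform (\<alpha>(v := \<alpha> r)) (\<beta>(v := \<beta> r)) (a(v := xa)) (b(v := xb)) e = y e" if e: "e \<in> L" for e
    proof (cases "fst e = v \<or> snd e = v")
      case True
      then have "e = edge_of v p \<or> e = edge_of v q" using star e by blast
      then show ?thesis
        using x pq by (elim disjE) (simp_all add: dform_edge_of algebra_simps)
    next
      case False
      then show ?thesis using ab e by (simp add: dform_update)
    qed
    then show "\<exists>\<alpha>' \<beta>'. \<forall>e\<in>L. dform (\<alpha>(v := \<alpha> r)) (\<beta>(v := \<beta> r)) \<alpha>' \<beta>' e = y e" by blast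
  qed
  then show ?thesis by blast
qed

text \<open>The new vertex is placed at the midpoint of \<open>p\<close> and \<open>q\<close>; there the two edges to \<open>p\<close> and \<open>q\<close>
  prescribe one coordinate of its velocity and, up to a factor, the value on the removed edge.\<close>

lemma surj_extend1:
  assumes L: "finite L" and d: "p \<noteq> q" "q \<noteq> r" "p \<noteq> r" and v: "v \<noteq> p" "v \<noteq> q" "v \<noteq> r"
    and star: "{e\<in>L. fst e = v \<or> snd e = v} = {edge_of v p, edge_of v q, edge_of v r}"
    and new: "edge_of p q \<notin> {e\<in>L. fst e \<noteq> v \<and> snd e \<noteq> v}"
    and s: "surj_at \<alpha> \<beta> (insert (edge_of p q) {e\<in>L. fst e \<noteq> v \<and> snd e \<noteq> v})"
  shows "\<exists>\<alpha> \<beta>. surj_at \<alpha> \<beta> L"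
proof -
  let ?L0 = "{e\<in>L. fst e \<noteq> v \<and> snd e \<noteq> v}"
  obtain \<alpha> \<beta> where s': "surj_at \<alpha> \<beta> (insert (edge_of p q) ?L0)"
    and gp: "(\<alpha> q - \<alpha> p) * (\<beta> r - \<beta> p) \<noteq> (\<alpha> r - \<alpha> p) * (\<beta> q - \<beta> p)"
    using surj_general_position[OF _ s d] L by auto
  define d1 d2 where "d1 = (\<alpha> p - \<alpha> q) / 2" and "d2 = (\<beta> p - \<beta> q) / 2"
  define av bv where "av = (\<alpha> p + \<alpha> q) / 2" and "bv = (\<beta> p + \<beta> q) / 2"
  have av: "av - \<alpha> p = - d1" "av - \<alpha> q = d1" "bv - \<beta> p = - d2" "bv - \<beta> q = d2"
    by (simp_all add: av_def bv_def d1_def d2_def field_simps)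
  have pq: "\<alpha> p - \<alpha> q = 2 * d1" "\<beta> p - \<beta> q = 2 * d2" by (simp_all add: d1_def d2_def)
  have "surj_at (\<alpha>(v := av)) (\<beta>(v := bv)) L"
    unfolding surj_at_def
  proof
    fix y
    \<comment> \<open>With \<open>v\<close> at the midpoint, its velocity cancels from the sum of
      the rates of the edges to \<open>p\<close> and \<open>q\<close>, which is half the rate of
      \<open>p q\<close>. This dictates the value, factor 2 included, on the removed edge.\<close>
    have "\<exists>a b. \<forall>e\<in>insert (edge_of p q) ?L0. dform \<alpha> \<beta> a b e =
        (y(edge_of p q := 2 * (y (edge_of v p) + y (edge_of v q)))) e"
      using s' unfolding surj_at_def by blast
    then obtain a b where ab: "\<forall>e\<in>insert (edge_of p q) ?L0. dform \<alpha> \<beta> a b e =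
        (y(edge_of p q := 2 * (y (edge_of v p) + y (edge_of v q)))) e" by blast
    have ab0: "dform \<alpha> \<beta> a b e = y e" if "e \<in> L" "fst e \<noteq> v" "snd e \<noteq> v" for e
      using ab new that by (metis (mono_tags, lifting) fun_upd_other insert_iff mem_Collect_eq)
    have "2 * d1 * (b p - b q) + 2 * d2 * (a p - a q) = 2 * (y (edge_of v p) + y (edge_of v q))"
      using ab by (simp add: dform_edge_of pq)
    then have abpq: "d1 * (b p - b q) + d2 * (a p - a q) = y (edge_of v p) + y (edge_of v q)"
      by (simp add: algebra_simps)
    \<comment> \<open>The determinant of the system for the edges to \<open>q\<close> and
      \<open>r\<close> is, up to a factor, the collinearity determinant of \<open>p\<close>,
      \<open>q\<close>, \<open>r\<close>.\<close>
    have "2 * ((\<beta> p - \<beta> q) / 2 * (av - \<alpha> r) - (bv - \<beta> r) * ((\<alpha> p - \<alpha> q) / 2)) =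
        (\<alpha> q - \<alpha> p) * (\<beta> r - \<beta> p) * (- 1) + (\<alpha> r - \<alpha> p) * (\<beta> q - \<beta> p)"
      by (simp add: av_def bv_def field_simps)
    then have "d2 * (av - \<alpha> r) - (bv - \<beta> r) * d1 \<noteq> 0"
      using gp unfolding d1_def d2_def by auto
    from solve2[OF this] obtain xa xb where
      x: "d2 * xa + d1 * xb = y (edge_of v q) + d2 * a q + d1 * b q"
         "(bv - \<beta> r) * xa + (av - \<alpha> r) * xb = y (edge_of v r) + (bv - \<beta> r) * a r + (av - \<alpha> r) * b r"
      by blast
    have "dform (\<alpha>(v := av)) (\<beta>(v := bv)) (a(v := xa)) (b(v := xb)) e = y e" if e: "e \<in> L" for e
    proof (cases "fst e = v \<or> snd e = v")
      case True
      then consider "e = edge_of v p" | "e = edge_of v q" | "e = edge_of v r" using star e by blast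
      then show ?thesis
      proof cases
        case 1
        have "dform (\<alpha>(v := av)) (\<beta>(v := bv)) (a(v := xa)) (b(v := xb)) e = - d1 * (xb - b p) + - d2 * (xa - a p)"
          using v by (simp add: 1 dform_edge_of av)
        also have "\<dots> = - (d2 * xa + d1 * xb) + d1 * b p + d2 * a p"
          by (simp add: algebra_simps)
        also have "\<dots> = d1 * (b p - b q) + d2 * (a p - a q) - y (edge_of v q)"
          unfolding x(1) by (simp add: algebra_simps)
        also have "\<dots> = y e" unfolding abpq by (simp add: 1)
        finally show ?thesis .
      next
        case 2
        then show ?thesis using x(1) v by (simp add: dform_edge_of av algebra_simps)
      next
        case 3
        then show ?thesis using x(2) v by (simp add: dform_edge_of algebra_simps)
      qed
    next
      case False
      then show ?thesis using ab0 e by (simp add: dform_update)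
    qed
    then show "\<exists>\<alpha>' \<beta>'. \<forall>e\<in>L. dform (\<alpha>(v := av)) (\<beta>(v := bv)) \<alpha>' \<beta>' e = y e" by blast
  qed
  then show ?thesis by blast
qed

theorem sparse_imp_surj:
  assumes "sparse L"
  shows "\<exists>\<alpha> \<beta>. surj_at \<alpha> \<beta> L"
  using assms
proof (induction "card (verts L)" arbitrary: L rule: less_induct)
  case less
  show ?case
  proof (cases "L = {}")
    case True
    then show ?thesis by (simp add: surj_at_def)
  next
    case False
    have fin: "finite L" "finite (verts L)" using less.prems by (auto simp: sparse_def verts_def)
    obtain v where v: "v \<in> verts L" "card {e\<in>L. fst e = v \<or> snd e = v} \<le> 3"
      using ex_low_degree[OF less.prems False] by blast
    define S where "S = {e\<in>L. fst e = v \<or> snd e = v}"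
    define L0 where "L0 = {e\<in>L. fst e \<noteq> v \<and> snd e \<noteq> v}"
    define N where "N = (\<lambda>e. if fst e = v then snd e else fst e) ` S"
    have Sfin: "finite S" using fin by (simp add: S_def)
    have SN: "S = edge_of v ` N"
    proof -
      have "edge_of v (if fst e = v then snd e else fst e) = e" if "e \<in> S" for e
        using that sparse_less[OF less.prems, of e] by (cases e) (auto simp: S_def edge_of_def)
      then have "(\<lambda>e. edge_of v (if fst e = v then snd e else fst e)) ` S = id ` S"
        by (intro image_cong) simp_all
      then show ?thesis by (simp only: N_def image_image image_id id_apply)
    qed
    have vN: "u \<noteq> v" if u: "u \<in> N" for u
    proof -
      obtain e where "e \<in> S" "u = (if fst e = v then snd e else fst e)"
        using u unfolding N_def by blast
      then have e: "e \<in> L" "fst e = v \<or> snd e = v" "u = (if fst e = v then snd e else fst e)"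
        by (simp_all add: S_def)
      then show ?thesis using sparse_less[OF less.prems e(1)] by auto
    qed
    have "inj_on (edge_of v) N" by (auto simp: inj_on_def edge_of_inject)
    then have "card S = card N" using SN by (simp add: card_image)
    then have cN: "card N \<le> 3" using v(2) by (simp add: S_def)
    have Nfin: "finite N" using Sfin by (simp add: N_def)
    obtain e where "e \<in> L" "fst e = v \<or> snd e = v" using v(1) unfolding verts_def by blast
    then have "e \<in> S" by (simp add: S_def)
    then have "N \<noteq> {}" unfolding N_def by blast
    have L0: "sparse L0" using sparse_subset[OF less.prems] by (auto simp: L0_def)
    have small: "card W < card (verts L)" if "W \<subseteq> verts L - {v}" for W
      using that fin v(1) by (metis card_Diff1_less card_mono finite_Diff order.strict_trans1)
    have "verts L0 \<subseteq> verts L - {v}" by (auto simp: verts_def L0_def)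
    then obtain \<alpha> \<beta> where s0: "surj_at \<alpha> \<beta> L0" using less.hyps[OF small] L0 by blast
    have two: ?thesis if "N \<subseteq> {p, q}" "p \<noteq> q" "v \<noteq> p" "v \<noteq> q" for p q
    proof (rule surj_extend0[OF fin(1) that(2-4)])
      have "S \<subseteq> {edge_of v p, edge_of v q}" unfolding SN using that(1) by auto
      then show "{e\<in>L. fst e = v \<or> snd e = v} \<subseteq> {edge_of v p, edge_of v q}" by (simp only: S_def)
      show "surj_at \<alpha> \<beta> {e\<in>L. fst e \<noteq> v \<and> snd e \<noteq> v}" using s0 by (simp only: L0_def)
    qed
    have "card N \<noteq> 0" using \<open>N \<noteq> {}\<close> Nfin by simp
    then consider "card N = 1" | "card N = 2" | "card N = 3" using cN by linarith
    then show ?thesis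
    proof cases
      case 1
      then obtain p where "N = {p}" by (rule card_1_singletonE)
      \<comment> \<open>For degree 1 the second neighbour is a dummy, chosen different from
        \<open>p\<close> and \<open>v\<close>.\<close>
      then show ?thesis using vN by (intro two[of p "Suc (max p v)"]) auto
    next
      case 2
      then obtain p q where "N = {p, q}" "p \<noteq> q" by (auto simp: card_2_iff)
      then show ?thesis using vN by (intro two[of p q]) auto
    next
      case 3
      then obtain p q r where N: "N = {p, q, r}" and d: "p \<noteq> q" "q \<noteq> r" "p \<noteq> r"
        by (auto simp: card_3_iff)
      have "{e\<in>L. fst e = v \<or> snd e = v} = {edge_of v p, edge_of v q, edge_of v r}"
        using SN N by (simp add: S_def)
      from ex_inverse_extension[OF less.prems d _ _ _ this] obtain a b c where
        abc: "{a, b, c} = {p, q, r}" "a \<noteq> b" "b \<noteq> c" "a \<noteq> c" "edge_of a b \<notin> L0" "sparse (insert (edge_of a b) L0)"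
        using vN N by (auto simp: L0_def)
      then have N': "N = {a, b, c}" using N by simp
      have abv: "v \<noteq> a" "v \<noteq> b" "v \<noteq> c" using N' vN by auto
      have "N \<subseteq> verts L" by (auto simp: N_def S_def verts_def)
      then have "a \<in> verts L" "b \<in> verts L" using N' by auto
      then have "verts (insert (edge_of a b) L0) \<subseteq> verts L - {v}"
        using \<open>verts L0 \<subseteq> verts L - {v}\<close> abv by (auto simp: verts_def edge_of_def min_def max_def)
      then obtain \<alpha> \<beta> where "surj_at \<alpha> \<beta> (insert (edge_of a b) L0)"
        using less.hyps[OF small] abc(6) by blast
      moreover have "{e\<in>L. fst e = v \<or> snd e = v} = {edge_of v a, edge_of v b, edge_of v c}"
        using SN N' by (simp add: S_def)
      ultimately show ?thesis
        using surj_extend1[OF fin(1) abc(2-4) abv] abc(5) by (simp add: L0_def)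
    qed
  qed
qed

section \<open>Circuits and their polynomials\<close>

text \<open>The generic length map is expanded along a curve through a configuration at which it is
  infinitesimally independent, with velocity chosen so that the length of \<open>e\<close> grows at rate \<open>Var e\<close>.
  The lowest homogeneous part of a relation, recentred at the base point, would then vanish.\<close>

theorem sparse_independent:
  assumes L: "sparse L" and g: "g \<in> CM n" "g \<in> poly_in L"
  shows "g = 0"
proof -
  obtain \<alpha> \<beta> where s: "surj_at \<alpha> \<beta> L" using sparse_imp_surj[OF L] by blast
  have "\<forall>k. \<exists>a b. \<forall>e\<in>L. dform \<alpha> \<beta> a b e = (if e = k then 1 else 0)"
    using s[unfolded surj_at_def, THEN spec, of "\<lambda>e. if e = _ then 1 else 0"] by simp
  then obtain wa wb where w: "\<And>k e. e \<in> L \<Longrightarrow> dform \<alpha> \<beta> (wa k) (wb k) e = (if e = k then 1 else 0)"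
    by metis
  define a where "a = (\<lambda>i. \<Sum>k\<in>L. Var k * Const (wa k i))"
  define b where "b = (\<lambda>i. \<Sum>k\<in>L. Var k * Const (wb k i))"
  define F where "F = (\<lambda>e. (\<alpha> (fst e) - \<alpha> (snd e)) * (\<beta> (fst e) - \<beta> (snd e)))"
  define q where "q = (\<lambda>e. (a (fst e) - a (snd e)) * (b (fst e) - b (snd e)))"
  let ?c = "\<lambda>x. [:Const x:] :: mpoly poly"
  have dC: "dform (\<lambda>i. Const (\<alpha> i)) (\<lambda>i. Const (\<beta> i)) (\<lambda>i. Const (wa k i)) (\<lambda>i. Const (wb k i)) e
      = Const (dform \<alpha> \<beta> (wa k) (wb k) e)" for k e
    by (simp add: dform_def Const_hom.hom_add Const_hom.hom_mult Const_hom.hom_minus)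
  have vel: "dform (\<lambda>i. Const (\<alpha> i)) (\<lambda>i. Const (\<beta> i)) a b e = Var e" if "e \<in> L" for e
  proof -
    have "dform (\<lambda>i. Const (\<alpha> i)) (\<lambda>i. Const (\<beta> i)) a b e = (\<Sum>k\<in>L. if k = e then Var k else 0)"
      unfolding a_def b_def dform_sum dC using that by (intro sum.cong) (auto simp: w)
    then show ?thesis using that sparse_finite[OF L] by simp
  qed
  \<comment> \<open>Along the curve the length of \<open>e\<close> is F e + t Var e + t^2 q e.
    Shifting the base lengths to the origin turns \<open>g\<close> into \<open>h\<close>, and
    \<open>\<chi>\<close> evaluates \<open>h\<close> on the remaining terms.\<close>
  define \<chi> where "\<chi> = psubst ?c (\<lambda>e. [:0, Var e, q e:])"
  define h where "h = psubst Const (\<lambda>e. Var e + Const (F e)) g"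
  have len: "([:Const (\<alpha> i), a i:] - [:Const (\<alpha> j), a j:]) * ([:Const (\<beta> i), b i:] - [:Const (\<beta> j), b j:])
      = [:Const (F (i, j)), Var (i, j), q (i, j):]" if "(i, j) \<in> L" for i j
  proof -
    have "Const (F (i, j)) = (Const (\<alpha> i) - Const (\<alpha> j)) * (Const (\<beta> i) - Const (\<beta> j))"
      by (simp add: F_def Const_hom.hom_mult Const_hom.hom_minus)
    moreover have "Var (i, j) = (Const (\<alpha> i) - Const (\<alpha> j)) * (b i - b j) + (Const (\<beta> i) - Const (\<beta> j)) * (a i - a j)"
      using vel[OF that] by (simp add: dform_def)
    ultimately show ?thesis by (simp add: q_def algebra_simps)
  qed
  have "\<chi> (psubst Const (\<lambda>e. Var e + Const (F e)) p) =
      pConst_alg.cfg (\<lambda>i. [:Const (\<alpha> i), a i:]) (\<lambda>i. [:Const (\<beta> i), b i:]) p" if "p \<in> poly_in L" for p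
    using that
  proof (induction p rule: poly_in_induct)
    case (Var e p)
    then show ?case using len[of "fst e" "snd e"]
      by (simp add: \<chi>_def pConst_alg.cfg_def Const_alg.psubst_mult pConst_alg.psubst_mult pConst_alg.psubst_add case_prod_beta)
  qed (simp_all add: \<chi>_def pConst_alg.cfg_def Const_alg.psubst_add pConst_alg.psubst_add)
  then have zero: "\<chi> h = 0" using pConst_alg.CM_vanishes[OF g(1)] g(2) by (simp add: h_def)
  \<comment> \<open>One factor t is taken out for each variable, so the coefficient of the least
    power of t is the lowest homogeneous part of \<open>h\<close> itself.\<close>
  have \<chi>: "\<chi> h = (\<Sum>m\<in>ks h. monom 1 (mdeg m) * ([:Const (lk h m):] * (\<Prod>e\<in>ks m. [:Var e, q e:] ^ lk m e)))"
  proof -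
    have "(\<Prod>e\<in>A. [:0, Var e, q e:] ^ k e) = monom 1 (sum k A) * (\<Prod>e\<in>A. [:Var e, q e:] ^ k e)"
      if "finite A" for A :: "edge set" and k
      using that
    proof (induction A rule: finite_induct)
      case (insert e A)
      have "[:0, Var e, q e:] = monom 1 1 * [:Var e, q e:]" by (simp add: monom_altdef)
      then have "[:0, Var e, q e:] ^ k e = monom 1 (k e) * [:Var e, q e:] ^ k e"
        by (simp only: power_mult_distrib monom_power power_one mult_1)
      moreover have "monom (1 :: mpoly) (k e + sum k A) = monom 1 (k e) * monom 1 (sum k A)"
        by (simp add: mult_monom)
      ultimately show ?case
        unfolding prod.insert[OF insert.hyps] sum.insert[OF insert.hyps] insert.IH by (simp only: mult_ac)
    qed simp
    then show ?thesis unfolding \<chi>_def psubst_def mdeg_def by (intro sum.cong) (simp_all only: finite_keys mult.left_commute)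
  qed
  have "h = 0"
  proof (rule ccontr)
    assume "h \<noteq> 0"
    then have "ks h \<noteq> {}" using mpoly_decompose[of h] by auto
    then obtain m where m: "m \<in> ks h" and least: "\<And>m'. m' \<in> ks h \<Longrightarrow> mdeg m \<le> mdeg m'"
      using ex_has_least_nat[of "\<lambda>m. m \<in> ks h" _ mdeg] by blast
    have "(\<Prod>e\<in>A. coeff ([:Var e, q e:] ^ k e) 0) = (\<Prod>e\<in>A. Var e ^ k e)" for A and k :: "edge \<Rightarrow> nat"
      by (simp add: coeff_0_power)
    moreover have "coeff (\<Prod>e\<in>A. P e) 0 = (\<Prod>e\<in>A. coeff (P e) 0)" for A and P :: "edge \<Rightarrow> mpoly poly"
      by (induction A rule: infinite_finite_induct) (simp_all add: coeff_mult_0)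
    ultimately have c0: "coeff ([:Const x:] * (\<Prod>e\<in>ks m'. [:Var e, q e:] ^ lk m' e)) 0 = sg m' x" for m' x
      using Const_alg.psubst_single[of Var m' x] by (simp add: coeff_mult_0)
    have "0 = coeff (\<chi> h) (mdeg m)" by (simp add: zero)
    also have "\<dots> = (\<Sum>m'\<in>ks h. if mdeg m' = mdeg m then sg m' (lk h m') else 0)"
      unfolding \<chi> coeff_sum
    proof (rule sum.cong[OF refl])
      fix m' assume "m' \<in> ks h"
      then have "mdeg m \<le> mdeg m'" by (rule least)
      then show "coeff (monom 1 (mdeg m') * ([:Const (lk h m'):] * (\<Prod>e\<in>ks m'. [:Var e, q e:] ^ lk m' e))) (mdeg m)
          = (if mdeg m' = mdeg m then sg m' (lk h m') else 0)"
        using c0[of "lk h m'" m'] by (auto simp only: coeff_monom_mult mult_1 diff_self_eq_0 le_antisym order_refl if_True if_False split: if_splits)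
    qed
    finally have "0 = lk (\<Sum>m'\<in>ks h. if mdeg m' = mdeg m then sg m' (lk h m') else 0) m" by simp
    also have "\<dots> = (\<Sum>m'\<in>ks h. if m' = m then lk h m' else 0)"
      unfolding lookup_sum by (intro sum.cong) (auto simp: lookup_single when_def)
    also have "\<dots> = lk h m" using m by simp
    finally show False using m by (simp add: in_keys_iff)
  qed
  moreover have "psubst Const (\<lambda>e. Var e - Const (F e)) (psubst Const (\<lambda>e. Var e + Const (F e)) p) = p" for p
    by (induction p rule: mpoly_induct) (simp_all add: Const_alg.psubst_add Const_alg.psubst_mult)
  from this[of g] have "psubst Const (\<lambda>e. Var e - Const (F e)) h = g" by (simp only: h_def)
  ultimately show ?thesis by simp
qed

text \<open>A circuit exceeds Laman's count by one edge, and only on its full vertex set. Vertices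
  of \<open>U\<close> outside the circuit span nothing, hence the passage to
  \<open>W\<close>.\<close>

lemma circuit_delete_sparse:
  assumes C: "rigidity_circuit C" "C \<subseteq> Xn n" and x: "x \<in> C"
  shows "sparse (C - {x})"
  unfolding sparse_def
proof (intro conjI allI impI ballI)
  have fin: "finite C" and cC: "int (card C) = 2 * int (card (verts C)) - 2"
    and proper: "\<And>W. W \<subset> verts C \<Longrightarrow> 2 \<le> card W \<Longrightarrow> int (card (span_edges C W)) \<le> 2 * int (card W) - 3"
    using C(1) by (auto simp: rigidity_circuit_def)
  show "finite (C - {x})" using fin by simp
  show less: "fst e < snd e" if "e \<in> C - {x}" for e using that C(2) by (auto simp: Xn_def)
  fix U :: "nat set" assume U: "finite U \<and> 2 \<le> card U"
  define W where "W = U \<inter> verts C"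
  have span: "span_edges (C - {x}) U = span_edges (C - {x}) W"
    by (auto simp: span_edges_def W_def verts_def)
  have WU: "card W \<le> card U" using U by (auto simp: W_def intro: card_mono)
  have fW: "finite W" using U by (simp add: W_def)
  have "W \<subseteq> verts C" by (simp add: W_def)
  consider "W = verts C" | "W \<subset> verts C" "2 \<le> card W" | "card W \<le> Suc 0"
    using \<open>W \<subseteq> verts C\<close> by (cases "W = verts C"; cases "2 \<le> card W") (auto simp: psubset_eq)
  then show "card (span_edges (C - {x}) U) + 3 \<le> 2 * card U"
  proof cases
    case 1
    have "card (span_edges (C - {x}) W) \<le> card (C - {x})"
      using fin by (intro card_mono) (auto simp: span_edges_def)
    also have "\<dots> = card C - 1" using x fin by simp
    finally show ?thesis using cC WU 1 span x fin card_gt_0_iff[of C] by auto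
  next
    case 2
    have "card (span_edges (C - {x}) W) \<le> card (span_edges C W)"
      using fin by (intro card_mono) (auto simp: span_edges_def)
    then show ?thesis using proper[OF 2] WU span by simp
  next
    case 3
    then have "fst e = snd e" if "e \<in> span_edges (C - {x}) W" for e
      using that fW card_le_Suc0_iff_eq[OF fW] by (auto simp: span_edges_def)
    then have "span_edges (C - {x}) W = {}" using less by (force simp: span_edges_def)
    then show ?thesis using span U by simp
  qed
qed

lemma circuit_proper_subset_independent:
  assumes "rigidity_circuit C" "C \<subseteq> Xn n" "g \<in> CM n" "vars g \<subset> C"
  shows "g = 0"
proof -
  obtain x where x: "x \<in> C" "x \<notin> vars g" using assms(4) by blast
  then have "g \<in> poly_in (C - {x})" using assms(4) by (auto simp: poly_in_def)
  then show ?thesis using sparse_independent[OF circuit_delete_sparse[OF assms(1,2) x(1)]] assms(3) by blast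
qed

lemma circuit_nonempty: "rigidity_circuit C \<Longrightarrow> C \<noteq> {}"
  by (auto simp: rigidity_circuit_def verts_def)

text \<open>Membership is checked in the kernel, where cofactors with foreign variables do no harm;
  the support of the resultant is bounded separately.\<close>

lemma Res_in_CM:
  assumes "p \<in> CM n" "q \<in> CM n" "e \<in> vars p"
  shows "Res p q e \<in> CM n"
proof -
  obtain a b where "Res p q e = a * p + b * q" using Res_in_ideal[OF assms(3)] by blast
  then have "gencfg (Res p q e) = 0"
    using assms by (simp add: CM_eq_kernel gencfg.hom_add gencfg.hom_mult)
  moreover have "Res p q e \<in> poly_in (Xn n)"
    using Res_poly_in[of p "Xn n" q e] assms by (auto simp: CM_eq_kernel intro: poly_in_mono)
  ultimately show ?thesis by (simp add: CM_eq_kernel)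
qed

lemma circuit_poly_dvd:
  assumes C: "rigidity_circuit C" "C \<subseteq> Xn n" and p: "circuit_poly n C p" and f: "f \<in> CM n" "f \<in> poly_in C"
  shows "p dvd f"
proof (rule ccontr)
  assume nd: "\<not> p dvd f"
  have p': "p \<in> CM n" "irreducible p" "vars p = C" using p by (auto simp: circuit_poly_def)
  obtain x where x: "x \<in> C" using circuit_nonempty[OF C(1)] by blast
  have "Res p f x \<noteq> 0" using Res_nonzero[OF p'(2) _ nd] x p' by simp
  moreover have "Res p f x \<in> CM n" using Res_in_CM p' f x by simp
  moreover have "vars (Res p f x) \<subset> C"
    using Res_poly_in[of p C f x] p' f x by (auto simp: poly_in_def)
  ultimately show False using circuit_proper_subset_independent[OF C] by blast
qed

text \<open>The support cannot shrink to a proper subset of the circuit, because those are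
  independent.\<close>

lemma irreducible_circuit_poly:
  assumes C: "rigidity_circuit C" "C \<subseteq> Xn n" and f: "irreducible f" "f \<in> CM n" "f \<in> poly_in C"
  shows "circuit_poly n C f"
  using circuit_proper_subset_independent[OF C f(2)] f by (auto simp: circuit_poly_def poly_in_def)

lemma circuit_poly_unique:
  assumes C: "rigidity_circuit C" "C \<subseteq> Xn n" and p: "circuit_poly n C p" and q: "circuit_poly n C q"
  shows "\<exists>c. c \<noteq> 0 \<and> q = Const c * p"
proof (rule irreducible_assoc)
  show "p dvd q" using q by (intro circuit_poly_dvd[OF C p]) (auto simp: circuit_poly_def poly_in_def)
qed (use p q in \<open>auto simp: circuit_poly_def\<close>)

text \<open>The ideal is prime and contains no unit, so splitting off factors must end at an
  irreducible one inside it.\<close>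

lemma ex_irreducible_factor_in_CM:
  assumes "f \<in> CM n" "f \<noteq> 0"
  shows "\<exists>g. irreducible g \<and> g dvd f \<and> g \<in> CM n"
  using assms(2,1)
proof (induction f rule: factor_induct)
  case (unit u)
  then obtain c where "c \<noteq> 0" "u = Const c" using unit_mpoly by blast
  then show ?case using unit by (auto simp: CM_eq_kernel)
next
  case (mult f q)
  have "f \<noteq> 0" using mult(1) by auto
  then have "f \<in> poly_in (Xn n)" "q \<in> poly_in (Xn n)"
    using CM_poly_in[OF mult.prems] mult(2) vars_mult_eq[of f q] by (auto simp: poly_in_def)
  then consider "f \<in> CM n" | "q \<in> CM n" using CM_prime[OF mult.prems] by blast
  then show ?case
  proof cases
    case 1
    then show ?thesis using mult(1) by auto
  next
    case 2
    then show ?thesis using mult.IH by (auto intro: dvd_mult)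
  qed
qed

text \<open>If \<open>pA\<close> divided \<open>pB\<close>, the two irreducible polynomials would be
  associates and have equal supports, against \<open>A \<noteq> B\<close>.\<close>

lemma CR_resultant:
  assumes A: "circuit_poly n A pA" and B: "circuit_poly n B pB" and "A \<noteq> B" and e: "e \<in> A \<inter> B"
  shows "Res pA pB e \<noteq> 0" and "Res pA pB e \<in> CM n" and "Res pA pB e \<in> poly_in (CR A B e)"
proof -
  have p: "pA \<in> CM n" "irreducible pA" "vars pA = A" "pB \<in> CM n" "irreducible pB" "vars pB = B"
    using A B by (auto simp: circuit_poly_def)
  have "\<not> pA dvd pB"
    using irreducible_assoc[OF p(2,5)] vars_Const_mult p assms(3) by metis
  then show "Res pA pB e \<noteq> 0" using Res_nonzero[OF p(2)] p e by simp
  show "Res pA pB e \<in> CM n" using Res_in_CM p e by simp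
  show "Res pA pB e \<in> poly_in (CR A B e)"
    unfolding CR_def by (rule Res_poly_in) (auto simp: poly_in_def p)
qed

section \<open>Complete graphs on four vertices\<close>

lemma card_K4_on: "finite S \<Longrightarrow> 2 * card (K4_on S) = card S * (card S - 1)"
proof (induction S rule: finite_linorder_max_induct)
  case (insert b A)
  have "K4_on (insert b A) = K4_on A \<union> (\<lambda>a. (a, b)) ` A" using insert by (force simp: K4_on_def)
  moreover have "finite (K4_on A)"
    by (rule finite_subset[of _ "A \<times> A"]) (use insert in \<open>auto simp: K4_on_def\<close>)
  moreover have "K4_on A \<inter> (\<lambda>a. (a, b)) ` A = {}" using insert by (auto simp: K4_on_def)
  ultimately have "card (K4_on (insert b A)) = card (K4_on A) + card A"
    using insert by (simp add: card_Un_disjoint card_image inj_on_def)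
  moreover have "b \<notin> A" using insert by auto
  ultimately show ?case using insert by (cases "card A") auto
qed (simp add: K4_on_def)

lemma K4_subset_Xn: "S \<subseteq> {1..n} \<Longrightarrow> K4_on S \<subseteq> Xn n"
  by (auto simp: K4_on_def Xn_def)

lemma K4_rigidity_circuit:
  assumes "card S = 4"
  shows "rigidity_circuit (K4_on S)"
proof -
  have fin: "finite S" using assms by (intro card_ge_0_finite) simp
  have v: "verts (K4_on S) = S"
  proof
    show "S \<subseteq> verts (K4_on S)"
    proof
      fix x assume x: "x \<in> S"
      have "\<not> S \<subseteq> {x}" using assms card_mono[of "{x}" S] by auto
      then obtain y where y: "y \<in> S" "y \<noteq> x" by blast
      then have "(min x y, max x y) \<in> K4_on S" using x by (auto simp: K4_on_def min_def max_def)
      then have "fst (min x y, max x y) \<in> verts (K4_on S)" "snd (min x y, max x y) \<in> verts (K4_on S)"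
        unfolding verts_def by blast+
      then show "x \<in> verts (K4_on S)" by (cases "x \<le> y") simp_all
    qed
  qed (auto simp: verts_def K4_on_def)
  have "finite (K4_on S)" by (rule finite_subset[of _ "S \<times> S"]) (use fin in \<open>auto simp: K4_on_def\<close>)
  moreover have "card (K4_on S) = 6" using card_K4_on[OF fin] assms by simp
  moreover have "int (card (span_edges (K4_on S) W)) \<le> 2 * int (card W) - 3" if W: "W \<subset> S" "2 \<le> card W" for W
  proof -
    have fW: "finite W" using W fin finite_subset by blast
    have "span_edges (K4_on S) W = K4_on W" using W by (auto simp: span_edges_def K4_on_def)
    moreover have "card W < 4" using psubset_card_mono[OF fin W(1)] assms by simp
    then have "card W = 2 \<or> card W = 3" using W by linarith
    ultimately show ?thesis using card_K4_on[OF fW] by auto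
  qed
  ultimately show ?thesis by (auto simp: rigidity_circuit_def v assms)
qed

text \<open>The principal minor on the border index 0 and the four vertices is nonzero: with all
  lengths set to 1 it becomes the all-ones matrix minus the identity, of determinant 4.\<close>

lemma K4_ex_in_CM:
  assumes S: "S \<subseteq> {1..n}" "card S = 4"
  shows "\<exists>f. f \<noteq> 0 \<and> f \<in> CM n \<and> f \<in> poly_in (K4_on S)"
proof -
  have fin: "finite S" using S by (intro card_ge_0_finite) simp
  define xs where "xs = 0 # sorted_list_of_set S"
  define r where "r = (\<lambda>i. xs ! i)"
  have len: "length xs = 5" using S by (simp add: xs_def)
  have "sorted_wrt (<) xs" using S fin by (auto simp: xs_def)
  then have sm: "strict_mono_on {..<5} r"
    using len by (intro strict_mono_onI) (simp add: r_def sorted_wrt_nth_less)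
  have mem: "r i \<in> insert 0 S" if "i < 5" for i
  proof -
    have "r i \<in> set xs" using that len by (simp add: r_def)
    then show ?thesis using fin by (simp add: xs_def)
  qed
  have le: "r i \<le> n" if "i < 5" for i using mem[OF that] S(1) by auto
  have inj: "r i = r j \<longleftrightarrow> i = j" if "i < 5" "j < 5" for i j
    using strict_mono_on_imp_inj_on[OF sm] that by (auto simp: inj_on_def)
  let ?M = "mat 5 5 (\<lambda>(a, b). CM_matrix n $$ (r a, r b))"
  have M: "?M $$ (i, j) = CM_entry (r i) (r j)" if "i < 5" "j < 5" for i j
    using that le by (simp add: CM_matrix_def less_Suc_eq_le)
  have "det ?M \<in> CM n"
  proof (rule CM_generator)
    show "det ?M \<in> CM_minors n"
      unfolding CM_minors_def using sm le[of 4] by (intro CollectI exI[of _ r]) auto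
  qed
  moreover have "det ?M \<in> poly_in (K4_on S)"
  proof (rule poly_in_det[of _ 5])
    fix i j :: nat assume ij: "i < 5" "j < 5"
    then show "?M $$ (i, j) \<in> poly_in (K4_on S)"
      unfolding M[OF ij] using mem[OF ij(1)] mem[OF ij(2)]
      by (auto simp: CM_entry_def K4_on_def min_def max_def)
  qed simp
  moreover have "det ?M \<noteq> 0"
  proof
    assume z: "det ?M = 0"
    let ?h = "psubst Const (\<lambda>_. 1)"
    interpret h: comm_ring_hom ?h by (rule Const_alg.psubst_hom)
    let ?f = "\<lambda>(i, j). if i = j then 0 else (1 :: mpoly)"
    have "map_mat ?h ?M = mat 5 5 ?f"
    proof (rule eq_matI)
      fix i j assume "i < dim_row (mat 5 5 ?f)" "j < dim_col (mat 5 5 ?f)"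
      then have ij: "i < 5" "j < 5" by auto
      then have "map_mat ?h ?M $$ (i, j) = ?h (?M $$ (i, j))" by (intro index_map_mat(1)) simp_all
      also have "?h (?M $$ (i, j)) = ?h (CM_entry (r i) (r j))" by (simp only: M[OF ij])
      also have "\<dots> = ?f (i, j)" using inj[OF ij] by (auto simp: CM_entry_def)
      finally show "map_mat ?h ?M $$ (i, j) = mat 5 5 ?f $$ (i, j)" using ij by simp
    qed auto
    then have "det (mat 5 5 ?f) = 0" using h.hom_det[of ?M] z by simp
    moreover have "det (mat 5 5 ?f) = 4" by (subst det_bordered) auto
    ultimately show False by simp
  qed
  ultimately show ?thesis by blast
qed

lemma K4_circuit:
  assumes "is_K4 n G"
  shows "rigidity_circuit G" "G \<subseteq> Xn n"
proof -
  obtain S where "S \<subseteq> {1..n}" "card S = 4" "G = K4_on S" using assms by (auto simp: is_K4_def)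
  then show "rigidity_circuit G" "G \<subseteq> Xn n" using K4_rigidity_circuit K4_subset_Xn by simp_all
qed

lemma K4_ex_circuit_poly:
  assumes "is_K4 n G"
  shows "\<exists>p. circuit_poly n G p"
proof -
  obtain S where S: "S \<subseteq> {1..n}" "card S = 4" "G = K4_on S" using assms by (auto simp: is_K4_def)
  obtain f where f: "f \<noteq> 0" "f \<in> CM n" "f \<in> poly_in G" using K4_ex_in_CM S by blast
  obtain g where g: "irreducible g" "g dvd f" "g \<in> CM n"
    using ex_irreducible_factor_in_CM[OF f(2,1)] by blast
  have "g \<in> poly_in G" using dvd_vars[OF g(2) f(1)] f(3) by (auto simp: poly_in_def)
  with K4_circuit[OF assms] g have "circuit_poly n G g" by (intro irreducible_circuit_poly) simp_all
  then show ?thesis by (rule exI)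
qed

section \<open>Resultant trees\<close>

lemma CR_subset_Xn: "A \<subseteq> Xn n \<Longrightarrow> B \<subseteq> Xn n \<Longrightarrow> CR A B e \<subseteq> Xn n"
  by (auto simp: CR_def)

text \<open>Any admissible choice of factor is forced: irreducible, in the ideal and supported on
  the new circuit, it is a circuit polynomial there, ready for the next resultant.\<close>

lemma obtainable_imp_circuit_poly:
  assumes "obtainable n D q"
  shows "rigidity_circuit D \<and> D \<subseteq> Xn n \<and> circuit_poly n D q"
  using assms
proof (induction rule: obtainable.induct)
  case (leaf G p)
  then show ?case by (simp add: K4_circuit)
next
  case (node A pA B pB e f)
  have sub: "CR A B e \<subseteq> Xn n" using node.IH by (intro CR_subset_Xn) simp_all
  have R: "Res pA pB e \<noteq> 0" "Res pA pB e \<in> poly_in (CR A B e)"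
    using CR_resultant[of n A pA B pB e] node.IH node.hyps(3,4) by simp_all
  have "f \<in> poly_in (CR A B e)"
    using dvd_vars[OF node.hyps(7) R(1)] R(2) by (simp add: poly_in_def)
  then show ?case
    using irreducible_circuit_poly[OF node.hyps(5) sub node.hyps(6,8)] node.hyps(5) sub by simp
qed

text \<open>The selection never gets stuck, since each resultant is a nonzero element of a prime
  ideal.\<close>

lemma resultant_tree_obtainable: "has_resultant_tree n D \<Longrightarrow> \<exists>q. obtainable n D q"
proof (induction rule: has_resultant_tree.induct)
  case (leaf G)
  then obtain p where "circuit_poly n G p" using K4_ex_circuit_poly by blast
  with leaf have "obtainable n G p" by (rule obtainable.leaf)
  then show ?case by (rule exI)
next
  case (node A B e)
  obtain pA pB where p: "obtainable n A pA" "obtainable n B pB" using node.IH by blast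
  have R: "Res pA pB e \<noteq> 0" "Res pA pB e \<in> CM n"
    using CR_resultant[of n A pA B pB e] obtainable_imp_circuit_poly[OF p(1)]
      obtainable_imp_circuit_poly[OF p(2)] node.hyps(3,4) by simp_all
  obtain f where "irreducible f" "f dvd Res pA pB e" "f \<in> CM n"
    using ex_irreducible_factor_in_CM[OF R(2,1)] by blast
  then show ?case
    by (intro exI[of _ f] obtainable.node[OF p]) (use node in simp_all)
qed

theorem theorem2:
  fixes n :: nat and A B C :: "edge set" and e :: edge and pA pB pC :: mpoly
  assumes "rigidity_circuit A" and "rigidity_circuit B" and "A \<noteq> B"
    and "A \<subseteq> Xn n" and "B \<subseteq> Xn n"
    and "e \<in> A \<inter> B"
    and "C = CR A B e" and "rigidity_circuit C"
    and "circuit_poly n A pA" and "circuit_poly n B pB" and "circuit_poly n C pC"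
  shows "Res pA pB e \<noteq> 0 \<and> Res pA pB e \<in> CM n \<inter> poly_in C
       \<and> pC dvd Res pA pB e
       \<and> (\<forall>f. irreducible f \<and> f dvd Res pA pB e \<and> f \<in> CM n
              \<longrightarrow> (\<exists>c. c \<noteq> 0 \<and> f = Const c * pC))
       \<and> (\<forall>D pD. has_resultant_tree n D \<and> circuit_poly n D pD \<longrightarrow>
              (\<exists>q. obtainable n D q) \<and>
              (\<forall>q. obtainable n D q \<longrightarrow> (\<exists>c. c \<noteq> 0 \<and> q = Const c * pD)))"
proof -
  have CX: "C \<subseteq> Xn n" using CR_subset_Xn assms by blast
  have R: "Res pA pB e \<noteq> 0" "Res pA pB e \<in> CM n" "Res pA pB e \<in> poly_in C"
    using CR_resultant[OF assms(9,10,3,6)] assms(7) by auto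
  have irr: "\<exists>c. c \<noteq> 0 \<and> f = Const c * pC" if f: "irreducible f" "f dvd Res pA pB e" "f \<in> CM n" for f
  proof (rule circuit_poly_unique[OF assms(8) CX assms(11)])
    have "f \<in> poly_in C" using dvd_vars[OF f(2) R(1)] R(3) by (simp add: poly_in_def)
    then show "circuit_poly n C f" using irreducible_circuit_poly[OF assms(8) CX f(1,3)] by simp
  qed
  have uniq: "\<exists>c. c \<noteq> 0 \<and> q = Const c * pD" if "circuit_poly n D pD" "obtainable n D q" for D pD q
    using obtainable_imp_circuit_poly[OF that(2)] circuit_poly_unique[of D n pD q] that(1) by simp
  show ?thesis
  proof (intro conjI allI impI IntI; (elim conjE)?)
    show "\<exists>q. obtainable n D q" if "has_resultant_tree n D" for D
      using that by (rule resultant_tree_obtainable)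
  qed (use irr uniq R circuit_poly_dvd[OF assms(8) CX assms(11) R(2,3)] in simp_all)
qed

end
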